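(* Let $P$ be a simple restricted $\mathcal{S}$-module. Suppose that either there exists an integer $k\ge1$ such that the action of $W_k$ on $P$ is injective, or there exists $c_2\in\mathbb{C}$, $c_2\neq0$, such that $C_2$ acts on $P$ as the scalar $c_2$. Then there exist $d,t\in\mathbb{N}$ and a simple module $V$ over the quotient algebra $\mathfrak{q}^{(d,t)}=\mathcal{T}_d/\mathcal{S}^{(t+d+1,\,t+1,\,t+1)}$ such that $P\cong\mathrm{Ind}(V)=\mathcal{U}(\mathcal{S})\otimes_{\mathcal{U}(\mathcal{T}_d)}V$, where $V$ is regarded as a $\mathcal{T}_d$-module via the quotient map $\mathcal{T}_d\to\mathfrak{q}^{(d,t)}$.
   Context: Everything is over $\mathbb{C}$; $\mathbb{N}=\{0,1,2,\dots\}$. The super extended Ovsienko--Roger algebra $\mathcal{S}$ is the Lie superalgebra with basis $\{L_m,W_m,G_r,C_1,C_2 : m\in\mathbb{Z},\ r\in\mathbb{Z}+\frac12\}$, where $L_m,W_m,C_1,C_2$ are even and $G_r$ is odd, with super-brackets (for $m,n\in\mathbb{Z}$, $r,s\in\mathbb{Z}+\frac12$) $$[L_m,L_n]=(n-m)L_{m+n}+\tfrac{m^3-m}{12}\delta_{m+n,0}C_1,\quad [L_m,W_n]=(m+n)W_{m+n}+\delta_{m+n,0}C_2,$$ $$[L_m,G_r]=rG_{m+r},\quad [G_r,G_s]=(r+s)W_{r+s}+\delta_{r+s,0}C_2,\quad [W_m,W_n]=[W_m,G_r]=[\mathcal{S},C_1]=[\mathcal{S},C_2]=0.$$ For $d\in\mathbb{N}$,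 $\mathcal{T}_d$ is the subalgebra $\mathcal{T}_d=\bigoplus_{i\ge 0}(\mathbb{C}L_i\oplus\mathbb{C}W_{i-d})\oplus\bigoplus_{i\ge1}\mathbb{C}G_{i-\frac12}\oplus\mathbb{C}C_1\oplus\mathbb{C}C_2$. For $r_1,r_2,r_3\in\mathbb{N}$ set $\mathcal{S}^{(r_1,r_2,r_3)}=\bigoplus_{i\ge r_1}\mathbb{C}L_i\oplus\bigoplus_{i\ge r_2}\mathbb{C}W_i\oplus\bigoplus_{i\ge r_3}\mathbb{C}(1-\delta_{i,0})G_{i-\frac12}$; the subspace $\mathcal{S}^{(t+d+1,t+1,t+1)}$ is an ideal of $\mathcal{T}_d$. An $\mathcal{S}$-module $M$ is restricted if for every $v\in M$, $L_iv=W_iv=G_{i+\frac12}v=0$ for all sufficiently large $i$. $\mathcal{U}(\cdot)$ denotes the universal enveloping (super)algebra. Conventions: all modules over Lie superalgebras are $\mathbb{Z}_2$-graded (with $\mathfrak{g}_{\bar i}V_{\bar j}\subseteq V_{\bar i+\bar j}$), all simple modules are assumed non-trivial, and the central elements $C_1,C_2$ are always assumed to act on the modules considered as scalars $c_1,c_2$. *)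

theory Defs
  imports
    "HOL-Algebra.Algebraic_Closure_Type"
    "HOL-Algebra.Free_Abelian_Groups"
    "HOL-Algebra.QuotRing"
    "HOL-Algebra.Module"
    "HOL-Library.Z2"
begin

section \<open>Lie superalgebras and their modules\<close>

text \<open>
  Super vector spaces are complex vector spaces in the sense of \<^locale>\<open>module\<close>, with a
  \<open>\<int>/2\<close>-grading \<open>hpart\<close>; the inherited fields \<open>mult\<close> and \<open>one\<close> of the record play no role.
\<close>

abbreviation CC :: "complex ring"
  where "CC \<equiv> ring_of_type_algebra"

record 'a superspace = "(complex, 'a) module" +
  hpart :: "bit \<Rightarrow> 'a set"

record 'a lie_superalgebra = "'a superspace" +
  bracket :: "'a \<Rightarrow> 'a \<Rightarrow> 'a"

record ('g, 'a) lie_supermodule = "'a superspace" +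
  act :: "'g \<Rightarrow> 'a \<Rightarrow> 'a"

locale superspace = module CC V for V :: "('a, 'b) superspace_scheme" (structure) +
  assumes hpart_submodule: "submodule (hpart V i) CC V"
    and hpart_disjoint: "hpart V 0 \<inter> hpart V 1 = {\<zero>\<^bsub>V\<^esub>}"
    and hpart_sum: "carrier V = hpart V 0 <+>\<^bsub>V\<^esub> hpart V 1"

definition koszul :: "bit \<Rightarrow> bit \<Rightarrow> complex"
  where "koszul i j = (if i = 1 \<and> j = 1 then -1 else 1)"

locale lie_superalgebra = superspace \<gg> for \<gg> :: "('g, 'b) lie_superalgebra_scheme" (structure) +
  assumes bracket_hpart:
      "\<lbrakk>x \<in> hpart \<gg> i; y \<in> hpart \<gg> j\<rbrakk> \<Longrightarrow> bracket \<gg> x y \<in> hpart \<gg> (i + j)"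
    and bracket_add_left: "\<lbrakk>x \<in> carrier \<gg>; y \<in> carrier \<gg>; z \<in> carrier \<gg>\<rbrakk> \<Longrightarrow>
      bracket \<gg> (x \<oplus>\<^bsub>\<gg>\<^esub> y) z = bracket \<gg> x z \<oplus>\<^bsub>\<gg>\<^esub> bracket \<gg> y z"
    and bracket_add_right: "\<lbrakk>x \<in> carrier \<gg>; y \<in> carrier \<gg>; z \<in> carrier \<gg>\<rbrakk> \<Longrightarrow>
      bracket \<gg> x (y \<oplus>\<^bsub>\<gg>\<^esub> z) = bracket \<gg> x y \<oplus>\<^bsub>\<gg>\<^esub> bracket \<gg> x z"
    and bracket_smult_left: "\<lbrakk>x \<in> carrier \<gg>; y \<in> carrier \<gg>\<rbrakk> \<Longrightarrow>
      bracket \<gg> (c \<odot>\<^bsub>\<gg>\<^esub> x) y = c \<odot>\<^bsub>\<gg>\<^esub> bracket \<gg> x y"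
    and bracket_smult_right: "\<lbrakk>x \<in> carrier \<gg>; y \<in> carrier \<gg>\<rbrakk> \<Longrightarrow>
      bracket \<gg> x (c \<odot>\<^bsub>\<gg>\<^esub> y) = c \<odot>\<^bsub>\<gg>\<^esub> bracket \<gg> x y"
    and bracket_skew: "\<lbrakk>x \<in> hpart \<gg> i; y \<in> hpart \<gg> j\<rbrakk> \<Longrightarrow>
      bracket \<gg> x y = \<ominus>\<^bsub>\<gg>\<^esub> (koszul i j \<odot>\<^bsub>\<gg>\<^esub> bracket \<gg> y x)"
    and bracket_jacobi: "\<lbrakk>x \<in> hpart \<gg> i; y \<in> hpart \<gg> j; z \<in> hpart \<gg> k\<rbrakk> \<Longrightarrow>
      bracket \<gg> x (bracket \<gg> y z) =
        bracket \<gg> (bracket \<gg> x y) z \<oplus>\<^bsub>\<gg>\<^esub> koszul i j \<odot>\<^bsub>\<gg>\<^esub> bracket \<gg> y (bracket \<gg> x z)"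

locale lie_supermodule = lie_superalgebra \<gg> + M: superspace M
  for \<gg> :: "('g, 'b) lie_superalgebra_scheme" (structure)
    and M :: "('g, 'v, 'c) lie_supermodule_scheme" (structure) +
  assumes act_hpart: "\<lbrakk>x \<in> hpart \<gg> i; v \<in> hpart M j\<rbrakk> \<Longrightarrow> act M x v \<in> hpart M (i + j)"
    and act_add_left: "\<lbrakk>x \<in> carrier \<gg>; y \<in> carrier \<gg>; v \<in> carrier M\<rbrakk> \<Longrightarrow>
      act M (x \<oplus>\<^bsub>\<gg>\<^esub> y) v = act M x v \<oplus>\<^bsub>M\<^esub> act M y v"
    and act_add_right: "\<lbrakk>x \<in> carrier \<gg>; v \<in> carrier M; w \<in> carrier M\<rbrakk> \<Longrightarrow>
      act M x (v \<oplus>\<^bsub>M\<^esub> w) = act M x v \<oplus>\<^bsub>M\<^esub> act M x w"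
    and act_smult_left: "\<lbrakk>x \<in> carrier \<gg>; v \<in> carrier M\<rbrakk> \<Longrightarrow>
      act M (c \<odot>\<^bsub>\<gg>\<^esub> x) v = c \<odot>\<^bsub>M\<^esub> act M x v"
    and act_smult_right: "\<lbrakk>x \<in> carrier \<gg>; v \<in> carrier M\<rbrakk> \<Longrightarrow>
      act M x (c \<odot>\<^bsub>M\<^esub> v) = c \<odot>\<^bsub>M\<^esub> act M x v"
    and act_bracket: "\<lbrakk>x \<in> hpart \<gg> i; y \<in> hpart \<gg> j; v \<in> carrier M\<rbrakk> \<Longrightarrow>
      act M (bracket \<gg> x y) v =
        act M x (act M y v) \<ominus>\<^bsub>M\<^esub> koszul i j \<odot>\<^bsub>M\<^esub> act M y (act M x v)"

definition graded_submodule ::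
    "('g, 'b) lie_superalgebra_scheme \<Rightarrow> ('g, 'v, 'c) lie_supermodule_scheme \<Rightarrow> 'v set \<Rightarrow> bool"
  where "graded_submodule \<gg> M N \<longleftrightarrow>
    submodule N CC M \<and>
    (\<forall>x\<in>carrier \<gg>. \<forall>v\<in>N. act M x v \<in> N) \<and>
    N = (N \<inter> hpart M 0) <+>\<^bsub>M\<^esub> (N \<inter> hpart M 1)"

text \<open>Simple modules are required not to have zero action.\<close>

definition simple_supermodule ::
    "('g, 'b) lie_superalgebra_scheme \<Rightarrow> ('g, 'v, 'c) lie_supermodule_scheme \<Rightarrow> bool"
  where "simple_supermodule \<gg> M \<longleftrightarrow>
    lie_supermodule \<gg> M \<and>
    carrier M \<noteq> {\<zero>\<^bsub>M\<^esub>} \<and>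
    (\<forall>N. graded_submodule \<gg> M N \<longrightarrow> N = {\<zero>\<^bsub>M\<^esub>} \<or> N = carrier M) \<and>
    (\<exists>x\<in>carrier \<gg>. \<exists>v\<in>carrier M. act M x v \<noteq> \<zero>\<^bsub>M\<^esub>)"

definition acts_as_scalar :: "('g, 'v, 'c) lie_supermodule_scheme \<Rightarrow> 'g \<Rightarrow> complex \<Rightarrow> bool"
  where "acts_as_scalar M z c \<longleftrightarrow> (\<forall>v\<in>carrier M. act M z v = c \<odot>\<^bsub>M\<^esub> v)"

definition supermodule_iso ::
    "('g, 'b) lie_superalgebra_scheme \<Rightarrow> ('g, 'v, 'c) lie_supermodule_scheme \<Rightarrow>
     ('g, 'w, 'd) lie_supermodule_scheme \<Rightarrow> bool"
  where "supermodule_iso \<gg> M N \<longleftrightarrow> (\<exists>f.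
    bij_betw f (carrier M) (carrier N) \<and>
    (\<forall>v\<in>carrier M. \<forall>w\<in>carrier M. f (v \<oplus>\<^bsub>M\<^esub> w) = f v \<oplus>\<^bsub>N\<^esub> f w) \<and>
    (\<forall>c. \<forall>v\<in>carrier M. f (c \<odot>\<^bsub>M\<^esub> v) = c \<odot>\<^bsub>N\<^esub> f v) \<and>
    (\<forall>x\<in>carrier \<gg>. \<forall>v\<in>carrier M. f (act M x v) = act N x (f v)) \<and>
    (\<forall>i. f ` hpart M i = hpart N i))"

text \<open>Graded subalgebras are given by their carrier sets.\<close>

definition sub_lsa :: "('g, 'b) lie_superalgebra_scheme \<Rightarrow> 'g set \<Rightarrow> ('g, 'b) lie_superalgebra_scheme"
  where "sub_lsa \<gg> H = \<gg>\<lparr>carrier := H, hpart := \<lambda>i. hpart \<gg> i \<inter> H\<rparr>"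

definition quot_lsa :: "('g, 'b) lie_superalgebra_scheme \<Rightarrow> 'g set \<Rightarrow> 'g set lie_superalgebra"
  where "quot_lsa \<gg> I =
    \<lparr>carrier = a_rcosets\<^bsub>\<gg>\<^esub> I, monoid.mult = undefined, one = undefined,
     ring.zero = I, add = set_add \<gg>,
     module.smult = (\<lambda>c A. \<Union>x\<in>A. I +>\<^bsub>\<gg>\<^esub> (c \<odot>\<^bsub>\<gg>\<^esub> x)),
     hpart = (\<lambda>i. (\<lambda>x. I +>\<^bsub>\<gg>\<^esub> x) ` hpart \<gg> i),
     bracket = (\<lambda>A B. \<Union>x\<in>A. \<Union>y\<in>B. I +>\<^bsub>\<gg>\<^esub> bracket \<gg> x y)\<rparr>"

definition pullback ::
    "('g \<Rightarrow> 'h) \<Rightarrow> ('h, 'v, 'c) lie_supermodule_scheme \<Rightarrow> ('g, 'v) lie_supermodule"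
  where "pullback f M =
    \<lparr>carrier = carrier M, monoid.mult = monoid.mult M, one = one M,
     ring.zero = ring.zero M, add = add M,
     module.smult = module.smult M, hpart = hpart M, act = (\<lambda>x. act M (f x))\<rparr>"


section \<open>The universal enveloping algebra\<close>

text \<open>
  Words form the free monoid, so that the finitely supported functions
  \<open>'g gword \<Rightarrow>\<^sub>0 complex\<close> form the free associative algebra on the elements of \<open>'g\<close>, with the ring structure of
  \<^theory>\<open>HOL-Library.Poly_Mapping\<close>.
\<close>

datatype 'g gword = Word (letters: "'g list")

instantiation gword :: (type) monoid_add
begin

definition zero_gword :: "'a gword"
  where "0 = Word []"

definition plus_gword :: "'a gword \<Rightarrow> 'a gword \<Rightarrow> 'a gword"
  where "u + v = Word (letters u @ letters v)"

instance
  by standard (simp_all add: zero_gword_def plus_gword_def)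

end

definition free_alg :: "('g, 'b) lie_superalgebra_scheme \<Rightarrow> ('g gword \<Rightarrow>\<^sub>0 complex) ring"
  where "free_alg \<gg> =
    ring_of_type_algebra
      \<lparr>carrier := {p. \<forall>w\<in>Poly_Mapping.keys p. set (letters w) \<subseteq> carrier \<gg>}\<rparr>"

definition letter :: "'g \<Rightarrow> 'g gword \<Rightarrow>\<^sub>0 complex"
  where "letter x = Poly_Mapping.single (Word [x]) 1"

definition const :: "complex \<Rightarrow> 'g gword \<Rightarrow>\<^sub>0 complex"
  where "const c = Poly_Mapping.single 0 c"

definition env_rel :: "('g, 'b) lie_superalgebra_scheme \<Rightarrow> ('g gword \<Rightarrow>\<^sub>0 complex) set"
  where "env_rel \<gg> =
    {letter (x \<oplus>\<^bsub>\<gg>\<^esub> y) - letter x - letter y | x y. x \<in> carrier \<gg> \<and> y \<in> carrier \<gg>} \<union>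
    {letter (c \<odot>\<^bsub>\<gg>\<^esub> x) - const c * letter x | c x. x \<in> carrier \<gg>} \<union>
    {letter x * letter y - const (koszul i j) * letter y * letter x - letter (bracket \<gg> x y)
      | x y i j. x \<in> hpart \<gg> i \<and> y \<in> hpart \<gg> j}"

definition env_ideal :: "('g, 'b) lie_superalgebra_scheme \<Rightarrow> ('g gword \<Rightarrow>\<^sub>0 complex) set"
  where "env_ideal \<gg> = Idl\<^bsub>free_alg \<gg>\<^esub> (env_rel \<gg>)"

definition env :: "('g, 'b) lie_superalgebra_scheme \<Rightarrow> ('g gword \<Rightarrow>\<^sub>0 complex) set ring"
  where "env \<gg> = free_alg \<gg> Quot env_ideal \<gg>"

definition env_class ::
    "('g, 'b) lie_superalgebra_scheme \<Rightarrow> ('g gword \<Rightarrow>\<^sub>0 complex) \<Rightarrow> ('g gword \<Rightarrow>\<^sub>0 complex) set"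
  where "env_class \<gg> p = env_ideal \<gg> +>\<^bsub>free_alg \<gg>\<^esub> p"

definition word_parity :: "('g, 'b) lie_superalgebra_scheme \<Rightarrow> 'g gword \<Rightarrow> bit \<Rightarrow> bool"
  where "word_parity \<gg> w i \<longleftrightarrow>
    (\<exists>is. list_all2 (\<lambda>x j. x \<in> hpart \<gg> j) (letters w) is \<and> sum_list is = i)"

definition env_hpart ::
    "('g, 'b) lie_superalgebra_scheme \<Rightarrow> bit \<Rightarrow> ('g gword \<Rightarrow>\<^sub>0 complex) set set"
  where "env_hpart \<gg> i = env_class \<gg> ` {p. \<forall>w\<in>Poly_Mapping.keys p. word_parity \<gg> w i}"

text \<open>
  The homomorphism from the enveloping algebra of a subalgebra of \<open>\<gg>\<close> to that of \<open>\<gg>\<close>: a class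
  modulo the smaller ideal is sent to the class modulo \<^term>\<open>env_ideal \<gg>\<close> containing it.
\<close>

definition env_incl :: "('g, 'b) lie_superalgebra_scheme \<Rightarrow>
    ('g gword \<Rightarrow>\<^sub>0 complex) set \<Rightarrow> ('g gword \<Rightarrow>\<^sub>0 complex) set"
  where "env_incl \<gg> A = env_ideal \<gg> <+>\<^bsub>free_alg \<gg>\<^esub> A"

text \<open>
  The action of the enveloping algebra on a module. All representatives of a class act alike, so
  the image below is a singleton.
\<close>

definition free_act :: "('g, 'v, 'c) lie_supermodule_scheme \<Rightarrow> ('g gword \<Rightarrow>\<^sub>0 complex) \<Rightarrow> 'v \<Rightarrow> 'v"
  where "free_act M p v =
    (\<Oplus>\<^bsub>M\<^esub>w\<in>Poly_Mapping.keys p. Poly_Mapping.lookup p w \<odot>\<^bsub>M\<^esub> foldr (act M) (letters w) v)"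

definition env_act ::
    "('g, 'v, 'c) lie_supermodule_scheme \<Rightarrow> ('g gword \<Rightarrow>\<^sub>0 complex) set \<Rightarrow> 'v \<Rightarrow> 'v"
  where "env_act M A v = the_elem ((\<lambda>p. free_act M p v) ` A)"


section \<open>Tensor products and induced modules\<close>

text \<open>
  The tensor product over the ring \<open>A\<close> of a right module \<open>M\<close> and a left module \<open>N\<close> with actions
  \<open>r\<close> and \<open>l\<close>, as an abelian group (written multiplicatively, as in \<^const>\<open>free_Abelian_group\<close>).
\<close>

definition tensor_rel ::
    "('r, 'a) ring_scheme \<Rightarrow> ('m, 'b) ring_scheme \<Rightarrow> ('n, 'c) ring_scheme \<Rightarrow>
     ('m \<Rightarrow> 'r \<Rightarrow> 'm) \<Rightarrow> ('r \<Rightarrow> 'n \<Rightarrow> 'n) \<Rightarrow> ('m \<times> 'n \<Rightarrow>\<^sub>0 int) set"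
  where "tensor_rel A M N r l =
    {frag_of (x \<oplus>\<^bsub>M\<^esub> y, v) - frag_of (x, v) - frag_of (y, v)
      | x y v. x \<in> carrier M \<and> y \<in> carrier M \<and> v \<in> carrier N} \<union>
    {frag_of (x, v \<oplus>\<^bsub>N\<^esub> w) - frag_of (x, v) - frag_of (x, w)
      | x v w. x \<in> carrier M \<and> v \<in> carrier N \<and> w \<in> carrier N} \<union>
    {frag_of (r x a, v) - frag_of (x, l a v)
      | x a v. x \<in> carrier M \<and> a \<in> carrier A \<and> v \<in> carrier N}"

definition tensor_ker ::
    "('r, 'a) ring_scheme \<Rightarrow> ('m, 'b) ring_scheme \<Rightarrow> ('n, 'c) ring_scheme \<Rightarrow>
     ('m \<Rightarrow> 'r \<Rightarrow> 'm) \<Rightarrow> ('r \<Rightarrow> 'n \<Rightarrow> 'n) \<Rightarrow> ('m \<times> 'n \<Rightarrow>\<^sub>0 int) set"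
  where "tensor_ker A M N r l =
    generate (free_Abelian_group (carrier M \<times> carrier N)) (tensor_rel A M N r l)"

definition tensor_prod ::
    "('r, 'a) ring_scheme \<Rightarrow> ('m, 'b) ring_scheme \<Rightarrow> ('n, 'c) ring_scheme \<Rightarrow>
     ('m \<Rightarrow> 'r \<Rightarrow> 'm) \<Rightarrow> ('r \<Rightarrow> 'n \<Rightarrow> 'n) \<Rightarrow> ('m \<times> 'n \<Rightarrow>\<^sub>0 int) set monoid"
  where "tensor_prod A M N r l =
    free_Abelian_group (carrier M \<times> carrier N) Mod tensor_ker A M N r l"

text \<open>
  For a graded subalgebra \<open>H\<close> of \<open>\<gg>\<close> and an \<open>H\<close>-module \<open>V\<close>, the tensor product of
  \<^term>\<open>env \<gg>\<close> and \<open>V\<close> over \<^term>\<open>env (sub_lsa \<gg> H)\<close>.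
\<close>

type_synonym ('g, 'v) ind = "(('g gword \<Rightarrow>\<^sub>0 complex) set \<times> 'v \<Rightarrow>\<^sub>0 int) set"

definition ind_ker ::
    "('g, 'b) lie_superalgebra_scheme \<Rightarrow> 'g set \<Rightarrow> ('g, 'v, 'c) lie_supermodule_scheme \<Rightarrow> ('g, 'v) ind"
  where "ind_ker \<gg> H V =
    tensor_ker (env (sub_lsa \<gg> H)) (env \<gg>) V (\<lambda>u a. u \<otimes>\<^bsub>env \<gg>\<^esub> env_incl \<gg> a) (env_act V)"

definition ind_group ::
    "('g, 'b) lie_superalgebra_scheme \<Rightarrow> 'g set \<Rightarrow> ('g, 'v, 'c) lie_supermodule_scheme \<Rightarrow>
     ('g, 'v) ind monoid"
  where "ind_group \<gg> H V =
    tensor_prod (env (sub_lsa \<gg> H)) (env \<gg>) V (\<lambda>u a. u \<otimes>\<^bsub>env \<gg>\<^esub> env_incl \<gg> a) (env_act V)"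

definition ind_class ::
    "('g, 'b) lie_superalgebra_scheme \<Rightarrow> 'g set \<Rightarrow> ('g, 'v, 'c) lie_supermodule_scheme \<Rightarrow>
     (('g gword \<Rightarrow>\<^sub>0 complex) set \<times> 'v \<Rightarrow>\<^sub>0 int) \<Rightarrow> ('g, 'v) ind"
  where "ind_class \<gg> H V t =
    ind_ker \<gg> H V #>\<^bsub>free_Abelian_group (carrier (env \<gg>) \<times> carrier V)\<^esub> t"

text \<open>Left multiplication by \<open>u\<close>, that is, the endomorphism taking \<open>u' \<otimes> v\<close> to \<open>u u' \<otimes> v\<close>.\<close>

definition ind_mult ::
    "('g, 'b) lie_superalgebra_scheme \<Rightarrow> 'g set \<Rightarrow> ('g, 'v, 'c) lie_supermodule_scheme \<Rightarrow>
     ('g gword \<Rightarrow>\<^sub>0 complex) set \<Rightarrow> ('g, 'v) ind \<Rightarrow> ('g, 'v) ind"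
  where "ind_mult \<gg> H V u T =
    (\<Union>t\<in>T. ind_class \<gg> H V (frag_extend (\<lambda>(u', v). frag_of (u \<otimes>\<^bsub>env \<gg>\<^esub> u', v)) t))"

definition Ind ::
    "('g, 'b) lie_superalgebra_scheme \<Rightarrow> 'g set \<Rightarrow> ('g, 'v, 'c) lie_supermodule_scheme \<Rightarrow>
     ('g, ('g, 'v) ind) lie_supermodule"
  where "Ind \<gg> H V =
    \<lparr>carrier = carrier (ind_group \<gg> H V), monoid.mult = undefined, one = undefined,
     ring.zero = one (ind_group \<gg> H V), add = monoid.mult (ind_group \<gg> H V),
     module.smult = (\<lambda>c. ind_mult \<gg> H V (env_class \<gg> (const c))),
     hpart = (\<lambda>i. generate (ind_group \<gg> H V)
       {ind_class \<gg> H V (frag_of (u, v)) | u v j k.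
          u \<in> env_hpart \<gg> j \<and> v \<in> hpart V k \<and> j + k = i}),
     act = (\<lambda>x. ind_mult \<gg> H V (env_class \<gg> (letter x)))\<rparr>"


section \<open>The super extended Ovsienko--Roger algebra\<close>

text \<open>The index \<^term>\<open>iG i\<close> stands for the odd basis element \<open>G\<^sub>r\<close> with \<open>r = i + 1/2\<close>.\<close>

datatype sor_index = iL int | iW int | iG int | iC1 | iC2

type_synonym sor = "sor_index \<Rightarrow>\<^sub>0 complex"

definition sor_smult :: "complex \<Rightarrow> sor \<Rightarrow> sor"
  where "sor_smult c = Poly_Mapping.map ((*) c)"

definition gen :: "sor_index \<Rightarrow> sor"
  where "gen a = Poly_Mapping.single a 1"

definition br_LL :: "int \<Rightarrow> int \<Rightarrow> sor"
  where "br_LL m n = sor_smult (of_int (n - m)) (gen (iL (m + n))) +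
    (if m + n = 0 then sor_smult (of_int (m ^ 3 - m) / 12) (gen iC1) else 0)"

definition br_LW :: "int \<Rightarrow> int \<Rightarrow> sor"
  where "br_LW m n = sor_smult (of_int (m + n)) (gen (iW (m + n))) +
    (if m + n = 0 then gen iC2 else 0)"

definition br_LG :: "int \<Rightarrow> int \<Rightarrow> sor"
  where "br_LG m i = sor_smult (of_int i + 1 / 2) (gen (iG (m + i)))"

definition br_GG :: "int \<Rightarrow> int \<Rightarrow> sor"
  where "br_GG i j = sor_smult (of_int (i + j + 1)) (gen (iW (i + j + 1))) +
    (if i + j + 1 = 0 then gen iC2 else 0)"

fun basis_bracket :: "sor_index \<Rightarrow> sor_index \<Rightarrow> sor"
  where
    "basis_bracket (iL m) (iL n) = br_LL m n"
  | "basis_bracket (iL m) (iW n) = br_LW m n"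
  | "basis_bracket (iW n) (iL m) = - br_LW m n"
  | "basis_bracket (iL m) (iG i) = br_LG m i"
  | "basis_bracket (iG i) (iL m) = - br_LG m i"
  | "basis_bracket (iG i) (iG j) = br_GG i j"
  | "basis_bracket _ _ = 0"

definition sor_bracket :: "sor \<Rightarrow> sor \<Rightarrow> sor"
  where "sor_bracket x y =
    (\<Sum>a\<in>Poly_Mapping.keys x. \<Sum>b\<in>Poly_Mapping.keys y.
      sor_smult (Poly_Mapping.lookup x a * Poly_Mapping.lookup y b) (basis_bracket a b))"

fun index_parity :: "sor_index \<Rightarrow> bit"
  where
    "index_parity (iG i) = 1"
  | "index_parity _ = 0"

definition sor_span :: "sor_index set \<Rightarrow> sor set"
  where "sor_span B = {x. Poly_Mapping.keys x \<subseteq> B}"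

definition SOR :: "sor lie_superalgebra"
  where "SOR =
    \<lparr>carrier = UNIV, monoid.mult = undefined, one = undefined, ring.zero = 0, add = (+),
     module.smult = sor_smult, hpart = (\<lambda>i. sor_span {a. index_parity a = i}),
     bracket = sor_bracket\<rparr>"

definition Td :: "nat \<Rightarrow> sor set"
  where "Td d = sor_span
    ({iL i | i. 0 \<le> i} \<union> {iW (i - int d) | i. 0 \<le> i} \<union> {iG (i - 1) | i. 1 \<le> i} \<union> {iC1, iC2})"

definition Sr :: "nat \<Rightarrow> nat \<Rightarrow> nat \<Rightarrow> sor set"
  where "Sr r1 r2 r3 = sor_span
    ({iL i | i. int r1 \<le> i} \<union> {iW i | i. int r2 \<le> i} \<union> {iG (i - 1) | i. int r3 \<le> i \<and> i \<noteq> 0})"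

definition qdt :: "nat \<Rightarrow> nat \<Rightarrow> sor set lie_superalgebra"
  where "qdt d t = quot_lsa (sub_lsa SOR (Td d)) (Sr (t + d + 1) (t + 1) (t + 1))"

definition quot_map :: "nat \<Rightarrow> nat \<Rightarrow> sor \<Rightarrow> sor set"
  where "quot_map d t x = Sr (t + d + 1) (t + 1) (t + 1) +>\<^bsub>sub_lsa SOR (Td d)\<^esub> x"

definition restricted :: "(sor, 'v, 'c) lie_supermodule_scheme \<Rightarrow> bool"
  where "restricted M \<longleftrightarrow> (\<forall>v\<in>carrier M. \<exists>N. \<forall>i\<ge>N.
    act M (gen (iL i)) v = \<zero>\<^bsub>M\<^esub> \<and>
    act M (gen (iW i)) v = \<zero>\<^bsub>M\<^esub> \<and>
    act M (gen (iG i)) v = \<zero>\<^bsub>M\<^esub>)"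

end

theory Submission
  imports Defs
begin

text \<open>
  Let \<open>P\<^sub>d\<^sub>,\<^sub>t\<close> be the space of vectors killed by \<^term>\<open>Sr (t + d + 1) (t + 1) (t + 1)\<close>, and choose
  \<open>t\<close> minimal with some \<open>P\<^sub>d\<^sub>,\<^sub>t\<close> nonzero. Minimality makes \<open>W\<^sub>t\<close> injective on \<open>V = P\<^sub>d\<^sub>,\<^sub>t\<close>, hence on
  \<open>P\<close>, because its locally nilpotent vectors form a submodule; for \<open>t = 0\<close> the hypothesis forces
  \<open>c\<^sub>2 \<noteq> 0\<close>. The generators of the ideal pair with the generators outside
  \<open>\<T>\<^sub>d\<close> through brackets that act as this injective operator, and a leading-term argument shows that in
  any module generated by a \<open>\<T>\<^sub>d\<close>-submodule \<open>V' \<subseteq> V\<close> a vector killed by the ideal modulo a submodule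
  not meeting \<open>V'\<close> already lies in \<open>V'\<close>. For the induced module and the kernel of
  \<open>Ind(V) \<rightarrow> P\<close> this gives injectivity; for \<open>P\<close> itself it gives \<open>V' = V\<close>, the simplicity of \<open>V\<close>.
  Only the spanning half of the Poincare-Birkhoff-Witt theorem enters.
\<close>

section \<open>Adjoining lowering operators\<close>

text \<open>Commutation relations are required only modulo a subspace \<open>Z\<close>, so that one
  argument covers two quotients of the same free module: \<open>Z\<close> is the relation space of
  the induced module when injectivity is at stake, and the kernel \<open>K\<close> of the map to
  \<open>P\<close> when simplicity is. Injectivity of \<open>\<theta>\<close> on the induced module
  is not known beforehand either: it comes from \<open>P\<close> and so holds modulo
  \<open>K\<close> only, and \<open>V \<inter> K \<subseteq> Z\<close> converts membership in
  \<open>K\<close> back into vanishing. The lowering operators are adjoined in the order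
  \<open>W\<close>, \<open>G\<close>, \<open>L\<close>. The \<open>W\<close> commute with each other
  and are treated as polynomial variables, one at a time; each \<open>G\<close> is needed at most
  once, because its square is a multiple of some \<open>W\<close>. The \<open>L\<close> commute
  neither with each other nor with \<open>\<theta>\<close>, so for them terms can be compared only
  up to lower filtration degree, and injectivity of \<open>\<theta>\<close> on the graded pieces has
  to be proved along with the comparison.\<close>

locale lowering = vector_space scale
  for scale :: "complex \<Rightarrow> 'm::ab_group_add \<Rightarrow> 'm" (infixr \<open>*s\<close> 75) +
  fixes L W G :: "int \<Rightarrow> 'm \<Rightarrow> 'm" and c2 :: complex and Z :: "'m set"
  assumes Z_subspace: "subspace Z"
    and L_add: "L m (x + y) = L m x + L m y" and L_scale: "L m (c *s x) = c *s L m x"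
    and W_add: "W m (x + y) = W m x + W m y" and W_scale: "W m (c *s x) = c *s W m x"
    and G_add: "G m (x + y) = G m x + G m y" and G_scale: "G m (c *s x) = c *s G m x"
    and Z_stable: "x \<in> Z \<Longrightarrow> L m x \<in> Z" "x \<in> Z \<Longrightarrow> W m x \<in> Z" "x \<in> Z \<Longrightarrow> G m x \<in> Z"
    and LL: "\<exists>c. L m (L n x) - (L n (L m x) + of_int (n - m) *s L (m + n) x + c *s x) \<in> Z"
    and LW: "L m (W n x) -
      (W n (L m x) + of_int (m + n) *s W (m + n) x + (if m + n = 0 then c2 else 0) *s x) \<in> Z"
    and LG: "L m (G i x) - (G i (L m x) + (of_int i + 1 / 2) *s G (m + i) x) \<in> Z"
    and GG: "G i (G j x) - (- G j (G i x) + of_int (i + j + 1) *s W (i + j + 1) x +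
      (if i + j + 1 = 0 then c2 else 0) *s x) \<in> Z"
    and WW: "W m (W n x) - W n (W m x) \<in> Z"
    and WG: "W m (G i x) - G i (W m x) \<in> Z"
begin

text \<open>Such sets are the preimages of the subspaces of the quotient by \<open>Z\<close>. In the
  same way \<open>eqv\<close> is equality in that quotient, and \<open>endo\<close> singles out the
  linear maps that descend to it.\<close>

definition zspace :: "'m set \<Rightarrow> bool" where "zspace A \<longleftrightarrow> subspace A \<and> Z \<subseteq> A"

definition eqv :: "'m \<Rightarrow> 'm \<Rightarrow> bool" (infix \<open>\<doteq>\<close> 50) where "x \<doteq> y \<longleftrightarrow> x - y \<in> Z"

definition endo :: "('m \<Rightarrow> 'm) \<Rightarrow> bool" where
  "endo f \<longleftrightarrow> (\<forall>x y. f (x + y) = f x + f y) \<and> (\<forall>c x. f (c *s x) = c *s f x) \<and> (\<forall>x\<in>Z. f x \<in> Z)"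

lemma endo_L: "endo (L m)" and endo_W: "endo (W m)" and endo_G: "endo (G m)"
  unfolding endo_def using L_add L_scale W_add W_scale G_add G_scale Z_stable by auto

lemma endo_add: "endo f \<Longrightarrow> f (x + y) = f x + f y"
  and endo_scale: "endo f \<Longrightarrow> f (c *s x) = c *s f x"
  and endo_Z: "endo f \<Longrightarrow> x \<in> Z \<Longrightarrow> f x \<in> Z"
  by (auto simp: endo_def)

lemma endo_minus: "endo f \<Longrightarrow> f (- x) = - f x"
  by (metis endo_scale scale_minus_left scale_one)

lemma endo_diff: "endo f \<Longrightarrow> f (x - y) = f x - f y"
  by (metis endo_add endo_minus add_uminus_conv_diff)

lemma endo_zero: "endo f \<Longrightarrow> f 0 = 0"
  by (metis endo_diff diff_self)

lemma endo_funpow: "endo f \<Longrightarrow> endo (f ^^ n)"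
  by (induction n) (auto simp: endo_def)

lemma endo_eqv: "endo f \<Longrightarrow> x \<doteq> y \<Longrightarrow> f x \<doteq> f y"
  unfolding eqv_def by (metis endo_diff endo_Z)

lemma zspaceD: assumes "zspace A"
  shows zspace_subspace: "subspace A" and zspace_Z: "x \<in> Z \<Longrightarrow> x \<in> A"
    and zspace_0: "0 \<in> A" and zspace_add: "x \<in> A \<Longrightarrow> y \<in> A \<Longrightarrow> x + y \<in> A"
    and zspace_diff: "x \<in> A \<Longrightarrow> y \<in> A \<Longrightarrow> x - y \<in> A"
    and zspace_minus: "x \<in> A \<Longrightarrow> - x \<in> A"
    and zspace_scale: "x \<in> A \<Longrightarrow> c *s x \<in> A"
  using assms unfolding zspace_def
  by (auto simp: subspace_0 subspace_add subspace_diff subspace_scale subspace_neg)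

lemma zspace_Z_self: "zspace Z" and zspace_UNIV: "zspace UNIV"
  using Z_subspace by (auto simp: zspace_def)

lemma zspace_eqv: "zspace A \<Longrightarrow> x \<doteq> y \<Longrightarrow> y \<in> A \<Longrightarrow> x \<in> A"
  unfolding eqv_def by (metis diff_add_cancel zspace_Z zspace_add)

lemma eqv_refl [simp]: "x \<doteq> x"
  unfolding eqv_def by (simp add: zspace_0[OF zspace_Z_self])

lemma eqv_sym: "x \<doteq> y \<Longrightarrow> y \<doteq> x"
  unfolding eqv_def by (metis minus_diff_eq zspace_minus[OF zspace_Z_self])

lemma eqv_trans [trans]: "x \<doteq> y \<Longrightarrow> y \<doteq> z \<Longrightarrow> x \<doteq> z"
  unfolding eqv_def using zspace_add[OF zspace_Z_self, of "x - y" "y - z"] by simp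

lemma eqv_add: "x \<doteq> y \<Longrightarrow> x' \<doteq> y' \<Longrightarrow> x + x' \<doteq> y + y'"
  unfolding eqv_def using zspace_add[OF zspace_Z_self, of "x - y" "x' - y'"] by (simp add: algebra_simps)

lemma eqv_scale: "x \<doteq> y \<Longrightarrow> c *s x \<doteq> c *s y"
  unfolding eqv_def using zspace_scale[OF zspace_Z_self, of "x - y" c] by (simp add: scale_right_diff_distrib)

lemma eqv_ZD: "x \<doteq> y \<Longrightarrow> y \<in> Z \<Longrightarrow> x \<in> Z"
  using zspace_eqv[OF zspace_Z_self] .

text \<open>Solves a commutation relation for the opposite order of the two factors.\<close>

lemma eqv_swap: "a \<doteq> b + p + q \<Longrightarrow> b \<doteq> a + - p + - q"
proof -
  assume "a \<doteq> b + p + q"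
  then have "- (a - (b + p + q)) \<in> Z"
    unfolding eqv_def by (rule zspace_minus[OF zspace_Z_self])
  moreover have "- (a - (b + p + q)) = b - (a + - p + - q)"
    by (simp add: algebra_simps)
  ultimately show ?thesis
    unfolding eqv_def by metis
qed

text \<open>The scalar in the first relation is the contribution of the central element
  \<open>C1\<close>. Its value never matters: all that counts is that the term contains no further
  operator.\<close>

lemma LL': "\<exists>c. L m (L n x) \<doteq> L n (L m x) + of_int (n - m) *s L (m + n) x + c *s x"
  and LW': "L m (W n x) \<doteq>
      W n (L m x) + of_int (m + n) *s W (m + n) x + (if m + n = 0 then c2 else 0) *s x"
  and LG': "L m (G i x) \<doteq> G i (L m x) + (of_int i + 1 / 2) *s G (m + i) x"
  and GG': "G i (G j x) \<doteq> - G j (G i x) + of_int (i + j + 1) *s W (i + j + 1) x +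
      (if i + j + 1 = 0 then c2 else 0) *s x"
  and WW': "W m (W n x) \<doteq> W n (W m x)"
  and WG': "W m (G i x) \<doteq> G i (W m x)"
  unfolding eqv_def by (rule LL LW LG GG WW WG)+

lemma GW': "G i (W m x) \<doteq> W m (G i x)"
  by (rule eqv_sym[OF WG'])

lemma WL': "W n (L m x) \<doteq>
      L m (W n x) + - of_int (m + n) *s W (m + n) x + - (if m + n = 0 then c2 else 0) *s x"
  using eqv_swap[OF LW'] by (simp only: scale_minus_left)

lemma zspace_UN_chain:
  assumes "\<And>n::nat. zspace (A n)" "\<And>n. A n \<subseteq> A (Suc n)"
  shows "zspace (\<Union>n. A n)"
proof -
  have mono: "A i \<subseteq> A j" if "i \<le> j" for i j
    using that assms(2) by (rule lift_Suc_mono_le[of A, rotated])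
  have "x + y \<in> (\<Union>n. A n)" if "x \<in> A i" "y \<in> A j" for x y i j
    using zspace_add[OF assms(1), of x "max i j" y] mono[of i "max i j"] mono[of j "max i j"] that by auto
  then have "subspace (\<Union>n. A n)"
    unfolding subspace_def
  proof (intro conjI ballI allI)
    show "0 \<in> (\<Union>n. A n)"
      using zspace_0[OF assms(1)] by blast
    show "c *s x \<in> (\<Union>n. A n)" if "x \<in> (\<Union>n. A n)" for c x
      using that zspace_scale[OF assms(1)] by blast
  qed blast
  then show ?thesis
    using assms(1) by (auto simp: zspace_def)
qed

lemma zspace_sum:
  assumes "zspace A" "zspace B"
  shows "zspace {x + y | x y. x \<in> A \<and> y \<in> B}"
proof -
  have "x = x + 0" for x :: 'm by simp
  then have "Z \<subseteq> {x + y | x y. x \<in> A \<and> y \<in> B}"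
    using zspace_Z[OF assms(1)] zspace_0[OF assms(2)] by blast
  then show ?thesis
    using subspace_sums assms unfolding zspace_def by blast
qed

lemma zspace_adjoin:
  assumes "endo D" "zspace A" "zspace B"
  shows "zspace {x + D y | x y. x \<in> A \<and> y \<in> B}"
proof -
  have "subspace (D ` B)"
    unfolding subspace_def
  proof (intro conjI ballI allI)
    show "0 \<in> D ` B"
      using zspace_0[OF assms(3)] endo_zero[OF assms(1)] by (metis image_eqI)
    show "x + y \<in> D ` B" if "x \<in> D ` B" "y \<in> D ` B" for x y
      using that zspace_add[OF assms(3)] by (auto simp: endo_add[OF assms(1), symmetric])
    show "c *s x \<in> D ` B" if "x \<in> D ` B" for c x
      using that zspace_scale[OF assms(3)] by (auto simp: endo_scale[OF assms(1), symmetric])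
  qed
  then have "subspace {x + y | x y. x \<in> A \<and> y \<in> D ` B}"
    by (rule subspace_sums[OF zspace_subspace[OF assms(2)]])
  moreover have "{x + y | x y. x \<in> A \<and> y \<in> D ` B} = {x + D y | x y. x \<in> A \<and> y \<in> B}"
    by blast
  moreover have "Z \<subseteq> {x + D y | x y. x \<in> A \<and> y \<in> B}"
  proof
    fix x assume "x \<in> Z"
    then have "x = x + D 0 \<and> x \<in> A \<and> 0 \<in> B"
      using endo_zero[OF assms(1)] zspace_Z[OF assms(2)] zspace_0[OF assms(3)] by simp
    then show "x \<in> {x + D y | x y. x \<in> A \<and> y \<in> B}"
      by (intro CollectI exI)
  qed
  ultimately show ?thesis
    by (simp add: zspace_def)
qed

section \<open>Polynomials in one operator with coefficients in a subspace\<close>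

fun polys :: "('m \<Rightarrow> 'm) \<Rightarrow> 'm set \<Rightarrow> nat \<Rightarrow> 'm set" where
  "polys D E 0 = E"
| "polys D E (Suc n) = {x + D y | x y. x \<in> E \<and> y \<in> polys D E n}"

text \<open>\<open>polys\<close> iterates the Horner form \<open>e + D y\<close>, so the union is
  the span of all powers of \<open>D\<close> applied to \<open>E\<close>. The powers may well be
  linearly dependent over \<open>E\<close>, since nothing makes such expressions unique.\<close>

definition adjoin :: "('m \<Rightarrow> 'm) \<Rightarrow> 'm set \<Rightarrow> 'm set" where
  "adjoin D E = (\<Union>n. polys D E n)"

context
  fixes D :: "'m \<Rightarrow> 'm" and E :: "'m set"
  assumes D: "endo D" and E: "zspace E"
begin

lemma zspace_polys: "zspace (polys D E n)"
  by (induction n) (auto simp: E intro!: zspace_adjoin D)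

lemma polys_Suc: "polys D E n \<subseteq> polys D E (Suc n)"
proof (induction n)
  case 0
  have "x = x + D 0" for x
    using endo_zero[OF D] by simp
  then show ?case
    using zspace_0[OF E] unfolding polys.simps by blast
next
  case (Suc n)
  then show ?case unfolding polys.simps(2) by blast
qed

lemma zspace_adjoin_all: "zspace (adjoin D E)"
  unfolding adjoin_def by (intro zspace_UN_chain zspace_polys polys_Suc)

lemma adjoin_base: "E \<subseteq> adjoin D E"
  unfolding adjoin_def using polys.simps(1) by blast

lemma adjoin_X: "x \<in> adjoin D E \<Longrightarrow> D x \<in> adjoin D E"
proof -
  assume "x \<in> adjoin D E"
  then obtain n where "x \<in> polys D E n"
    by (auto simp: adjoin_def)
  moreover have "D x = 0 + D x" by simp
  ultimately have "D x \<in> polys D E (Suc n)"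
    using zspace_0[OF E] unfolding polys.simps by blast
  then show ?thesis
    unfolding adjoin_def by blast
qed

lemma adjoin_induct [consumes 1, case_names base step]:
  assumes "x \<in> adjoin D E" and "\<And>x. x \<in> E \<Longrightarrow> Q x"
    and "\<And>x y. x \<in> E \<Longrightarrow> y \<in> adjoin D E \<Longrightarrow> Q y \<Longrightarrow> Q (x + D y)"
  shows "Q x"
proof -
  obtain n where "x \<in> polys D E n"
    using assms(1) by (auto simp: adjoin_def)
  then show ?thesis
  proof (induction n arbitrary: x)
    case 0
    then show ?case using assms(2) by simp
  next
    case (Suc n)
    then obtain e y where "x = e + D y" "e \<in> E" "y \<in> polys D E n"
      by auto
    then show ?case
      using assms(3)[of e y] Suc.IH[of y] unfolding adjoin_def by blast
  qed
qed

text \<open>The shape in which commutation relations are applied: in the fourth hypothesis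
  \<open>f\<close> is moved past the newest factor \<open>D\<close>, and everything else is
  linearity.\<close>

lemma adjoin_closed:
  assumes "endo f" "zspace A" "\<And>x. x \<in> E \<Longrightarrow> f x \<in> A"
    and "\<And>y. y \<in> adjoin D E \<Longrightarrow> f y \<in> A \<Longrightarrow> f (D y) \<in> A"
    and "x \<in> adjoin D E"
  shows "f x \<in> A"
  using assms(5)
proof (induction rule: adjoin_induct)
  case (base x)
  then show ?case using assms(3) by blast
next
  case (step x y)
  then show ?case
    using assms by (simp add: endo_add zspace_add)
qed

text \<open>The Leibniz rule for \<open>Y\<close> acting as \<open>\<theta> d/dD\<close>: each of
  the \<open>Suc j\<close> factors \<open>Y\<close> contributes one \<open>\<theta>\<close>. That
  \<open>Y\<close> and \<open>\<theta>\<close> commute is asked for only on a stable set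
  \<open>U\<close>, because \<open>L m\<close> and \<open>W t\<close> commute only on vectors that
  \<open>W (m + t)\<close> kills.\<close>

lemma funpow_commutator:
  assumes Y: "endo Y" and \<theta>: "endo \<theta>" and YX: "\<And>x. Y (D x) \<doteq> D (Y x) + \<theta> x"
    and U: "\<And>x. x \<in> U \<Longrightarrow> Y x \<in> U" "\<And>x. x \<in> U \<Longrightarrow> Y (\<theta> x) \<doteq> \<theta> (Y x)" and x: "x \<in> U"
  shows "(Y ^^ Suc j) (D x) \<doteq> D ((Y ^^ Suc j) x) + of_nat (Suc j) *s \<theta> ((Y ^^ j) x)"
proof (induction j)
  case 0
  then show ?case using YX by simp
next
  case (Suc j)
  have pow: "(Y ^^ i) x \<in> U" for i
    by (induction i) (use x U in auto)
  have "(Y ^^ Suc (Suc j)) (D x) \<doteq> Y (D ((Y ^^ Suc j) x) + of_nat (Suc j) *s \<theta> ((Y ^^ j) x))"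
    using endo_eqv[OF Y Suc] by simp
  also have "\<dots> = Y (D ((Y ^^ Suc j) x)) + of_nat (Suc j) *s Y (\<theta> ((Y ^^ j) x))"
    by (simp only: endo_add[OF Y] endo_scale[OF Y])
  also have "\<dots> \<doteq> (D (Y ((Y ^^ Suc j) x)) + \<theta> ((Y ^^ Suc j) x)) + of_nat (Suc j) *s \<theta> ((Y ^^ Suc j) x)"
    using eqv_add[OF YX eqv_scale[OF U(2)[OF pow]]] by simp
  also have "\<dots> = D ((Y ^^ Suc (Suc j)) x) + of_nat (Suc (Suc j)) *s \<theta> ((Y ^^ Suc j) x)"
    by (simp only: of_nat_Suc scale_left_distrib scale_one funpow.simps comp_apply add.assoc)
  finally show ?case .
qed

text \<open>Comparing leading coefficients: \<open>Y\<close> acts on the polynomials in \<open>D\<close> as \<open>\<theta> d/dD\<close>.\<close>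

lemma adjoin_one_variable:
  assumes Y: "endo Y" and \<theta>: "endo \<theta>" and YX: "\<And>x. Y (D x) \<doteq> D (Y x) + \<theta> x"
    and U: "\<And>x. x \<in> U \<Longrightarrow> Y x \<in> U" "\<And>x. x \<in> U \<Longrightarrow> Y (\<theta> x) \<doteq> \<theta> (Y x)"
    and YE: "\<And>x. x \<in> E \<Longrightarrow> Y x \<in> Z" and EU: "adjoin D E \<subseteq> U"
    and \<theta>E: "\<And>x. x \<in> adjoin D E \<Longrightarrow> \<theta> x \<in> adjoin D E"
    and K: "zspace K" "\<And>x. x \<in> K \<Longrightarrow> D x \<in> K" "\<And>x. x \<in> K \<Longrightarrow> Y x \<in> K" "\<And>x. \<theta> x \<in> K \<Longrightarrow> x \<in> K"
    and EK: "E \<inter> K \<subseteq> Z"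
    and x: "x \<in> adjoin D E" "Y x \<in> K"
  shows "x \<in> E"
proof -
  have comm: "(Y ^^ Suc j) (D x) \<doteq> D ((Y ^^ Suc j) x) + of_nat (Suc j) *s \<theta> ((Y ^^ j) x)"
    if "x \<in> polys D E n" for j x n
    using that EU by (intro funpow_commutator[OF Y \<theta> YX U]) (auto simp: adjoin_def)
  \<comment> \<open>A polynomial of degree \<open>n\<close> does not survive \<open>n + 1\<close>
    derivatives, since \<open>Y\<close> kills the coefficients.\<close>
  have nilp: "(Y ^^ Suc n) x \<in> Z" if "x \<in> polys D E n" for n x
    using that
  proof (induction n arbitrary: x)
    case 0
    then show ?case using YE by simp
  next
    case (Suc n)
    then obtain e y where x: "x = e + D y" and e: "e \<in> E" and y: "y \<in> polys D E n"
      by auto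
    have "(Y ^^ Suc (Suc n)) e = (Y ^^ Suc n) (Y e)"
      by (simp add: funpow_swap1)
    then have e0: "(Y ^^ Suc (Suc n)) e \<in> Z"
      using endo_Z[OF endo_funpow[OF Y]] YE[OF e] by metis
    have y0: "(Y ^^ Suc n) y \<in> Z"
      using Suc.IH y by blast
    have "D ((Y ^^ Suc (Suc n)) y) + of_nat (Suc (Suc n)) *s \<theta> ((Y ^^ Suc n) y) \<in> Z"
      using zspace_add[OF zspace_Z_self] zspace_scale[OF zspace_Z_self] endo_Z[OF D] endo_Z[OF Y] endo_Z[OF \<theta>] y0
      by simp
    then have "(Y ^^ Suc (Suc n)) (D y) \<in> Z"
      using eqv_ZD[OF comm[OF y]] by blast
    then show ?case
      using e0 zspace_add[OF zspace_Z_self] endo_add[OF endo_funpow[OF Y]] x by metis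
  qed
  have main: "x \<in> E" if "x \<in> polys D E n" "Y x \<in> K" for n x
    using that
  proof (induction n arbitrary: x)
    case 0
    then show ?case by simp
  next
    case (Suc n)
    then obtain e y where x: "x = e + D y" and e: "e \<in> E" and y: "y \<in> polys D E n"
      by auto
    have pow: "(Y ^^ j) z \<in> K" if "z \<in> K" for j z
      by (induction j) (use that K in auto)
    \<comment> \<open>Descending induction on the power of \<open>Y\<close>. By \<open>nilp\<close>
      the power \<open>Suc n\<close> kills \<open>y\<close>; and once \<open>(Y ^^ Suc i) y\<close>
      is in \<open>K\<close>, applying \<open>Y ^^ Suc i\<close> to \<open>x = e + D y\<close>
      leaves only the multiple \<open>Suc i\<close> of \<open>\<theta> ((Y ^^ i) y)\<close>, which
      must therefore be in \<open>K\<close>, and \<open>\<theta>\<close> can be removed.\<close>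
    have "j \<le> Suc n \<Longrightarrow> (Y ^^ (Suc n - j)) y \<in> K" for j
    proof (induction j)
      case 0
      then show ?case using nilp[OF y] zspace_Z[OF K(1)] by simp
    next
      case (Suc j)
      define i where "i = n - j"
      have i: "Suc n - j = Suc i"
        using Suc.prems by (simp add: i_def Suc_diff_le)
      have "(Y ^^ Suc i) y \<in> K"
        using Suc i by simp
      then have XK: "D ((Y ^^ Suc i) y) \<in> K"
        using K(2) by blast
      have "(Y ^^ Suc i) e = (Y ^^ i) (Y e)"
        by (simp add: funpow_swap1)
      then have eK: "(Y ^^ Suc i) e \<in> K"
        using pow YE[OF e] zspace_Z[OF K(1)] by simp
      have "(Y ^^ Suc i) x = (Y ^^ i) (Y x)"
        by (simp add: funpow_swap1)
      then have "(Y ^^ Suc i) x \<in> K"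
        using pow \<open>Y x \<in> K\<close> by simp
      then have "(Y ^^ Suc i) (D y) \<in> K"
        using eK zspace_diff[OF K(1)] endo_add[OF endo_funpow[OF Y]] x by (metis add_diff_cancel_left')
      then have "D ((Y ^^ Suc i) y) + of_nat (Suc i) *s \<theta> ((Y ^^ i) y) \<in> K"
        using zspace_eqv[OF K(1) eqv_sym[OF comm[OF y]]] by blast
      then have "of_nat (Suc i) *s \<theta> ((Y ^^ i) y) \<in> K"
        using XK zspace_diff[OF K(1)] by (metis add_diff_cancel_left')
      then have "(1 / of_nat (Suc i)) *s of_nat (Suc i) *s \<theta> ((Y ^^ i) y) \<in> K"
        using zspace_scale[OF K(1)] by blast
      then have "\<theta> ((Y ^^ i) y) \<in> K"
        by (simp del: of_nat_Suc)
      then show ?case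
        using K(4) by (simp add: i_def)
    qed
    from this[of "Suc n"] have "y \<in> K" by simp
    \<comment> \<open>\<open>K\<close> is stable under \<open>Y\<close>, so the induction hypothesis
      applies to \<open>y\<close> and puts it into \<open>E \<inter> K\<close>. Hence the factor
      \<open>D\<close> disappears from \<open>x\<close> altogether.\<close>
    then have "y \<in> Z"
      using Suc.IH[OF y] K(3) EK by blast
    then show ?case
      using x e endo_Z[OF D] zspace_add[OF E] zspace_Z[OF E] by simp
  qed
  show ?thesis
    using x main by (auto simp: adjoin_def)
qed

end

end

section \<open>The setting: a generating \<open>Td d\<close>-submodule \<open>V\<close> and a stable
  subspace \<open>K\<close>\<close>

locale lowering_induced = lowering +
  fixes d t :: nat and K V
  assumes K: "zspace K" and V: "zspace V" and VK: "V \<inter> K \<subseteq> Z"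
    and K_stable: "x \<in> K \<Longrightarrow> L m x \<in> K" "x \<in> K \<Longrightarrow> W m x \<in> K" "x \<in> K \<Longrightarrow> G m x \<in> K"
    and V_stable: "x \<in> V \<Longrightarrow> 0 \<le> m \<Longrightarrow> L m x \<in> V" "x \<in> V \<Longrightarrow> - int d \<le> m \<Longrightarrow> W m x \<in> V"
      "x \<in> V \<Longrightarrow> 0 \<le> m \<Longrightarrow> G m x \<in> V"
    and V_null: "x \<in> V \<Longrightarrow> int (t + d) < m \<Longrightarrow> L m x \<in> Z" "x \<in> V \<Longrightarrow> int t < m \<Longrightarrow> W m x \<in> Z"
      "x \<in> V \<Longrightarrow> int t \<le> m \<Longrightarrow> G m x \<in> Z"
    and K_W: "t > 0 \<Longrightarrow> W (int t) x \<in> K \<Longrightarrow> x \<in> K"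
    and c2: "t = 0 \<Longrightarrow> c2 \<noteq> 0"
    and generated: "\<lbrakk>zspace N; V \<subseteq> N; \<And>m x. x \<in> N \<Longrightarrow> L m x \<in> N; \<And>m x. x \<in> N \<Longrightarrow> W m x \<in> N;
      \<And>m x. x \<in> N \<Longrightarrow> G m x \<in> N\<rbrakk> \<Longrightarrow> N = UNIV"
begin

text \<open>The common action of \<open>[L\<^bsub>t+d+a\<^esub>, W\<^bsub>-d-a\<^esub>]\<close>,
  \<open>[L\<^bsub>-a\<^esub>, W\<^bsub>t+a\<^esub>]\<close> and \<open>[G\<^bsub>t+a-1/2\<^esub>, G\<^bsub>-a+1/2\<^esub>]\<close> for \<open>a > 0\<close>.\<close>

definition \<theta> :: "'a \<Rightarrow> 'a" where
  "\<theta> x = of_nat t *s W (int t) x + (if t = 0 then c2 else 0) *s x"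

lemma endo_\<theta>: "endo \<theta>"
  unfolding endo_def \<theta>_def using zspace_add[OF zspace_Z_self] zspace_scale[OF zspace_Z_self] Z_stable
  by (auto simp: W_add W_scale scale_right_distrib ac_simps scale_left_commute)

text \<open>For \<open>t = 0\<close> the operator is the nonzero scalar \<open>c2\<close>; for
  \<open>t > 0\<close> it is a nonzero multiple of \<open>W t\<close>, which is injective modulo
  \<open>K\<close> by \<open>K_W\<close>.\<close>

lemma \<theta>_K: "\<theta> x \<in> K \<Longrightarrow> x \<in> K"
proof (cases "t = 0")
  case True
  assume "\<theta> x \<in> K"
  then have "c2 *s x \<in> K"
    unfolding \<theta>_def using True by simp
  then have "(1 / c2) *s c2 *s x \<in> K"
    by (rule zspace_scale[OF K])
  then show ?thesis using c2 True by simp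
next
  case False
  assume "\<theta> x \<in> K"
  then have "of_nat t *s W (int t) x \<in> K"
    unfolding \<theta>_def using False by simp
  then have "(1 / of_nat t) *s of_nat t *s W (int t) x \<in> K"
    by (rule zspace_scale[OF K])
  then show ?thesis using K_W False by simp
qed

lemma \<theta>_mem: "zspace A \<Longrightarrow> x \<in> A \<Longrightarrow> W (int t) x \<in> A \<Longrightarrow> \<theta> x \<in> A"
  by (simp add: \<theta>_def zspace_add zspace_scale)

lemma W_\<theta>: "W m (\<theta> x) \<doteq> \<theta> (W m x)"
  unfolding \<theta>_def W_add W_scale by (intro eqv_add eqv_scale WW' eqv_refl)

text \<open>The conditional rules are made for the central terms of the brackets: membership of
  \<open>y\<close> has to be shown only when the Kronecker delta does not vanish.\<close>

lemma zspace_scale_W: "zspace A \<Longrightarrow> W k y \<in> A \<Longrightarrow> c *s W k y \<in> A"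
  and zspace_scale_if: "zspace A \<Longrightarrow> (b \<Longrightarrow> y \<in> A) \<Longrightarrow> (if b then c else 0) *s y \<in> A"
  and zspace_scale_uminus_if: "zspace A \<Longrightarrow> (b \<Longrightarrow> y \<in> A) \<Longrightarrow> - (if b then c else 0) *s y \<in> A"
  by (auto intro: zspace_scale zspace_minus zspace_0)

lemmas zspace_rules = zspace_add zspace_minus zspace_scale_W zspace_scale_if zspace_scale_uminus_if

lemma endo_mem_add:
  assumes "endo f" "zspace N" "x = y + w" "f y \<in> N" "f w \<in> N"
  shows "f x \<in> N"
  using assms zspace_add by (auto simp: endo_add)

text \<open>On \<open>U\<close> the operator \<open>\<theta>\<close> commutes with every
  \<open>L m\<close> for \<open>m > 0\<close>, because the bracket is a multiple of
  \<open>W (m + t)\<close>. Everything that \<open>W\<close> and \<open>G\<close> produce from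
  \<open>V\<close> stays in \<open>U\<close>.\<close>

definition U where "U = {x. \<forall>m > int t. W m x \<in> Z}"

lemma zspace_U: "zspace U"
  unfolding zspace_def subspace_def U_def
  using zspace_0[OF zspace_Z_self] zspace_add[OF zspace_Z_self] zspace_scale[OF zspace_Z_self]
  by (auto simp: endo_zero[OF endo_W] W_add W_scale Z_stable)

lemma U_W: "x \<in> U \<Longrightarrow> W n x \<in> U"
  unfolding U_def using eqv_ZD[OF WW'] Z_stable by blast

lemma U_G: "x \<in> U \<Longrightarrow> G n x \<in> U"
  unfolding U_def using eqv_ZD[OF WG'] Z_stable by blast

text \<open>Moving \<open>W m\<close> past \<open>L n\<close> creates \<open>W (n + m)\<close>,
  whose index is still above \<open>t\<close> because \<open>n\<close> is not negative; for the same
  reason no central term appears.\<close>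

lemma U_L:
  assumes "x \<in> U" "0 \<le> n"
  shows "L n x \<in> U"
proof -
  have "W m (L n x) \<in> Z" if "int t < m" for m
  proof (rule eqv_ZD[OF WL'])
    have "W m x \<in> Z" "W (n + m) x \<in> Z"
      using assms that by (auto simp: U_def)
    then show "L n (W m x) + - of_int (n + m) *s W (n + m) x + - (if n + m = 0 then c2 else 0) *s x \<in> Z"
      using assms that by (auto intro!: zspace_rules zspace_Z_self Z_stable)
  qed
  then show ?thesis by (simp add: U_def)
qed

lemma V_U: "V \<subseteq> U"
  using V_null by (auto simp: U_def)

section \<open>Adjoining the operators \<open>W (-d-1)\<close>, \<open>W (-d-2)\<close>, ..\<close>

primrec A :: "nat \<Rightarrow> 'a set" where
  "A 0 = V"
| "A (Suc n) = adjoin (W (- int d - int (Suc n))) (A n)"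

declare A.simps(2) [simp del]

lemma zspace_A: "zspace (A n)"
  by (induction n) (auto simp: V A.simps(2) zspace_adjoin_all endo_W)

lemma A_Suc: "A n \<subseteq> A (Suc n)"
  using adjoin_base[OF endo_W zspace_A] by (simp add: A.simps(2))

lemma A_last: "x \<in> A (Suc n) \<Longrightarrow> W (- int d - int (Suc n)) x \<in> A (Suc n)"
  unfolding A.simps(2) by (rule adjoin_X[OF endo_W zspace_A])

lemma A_Suc_closed:
  assumes "endo f" "zspace N" "\<And>x. x \<in> A n \<Longrightarrow> f x \<in> N"
    and "\<And>y. y \<in> A (Suc n) \<Longrightarrow> f y \<in> N \<Longrightarrow> f (W (- int d - int (Suc n)) y) \<in> N"
    and "x \<in> A (Suc n)"
  shows "f x \<in> N"
  using assms(3-5) unfolding A.simps(2) by (rule adjoin_closed[OF endo_W zspace_A assms(1,2)])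

lemma A_mono: "i \<le> j \<Longrightarrow> A i \<subseteq> A j"
  using A_Suc by (rule lift_Suc_mono_le)

lemma A_U: "A n \<subseteq> U"
proof (induction n)
  case (Suc n)
  have "x \<in> U" if "x \<in> A (Suc n)" for x
    using that unfolding A.simps(2)
  proof (induction rule: adjoin_induct[OF endo_W zspace_A, consumes 1, case_names base step])
    case base
    then show ?case using Suc by blast
  next
    case (step x y)
    then show ?case
      using Suc U_W zspace_add[OF zspace_U] by blast
  qed
  then show ?case by blast
qed (simp add: V_U)

lemma A_W: "- int d \<le> m \<Longrightarrow> x \<in> A n \<Longrightarrow> W m x \<in> A n"
proof (induction n arbitrary: x)
  case 0
  then show ?case using V_stable by simp
next
  case (Suc n)
  show ?case
  proof (rule A_Suc_closed[OF endo_W zspace_A _ _ Suc.prems(2)])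
    show "W m x \<in> A (Suc n)" if "x \<in> A n" for x
      using A_Suc Suc.IH[OF Suc.prems(1) that] by blast
  qed (rule zspace_eqv[OF zspace_A WW' A_last])
qed

lemma A_W_neg: "x \<in> A n \<Longrightarrow> k < n \<Longrightarrow> W (- int d - int (Suc k)) x \<in> A n"
proof (induction n arbitrary: x)
  case (Suc n)
  show ?case
  proof (cases "k = n")
    case True
    then show ?thesis
      using A_last Suc.prems(1) by blast
  next
    case False
    show ?thesis
    proof (rule A_Suc_closed[OF endo_W zspace_A _ _ Suc.prems(1)])
      show "W (- int d - int (Suc k)) x \<in> A (Suc n)" if "x \<in> A n" for x
        using A_Suc Suc.IH[OF that] False Suc.prems(2) by (meson less_SucE subsetD)
    qed (rule zspace_eqv[OF zspace_A WW' A_last])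
  qed
qed simp

text \<open>Moving \<open>L m\<close> past \<open>W (-d-k)\<close> with \<open>k \<le> n\<close>
  leaves a multiple of \<open>W (m-d-k)\<close>. The bound on \<open>m\<close> keeps this index
  above \<open>t\<close>, so the term vanishes on \<open>U\<close>.\<close>

lemma A_L_null: "x \<in> A n \<Longrightarrow> int (t + d + n) < m \<Longrightarrow> L m x \<in> Z"
proof (induction n arbitrary: x)
  case 0
  then show ?case using V_null by simp
next
  case (Suc n)
  let ?k = "- int d - int (Suc n)"
  show ?case
  proof (rule A_Suc_closed[OF endo_L zspace_Z_self _ _ Suc.prems(1)])
    show "L m x \<in> Z" if "x \<in> A n" for x
      using Suc.IH[OF that] Suc.prems(2) by simp
    show "L m (W ?k y) \<in> Z" if "y \<in> A (Suc n)" "L m y \<in> Z" for y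
    proof (rule eqv_ZD[OF LW'])
      have "int t < m + ?k"
        using Suc.prems(2) by simp
      then have "W (m + ?k) y \<in> Z" "m + ?k \<noteq> 0"
        using A_U that(1) by (auto simp: U_def)
      then show "W ?k (L m y) + of_int (m + ?k) *s W (m + ?k) y + (if m + ?k = 0 then c2 else 0) *s y \<in> Z"
        using Z_stable(2)[OF that(2)] by (auto intro!: zspace_rules zspace_Z_self)
    qed
  qed
qed

text \<open>\<open>L (t+d+n+1)\<close> kills \<open>A n\<close> and differentiates with respect to
  the newest variable \<open>W (-d-n-1)\<close>, so the one-variable argument strips that variable.
  The two claims have to be proved together: stripping uses
  \<open>A n \<inter> K \<subseteq> Z\<close>, and the same inclusion for \<open>Suc n\<close>
  follows by stripping, because \<open>K\<close> is stable under the \<open>L m\<close>.\<close>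

lemma A_singular:
  shows A_singular_V: "\<lbrakk>x \<in> A n; \<And>m. int (t + d) < m \<Longrightarrow> L m x \<in> K\<rbrakk> \<Longrightarrow> x \<in> V"
    and A_K: "A n \<inter> K \<subseteq> Z"
proof -
  have "(\<forall>x\<in>A n. (\<forall>m. int (t + d) < m \<longrightarrow> L m x \<in> K) \<longrightarrow> x \<in> V) \<and> A n \<inter> K \<subseteq> Z"
  proof (induction n)
    case 0
    then show ?case using VK by simp
  next
    case (Suc n)
    let ?m = "int (t + d + Suc n)" and ?k = "- int d - int (Suc n)"
    \<comment> \<open>The indices \<open>?m\<close> and \<open>?k\<close> add up to
      \<open>t\<close>, so the whole bracket including its central term is
      \<open>\<theta>\<close>.\<close>
    have YD: "L ?m (W ?k x) \<doteq> W ?k (L ?m x) + \<theta> x" for x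
      using LW'[of ?m ?k x] by (simp add: \<theta>_def add.assoc)
    \<comment> \<open>Here \<open>?m\<close> is positive, so the bracket with \<open>W t\<close> is
      a \<open>W\<close> of index above \<open>t\<close> and vanishes on \<open>U\<close>.\<close>
    have Y\<theta>: "L ?m (\<theta> x) \<doteq> \<theta> (L ?m x)" if "x \<in> U" for x
    proof -
      have "W (?m + int t) x \<in> Z"
        using that by (auto simp: U_def)
      then have "of_int (?m + int t) *s W (?m + int t) x + (if ?m + int t = 0 then c2 else 0) *s x \<in> Z"
        by (auto intro!: zspace_rules zspace_Z_self)
      then have "W (int t) (L ?m x) + (of_int (?m + int t) *s W (?m + int t) x +
          (if ?m + int t = 0 then c2 else 0) *s x) \<doteq> W (int t) (L ?m x)"
        unfolding eqv_def by simp
      then have "L ?m (W (int t) x) \<doteq> W (int t) (L ?m x)"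
        using eqv_trans[OF LW'] by (simp only: add.assoc)
      then show ?thesis
        unfolding \<theta>_def L_add L_scale by (intro eqv_add eqv_scale eqv_refl)
    qed
    have one: "x \<in> A n" if "x \<in> A (Suc n)" "L ?m x \<in> K" for x
    proof (rule adjoin_one_variable[OF endo_W zspace_A endo_L endo_\<theta> YD, of U _ K])
      show "L ?m x \<in> Z" if "x \<in> A n" for x
        using A_L_null that by simp
      show "\<theta> x \<in> adjoin (W ?k) (A n)" if "x \<in> adjoin (W ?k) (A n)" for x
        using that unfolding A.simps(2)[symmetric] by (intro \<theta>_mem zspace_A A_W) auto
      show "adjoin (W ?k) (A n) \<subseteq> U"
        using A_U unfolding A.simps(2)[symmetric] .
      show "x \<in> adjoin (W ?k) (A n)"
        using that(1) unfolding A.simps(2) .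
      show "A n \<inter> K \<subseteq> Z" using Suc by blast
    qed (use U_L K K_stable \<theta>_K Y\<theta> that(2) in auto)
    then have 1: "\<forall>x\<in>A (Suc n). (\<forall>m. int (t + d) < m \<longrightarrow> L m x \<in> K) \<longrightarrow> x \<in> V"
      using Suc by auto
    have "A (Suc n) \<inter> K \<subseteq> Z"
      using one K_stable Suc by blast
    with 1 show ?case by blast
  qed
  then show "\<lbrakk>x \<in> A n; \<And>m. int (t + d) < m \<Longrightarrow> L m x \<in> K\<rbrakk> \<Longrightarrow> x \<in> V" "A n \<inter> K \<subseteq> Z" by auto
qed

definition A' where "A' = (\<Union>n. A n)"

lemma zspace_A': "zspace A'"
  unfolding A'_def by (rule zspace_UN_chain[of A, OF zspace_A A_Suc])

lemma A'_U: "A' \<subseteq> U"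
  using A_U by (auto simp: A'_def)

lemma A'_W: "x \<in> A' \<Longrightarrow> W m x \<in> A'"
proof -
  assume "x \<in> A'"
  then obtain n where x: "x \<in> A n" by (auto simp: A'_def)
  show ?thesis
  proof (cases "- int d \<le> m")
    case True
    then show ?thesis using A_W x by (auto simp: A'_def)
  next
    case False
    define k where "k = nat (- int d - m - 1)"
    have m: "m = - int d - int (Suc k)"
      using False by (simp add: k_def)
    have "x \<in> A (max n (Suc k))"
      using A_mono[of n "max n (Suc k)"] x by auto
    then have "W m x \<in> A (max n (Suc k))"
      unfolding m by (rule A_W_neg) simp
    then show ?thesis by (auto simp: A'_def)
  qed
qed

lemma A_closed:
  assumes "endo f" "zspace N" "\<And>x. x \<in> V \<Longrightarrow> f x \<in> N"
    and "\<And>m y. y \<in> A' \<Longrightarrow> f y \<in> N \<Longrightarrow> f (W m y) \<in> N" and x: "x \<in> A'"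
  shows "f x \<in> N"
proof -
  obtain n where "x \<in> A n" using x by (auto simp: A'_def)
  then show ?thesis
  proof (induction n arbitrary: x)
    case 0
    then show ?case using assms(3) by simp
  next
    case (Suc n)
    have "f (W m y) \<in> N" if "y \<in> A (Suc n)" "f y \<in> N" for m y
      using assms(4) that unfolding A'_def by blast
    then show ?case
      using A_Suc_closed[OF assms(1,2) Suc.IH _ Suc.prems] by blast
  qed
qed

lemma A'_V: "V \<subseteq> A'"
  unfolding A'_def using A.simps(1) by blast

lemma A'_L: "0 \<le> m \<Longrightarrow> x \<in> A' \<Longrightarrow> L m x \<in> A'"
  by (rule A_closed[OF endo_L zspace_A'])
    (use A'_V V_stable in \<open>auto intro!: zspace_eqv[OF zspace_A' LW'] zspace_rules zspace_A' A'_W\<close>)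

lemma A'_G: "0 \<le> m \<Longrightarrow> x \<in> A' \<Longrightarrow> G m x \<in> A'"
  by (rule A_closed[OF endo_G zspace_A'])
    (use A'_V V_stable in \<open>auto intro!: zspace_eqv[OF zspace_A' GW'] A'_W\<close>)

lemma A'_G_null: "int t \<le> m \<Longrightarrow> x \<in> A' \<Longrightarrow> G m x \<in> Z"
  by (rule A_closed[OF endo_G zspace_Z_self])
    (use V_null in \<open>auto intro!: eqv_ZD[OF GW'] Z_stable(2)\<close>)

section \<open>Adjoining the operators \<open>G (-1)\<close>, \<open>G (-2)\<close>, ..\<close>

primrec B :: "nat \<Rightarrow> 'a set" where
  "B 0 = A'"
| "B (Suc n) = {x + G (- int (Suc n)) y | x y. x \<in> B n \<and> y \<in> B n}"

declare B.simps(2) [simp del]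

lemma zspace_B: "zspace (B n)"
  by (induction n) (simp_all add: zspace_A' B.simps(2) zspace_adjoin endo_G)

lemma B_SucE:
  assumes "x \<in> B (Suc n)"
  obtains y z where "x = y + G (- int (Suc n)) z" "y \<in> B n" "z \<in> B n"
  using assms unfolding B.simps(2) by blast

lemma B_SucI: "y \<in> B n \<Longrightarrow> z \<in> B n \<Longrightarrow> y + G (- int (Suc n)) z \<in> B (Suc n)"
  unfolding B.simps(2) by blast

lemma B_G_last: "y \<in> B n \<Longrightarrow> G (- int (Suc n)) y \<in> B (Suc n)"
  using B_SucI[OF zspace_0[OF zspace_B], of y n] by simp

lemma B_Suc: "B n \<subseteq> B (Suc n)"
proof
  fix x assume "x \<in> B n"
  then have "x + G (- int (Suc n)) 0 \<in> B (Suc n)"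
    by (intro B_SucI zspace_0 zspace_B)
  then show "x \<in> B (Suc n)"
    by (simp add: endo_zero[OF endo_G])
qed

lemma B_mono: "i \<le> j \<Longrightarrow> B i \<subseteq> B j"
  using B_Suc by (rule lift_Suc_mono_le)

lemma B_U: "B n \<subseteq> U"
proof (induction n)
  case (Suc n)
  then show ?case
    using U_G zspace_add[OF zspace_U] by (blast elim!: B_SucE)
qed (simp add: A'_U)

lemma B_W: "x \<in> B n \<Longrightarrow> W m x \<in> B n"
proof (induction n arbitrary: x)
  case 0
  then show ?case using A'_W by simp
next
  case (Suc n)
  then obtain y z where x: "x = y + G (- int (Suc n)) z" "y \<in> B n" "z \<in> B n" by (auto elim: B_SucE)
  have "W m (G (- int (Suc n)) z) \<in> B (Suc n)"
    using zspace_eqv[OF zspace_B WG' B_G_last] Suc.IH x by blast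
  then show ?case
    using endo_mem_add[OF endo_W zspace_B x(1)] Suc.IH[OF x(2)] B_Suc by blast
qed

text \<open>Moving \<open>G m\<close> past the newest \<open>G\<close> costs a \<open>W\<close> and
  possibly a scalar, and neither leaves \<open>B n\<close>.\<close>

lemma B_G_step:
  assumes "x \<in> B (Suc n)" "\<And>z. z \<in> B n \<Longrightarrow> G m z \<in> B n"
  shows "G m x \<in> B (Suc n)"
proof -
  let ?m = "- int (Suc n)"
  obtain y z where x: "x = y + G ?m z" "y \<in> B n" "z \<in> B n"
    using assms(1) by (auto elim: B_SucE)
  have "G m (G ?m z) \<in> B (Suc n)"
  proof (rule zspace_eqv[OF zspace_B GG'])
    have "G ?m (G m z) \<in> B (Suc n)" "W k z \<in> B (Suc n)" "z \<in> B (Suc n)" for k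
      using B_G_last B_W B_Suc x assms(2) by blast+
    then show "- G ?m (G m z) + of_int (m + ?m + 1) *s W (m + ?m + 1) z +
        (if m + ?m + 1 = 0 then c2 else 0) *s z \<in> B (Suc n)"
      by (intro zspace_add zspace_scale zspace_minus zspace_B)
  qed
  then show ?thesis
    using endo_mem_add[OF endo_G zspace_B x(1)] assms(2)[OF x(2)] B_Suc by blast
qed

lemma B_G: "0 \<le> m \<Longrightarrow> x \<in> B n \<Longrightarrow> G m x \<in> B n"
proof (induction n arbitrary: x)
  case 0
  then show ?case using A'_G by simp
next
  case (Suc n)
  show ?case
    by (rule B_G_step[OF Suc.prems(2)]) (rule Suc.IH[OF Suc.prems(1)])
qed

text \<open>The only critical case is the newest operator applied a second time. The square of an
  odd operator is half of its bracket with itself, hence a multiple of some \<open>W\<close>; this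
  is why first powers suffice in \<open>B\<close>.\<close>

lemma B_G_neg: "k < n \<Longrightarrow> x \<in> B n \<Longrightarrow> G (- int (Suc k)) x \<in> B n"
proof (induction n arbitrary: x)
  case (Suc n)
  show ?case
  proof (cases "k = n")
    case True
    let ?m = "- int (Suc n)"
    obtain y z where x: "x = y + G ?m z" "y \<in> B n" "z \<in> B n"
      using Suc.prems by (auto elim: B_SucE)
    let ?w = "of_int (?m + ?m + 1) *s W (?m + ?m + 1) z + (if ?m + ?m + 1 = 0 then c2 else 0) *s z"
    have w: "?w \<in> B (Suc n)"
      using B_W B_Suc x by (intro zspace_add zspace_scale zspace_B) blast+
    have cancel: "(- a + p + q) + a = p + q" for a p q :: 'a
      by simp
    have "G ?m (G ?m z) + G ?m (G ?m z) \<in> B (Suc n)"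
    proof (rule zspace_eqv[OF zspace_B _ w])
      have "G ?m (G ?m z) + G ?m (G ?m z) \<doteq>
          (- G ?m (G ?m z) + of_int (?m + ?m + 1) *s W (?m + ?m + 1) z
            + (if ?m + ?m + 1 = 0 then c2 else 0) *s z) + G ?m (G ?m z)"
        by (rule eqv_add[OF GG' eqv_refl])
      also have "\<dots> = ?w" by (rule cancel)
      finally show "G ?m (G ?m z) + G ?m (G ?m z) \<doteq> ?w" .
    qed
    then have "(1/2) *s (G ?m (G ?m z) + G ?m (G ?m z)) \<in> B (Suc n)"
      using zspace_scale[OF zspace_B] by blast
    moreover have "(1/2) *s (v + v) = v" for v
    proof -
      have "(1/2) *s (v + v) = (1/2 + 1/2) *s v"
        by (simp only: scale_left_distrib scale_right_distrib)
      then show ?thesis by simp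
    qed
    ultimately have "G ?m (G ?m z) \<in> B (Suc n)" by metis
    then show ?thesis
      using endo_mem_add[OF endo_G zspace_B x(1)] B_G_last[OF x(2)] True by blast
  next
    case False
    then have "k < n" using Suc.prems(1) by simp
    then show ?thesis
      by (intro B_G_step[OF Suc.prems(2)] Suc.IH)
  qed
qed simp

text \<open>As \<open>G i\<close> has half-integer index \<open>i + 1/2\<close>, the bracket of
  \<open>G m\<close> with \<open>G (-k)\<close> is a multiple of \<open>W (m-k+1)\<close>. For
  \<open>k \<le> n\<close> this index exceeds \<open>t\<close>, so the term vanishes on
  \<open>U\<close>.\<close>

lemma B_G_null: "x \<in> B n \<Longrightarrow> int (t + n) \<le> m \<Longrightarrow> G m x \<in> Z"
proof (induction n arbitrary: x)
  case 0
  then show ?case using A'_G_null by simp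
next
  case (Suc n)
  let ?m = "- int (Suc n)"
  obtain y z where x: "x = y + G ?m z" "y \<in> B n" "z \<in> B n"
    using Suc.prems by (auto elim: B_SucE)
  have "G m (G ?m z) \<in> Z"
  proof (rule eqv_ZD[OF GG'])
    have "int t < m + ?m + 1"
      using Suc.prems(2) by simp
    then have *: "W (m + ?m + 1) z \<in> Z" "m + ?m + 1 \<noteq> 0"
      using B_U x(3) unfolding U_def by auto
    have "G ?m (G m z) \<in> Z"
      using Suc.IH[OF x(3)] Suc.prems(2) by (intro Z_stable(3)[of "G m z"]) simp
    with * show "- G ?m (G m z) + of_int (m + ?m + 1) *s W (m + ?m + 1) z +
        (if m + ?m + 1 = 0 then c2 else 0) *s z \<in> Z"
      by (intro zspace_rules zspace_Z_self) simp_all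
  qed
  then show ?case
    using endo_mem_add[OF endo_G zspace_Z_self x(1)] Suc.IH[OF x(2)] Suc.prems(2) by simp
qed

text \<open>\<open>G (t+n)\<close> kills \<open>B n\<close>, and its bracket with the newest
  operator \<open>G (-n-1)\<close> is \<open>\<theta>\<close>. Applied to
  \<open>x = y + G (-n-1) z\<close> it leaves \<open>\<theta> z\<close>, so \<open>z\<close> lies in
  \<open>K\<close>. As \<open>K\<close> is stable, the induction hypothesis puts \<open>z\<close>
  into \<open>A'\<close>, where \<open>A_K\<close> makes it vanish.\<close>

lemma B_singular:
  assumes "x \<in> B n" "\<And>m. int t \<le> m \<Longrightarrow> G m x \<in> K"
  shows "x \<in> A'"
  using assms
proof (induction n arbitrary: x)
  case 0
  then show ?case by simp
next
  case (Suc n)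
  let ?m = "- int (Suc n)" and ?k = "int (t + n)"
  obtain y z where x: "x = y + G ?m z" "y \<in> B n" "z \<in> B n"
    using Suc.prems by (auto elim: B_SucE)
  have e: "?k + ?m + 1 = int t" by simp
  have "G ?k (G ?m z) \<doteq> - G ?m (G ?k z) + \<theta> z"
    using GG'[of ?k ?m z] unfolding e by (simp only: \<theta>_def add.assoc of_nat_eq_0_iff of_int_of_nat_eq)
  moreover have "G ?k y \<in> Z" "G ?k z \<in> Z"
    using B_G_null x by auto
  moreover have "G ?k y + G ?k (G ?m z) \<in> K"
    using Suc.prems(2)[of ?k] x by (simp add: G_add)
  ultimately have "\<theta> z \<in> K"
  proof -
    assume c: "G ?k (G ?m z) \<doteq> - G ?m (G ?k z) + \<theta> z" and y: "G ?k y \<in> Z" and z: "G ?k z \<in> Z"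
      and s: "G ?k y + G ?k (G ?m z) \<in> K"
    have "G ?k (G ?m z) \<in> K"
      using s zspace_diff[OF K s zspace_Z[OF K y]] by simp
    then have "- G ?m (G ?k z) + \<theta> z \<in> K"
      using zspace_eqv[OF K eqv_sym[OF c]] by blast
    then show ?thesis
      using zspace_add[OF K _ zspace_Z[OF K Z_stable(3)[OF z, of ?m]]] by fastforce
  qed
  then have zK: "z \<in> K" by (rule \<theta>_K)
  have "z \<in> A'"
    by (rule Suc.IH[OF x(3)]) (rule K_stable(3)[OF zK])
  then obtain i where "z \<in> A i" by (auto simp: A'_def)
  then have "z \<in> Z"
    using A_K[of i] zK by blast
  then have "x \<in> B n"
    using x Z_stable zspace_Z[OF zspace_B] zspace_add[OF zspace_B] by simp
  then show ?case
    using Suc by blast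
qed

text \<open>The closure of \<open>V\<close> under all \<open>W m\<close> and \<open>G m\<close>; it
  is the coefficient space for the remaining operators, the \<open>L m\<close> with negative
  \<open>m\<close>.\<close>

definition E where "E = (\<Union>n. B n)"

lemma zspace_E: "zspace E"
  unfolding E_def by (rule zspace_UN_chain[of B, OF zspace_B B_Suc])

lemma E_U: "E \<subseteq> U"
  using B_U by (auto simp: E_def)

lemma E_V: "V \<subseteq> E"
  using A'_V B.simps(1) unfolding E_def by blast

lemma E_W: "x \<in> E \<Longrightarrow> W m x \<in> E"
  using B_W by (auto simp: E_def)

lemma E_G: "x \<in> E \<Longrightarrow> G m x \<in> E"
proof -
  assume "x \<in> E"
  then obtain n where x: "x \<in> B n" by (auto simp: E_def)
  show ?thesis
  proof (cases "0 \<le> m")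
    case True
    then show ?thesis using B_G x by (auto simp: E_def)
  next
    case False
    define k where "k = nat (- m - 1)"
    have m: "m = - int (Suc k)"
      using False by (simp add: k_def)
    have "x \<in> B (max n (Suc k))"
      using B_mono[of n "max n (Suc k)"] x by auto
    then have "G m x \<in> B (max n (Suc k))"
      unfolding m by (intro B_G_neg) auto
    then show ?thesis by (auto simp: E_def)
  qed
qed

lemma E_L:
  assumes "x \<in> E" "0 \<le> m"
  shows "L m x \<in> E"
proof -
  obtain n where "x \<in> B n" using assms by (auto simp: E_def)
  then show ?thesis
  proof (induction n arbitrary: x)
    case 0
    then show ?case using A'_L assms B.simps(1) unfolding E_def by blast
  next
    case (Suc n)
    then obtain y z where x: "x = y + G (- int (Suc n)) z" "y \<in> B n" "z \<in> B n" by (auto elim: B_SucE)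
    have "z \<in> E" using x by (auto simp: E_def)
    then have "L m (G (- int (Suc n)) z) \<in> E"
      using Suc.IH[OF x(3)] by (auto intro!: zspace_eqv[OF zspace_E LG'] zspace_add zspace_scale zspace_E E_G)
    then show ?case
      using endo_mem_add[OF endo_L zspace_E x(1)] Suc.IH[OF x(2)] by blast
  qed
qed

lemma E_singular:
  assumes "x \<in> E" "\<And>m. int (t + d) < m \<Longrightarrow> L m x \<in> K" "\<And>m. int t \<le> m \<Longrightarrow> G m x \<in> K"
  shows "x \<in> V"
proof -
  have "x \<in> A'" using B_singular assms by (auto simp: E_def)
  then show ?thesis using A_singular_V assms by (auto simp: A'_def)
qed

lemma E_K: "E \<inter> K \<subseteq> Z"
  using E_singular K_stable VK by blast

end

section \<open>Filtration by the number of operators \<open>L\<close>\<close>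

context lowering_induced begin

text \<open>Degrees are shifted by one: \<open>F (Suc k)\<close> contains the products of at most
  \<open>k\<close> operators \<open>L\<close> applied to \<open>E\<close>. Thus
  \<open>F 0 = Z\<close> stands for degree -1, and truncated subtraction of degrees ends in
  vanishing.\<close>

fun F :: "nat \<Rightarrow> 'a set" where
  "F 0 = Z"
| "F (Suc 0) = E"
| "F (Suc (Suc k)) = span (F (Suc k) \<union> (\<Union>m. L m ` F (Suc k)))"

declare F.simps(3) [simp del]

lemma F_induct [case_names 1 2 3]:
  "Q 0 \<Longrightarrow> Q (Suc 0) \<Longrightarrow> (\<And>k. Q (Suc k) \<Longrightarrow> Q (Suc (Suc k))) \<Longrightarrow> Q k"
  by (metis nat.exhaust nat_induct)

lemma zspace_F: "zspace (F k)"
proof (induction k rule: F_induct)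
  case (3 k)
  then have "Z \<subseteq> F (Suc (Suc k))"
    unfolding F.simps(3) by (meson Un_upper1 order_trans span_superset zspace_def)
  then show ?case by (simp add: zspace_def F.simps(3))
qed (simp_all add: zspace_E zspace_Z_self)

lemma F_Suc: "F k \<subseteq> F (Suc k)"
proof (cases k)
  case 0
  then show ?thesis using zspace_Z[OF zspace_E] by auto
next
  case (Suc i)
  then show ?thesis unfolding F.simps(3) Suc by (meson Un_upper1 order_trans span_superset)
qed

lemma F_Suc_mem: "x \<in> F k \<Longrightarrow> x \<in> F (Suc k)"
  using F_Suc by blast

lemma F_L: "x \<in> F k \<Longrightarrow> L m x \<in> F (Suc k)"
proof (cases k)
  case 0
  then show "x \<in> F k \<Longrightarrow> L m x \<in> F (Suc k)" using zspace_Z[OF zspace_E] Z_stable by auto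
next
  case (Suc i)
  assume "x \<in> F k"
  then show ?thesis unfolding F.simps(3) Suc by (intro span_base) blast
qed

lemma F_L_pred: "x \<in> F (k - 1) \<Longrightarrow> L m x \<in> F k"
  by (cases k) (auto intro: F_L Z_stable simp del: F.simps(2))

lemma F_closed:
  assumes f: "endo f" and N: "zspace N" and base: "\<And>x. x \<in> F (Suc k) \<Longrightarrow> f x \<in> N"
    and step: "\<And>m y. y \<in> F (Suc k) \<Longrightarrow> f (L m y) \<in> N" and x: "x \<in> F (Suc (Suc k))"
  shows "f x \<in> N"
proof -
  have "subspace {x. f x \<in> N}"
    unfolding subspace_def
    using zspace_0[OF N] zspace_add[OF N] zspace_scale[OF N]
    by (simp add: endo_add[OF f] endo_scale[OF f] endo_zero[OF f])
  then have "F (Suc (Suc k)) \<subseteq> {x. f x \<in> N}"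
    unfolding F.simps(3) using base step by (intro span_minimal) auto
  then show ?thesis using x by blast
qed

lemma F_W: "x \<in> F k \<Longrightarrow> W m x \<in> F k"
proof (induction k arbitrary: x m rule: F_induct)
  case (3 k)
  show ?case
  proof (rule F_closed[OF endo_W zspace_F _ _ 3(2)])
    show "W m y \<in> F (Suc (Suc k))" if "y \<in> F (Suc k)" for y
      by (rule F_Suc_mem[OF 3(1)[OF that]])
    show "W m (L n y) \<in> F (Suc (Suc k))" if "y \<in> F (Suc k)" for n y
      by (rule zspace_eqv[OF zspace_F WL'])
        (intro zspace_add zspace_scale zspace_F F_L F_Suc_mem[OF 3(1)[OF that]]
          F_Suc_mem[OF that] 3(1)[OF that])
  qed
qed (auto intro: Z_stable E_W)

lemma GL': "G i (L m x) \<doteq> L m (G i x) + - ((of_int i + 1 / 2) *s G (m + i) x)"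
  using eqv_swap[of "L m (G i x)" "G i (L m x)" "(of_int i + 1 / 2) *s G (m + i) x" 0] LG' by simp

lemma F_G: "x \<in> F k \<Longrightarrow> G m x \<in> F k"
proof (induction k arbitrary: x m rule: F_induct)
  case (3 k)
  show ?case
  proof (rule F_closed[OF endo_G zspace_F _ _ 3(2)])
    show "G m y \<in> F (Suc (Suc k))" if "y \<in> F (Suc k)" for y
      by (rule F_Suc_mem[OF 3(1)[OF that]])
    show "G m (L n y) \<in> F (Suc (Suc k))" if "y \<in> F (Suc k)" for n y
      by (rule zspace_eqv[OF zspace_F GL'])
        (intro zspace_add zspace_minus zspace_scale zspace_F F_L F_Suc_mem[OF 3(1)[OF that]]
          3(1)[OF that])
  qed
qed (auto intro: Z_stable E_G)

text \<open>Such an operator preserves \<open>E\<close>, and moving it past another \<open>L\<close>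
  replaces two of them by one \<open>L\<close> and a scalar; the degree is never raised.\<close>

lemma F_L_nonneg:
  assumes m: "0 \<le> m"
  shows "x \<in> F k \<Longrightarrow> L m x \<in> F k"
proof (induction k arbitrary: x rule: F_induct)
  case (3 k)
  show ?case
  proof (rule F_closed[OF endo_L zspace_F _ _ 3(2)])
    show "L m y \<in> F (Suc (Suc k))" if "y \<in> F (Suc k)" for y
      by (rule F_L[OF that])
    show "L m (L n y) \<in> F (Suc (Suc k))" if "y \<in> F (Suc k)" for n y
    proof -
      obtain c where "L m (L n y) \<doteq> L n (L m y) + of_int (n - m) *s L (m + n) y + c *s y"
        using LL' by blast
      then show ?thesis
        by (rule zspace_eqv[OF zspace_F])
          (intro zspace_add zspace_scale zspace_F F_L 3(1)[OF that] that F_Suc_mem[OF that])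
    qed
  qed
qed (use m in \<open>auto intro: Z_stable E_L\<close>)

text \<open>\<open>W m\<close> kills \<open>E\<close> modulo \<open>Z\<close>, and its bracket with
  an \<open>L\<close> is a \<open>W\<close> and a scalar: either way one \<open>L\<close> is
  lost.\<close>

lemma F_W_lower: "int t < m \<Longrightarrow> x \<in> F (Suc k) \<Longrightarrow> W m x \<in> F k"
proof (induction k arbitrary: x)
  case 0
  then show ?case using E_U by (auto simp: U_def)
next
  case (Suc k)
  show ?case
  proof (rule F_closed[OF endo_W zspace_F _ _ Suc.prems(2)])
    show "W m y \<in> F (Suc k)" if "y \<in> F (Suc k)" for y
      by (rule F_Suc_mem[OF Suc.IH[OF Suc.prems(1) that]])
    show "W m (L n y) \<in> F (Suc k)" if "y \<in> F (Suc k)" for n y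
      by (rule zspace_eqv[OF zspace_F WL'])
        (intro zspace_add zspace_scale zspace_F F_L Suc.IH[OF Suc.prems(1) that] F_W that)
  qed
qed

lemma F_W_lower_pow: "int t < m \<Longrightarrow> x \<in> F k \<Longrightarrow> (W m ^^ n) x \<in> F (k - n)"
proof (induction n)
  case (Suc n)
  then have *: "(W m ^^ n) x \<in> F (k - n)" by blast
  show ?case
  proof (cases "k - n")
    case 0
    then show ?thesis using * Z_stable by simp
  next
    case (Suc i)
    then have "W m ((W m ^^ n) x) \<in> F i"
      using * F_W_lower \<open>int t < m\<close> by metis
    then show ?thesis using Suc by (simp add: diff_Suc)
  qed
qed simp

text \<open>Up to \<open>F (k - 1)\<close>, the set \<open>FA a k\<close> consists of the combinations of products of \<open>k - 1\<close> of
  the operators \<open>L (-1)\<close>, ..., \<open>L (-a)\<close> applied to \<open>E\<close>.\<close>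

fun FA :: "nat \<Rightarrow> nat \<Rightarrow> 'a set" where
  "FA a 0 = Z"
| "FA a (Suc 0) = E"
| "FA 0 (Suc (Suc k)) = F (Suc k)"
| "FA (Suc a) (Suc (Suc k)) =
    {x + L (- int (Suc a)) z | x z. x \<in> FA a (Suc (Suc k)) \<and> z \<in> FA (Suc a) (Suc k)}"

declare FA.simps(4) [simp del]

lemma zspace_FA: "zspace (FA a k)"
  by (induction a k rule: FA.induct)
    (simp_all add: zspace_Z_self zspace_E zspace_F FA.simps(4) zspace_adjoin endo_L del: F.simps(2))

lemma FA_SucE:
  assumes "x \<in> FA (Suc a) (Suc (Suc k))"
  obtains y z where "x = y + L (- int (Suc a)) z" "y \<in> FA a (Suc (Suc k))" "z \<in> FA (Suc a) (Suc k)"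
  using assms unfolding FA.simps(4) by blast

lemma FA_SucI: "y \<in> FA a (Suc (Suc k)) \<Longrightarrow> z \<in> FA (Suc a) (Suc k) \<Longrightarrow>
    y + L (- int (Suc a)) z \<in> FA (Suc a) (Suc (Suc k))"
  unfolding FA.simps(4) by blast

lemma FA_last: "z \<in> FA (Suc a) (Suc k) \<Longrightarrow> L (- int (Suc a)) z \<in> FA (Suc a) (Suc (Suc k))"
  using FA_SucI[OF zspace_0[OF zspace_FA], of z a k] by simp

lemma FA_Suc: "x \<in> FA a k \<Longrightarrow> x \<in> FA (Suc a) k"
proof (induction a k rule: FA.induct)
  case (3 k)
  then show ?case
    using FA_SucI[OF 3 zspace_0[OF zspace_FA]] by (simp add: endo_zero[OF endo_L])
next
  case (4 a k)
  then show ?case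
    using FA_SucI[OF 4(3) zspace_0[OF zspace_FA]] by (simp add: endo_zero[OF endo_L])
qed auto

lemma FA_mono: "a \<le> b \<Longrightarrow> FA a k \<subseteq> FA b k"
  by (rule lift_Suc_mono_le[of "\<lambda>a. FA a k"]) (auto intro: FA_Suc)

lemma F_FA: "x \<in> F k \<Longrightarrow> x \<in> FA a (Suc k)"
proof (cases k)
  case 0
  then show "x \<in> F k \<Longrightarrow> x \<in> FA a (Suc k)" using zspace_Z[OF zspace_E] by simp
next
  case (Suc i)
  then show "x \<in> F k \<Longrightarrow> x \<in> FA a (Suc k)"
    using FA_mono[of 0 a "Suc k"] by auto
qed

lemma FA_F: "x \<in> FA a k \<Longrightarrow> x \<in> F k"
proof (induction a k arbitrary: x rule: FA.induct)
  case (3 k)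
  then show ?case using F_Suc_mem by simp
next
  case (4 a k)
  then show ?case
    by (auto elim!: FA_SucE simp del: F.simps(2) intro: zspace_add[OF zspace_F] F_L)
qed auto

text \<open>Lowering operators may be reordered, since the bracket of two of them contains one
  \<open>L\<close> fewer and so falls into the lower filtration step that \<open>FA\<close> includes
  from the start.\<close>

lemma FA_L: "b < a \<Longrightarrow> x \<in> FA a (Suc k) \<Longrightarrow> L (- int (Suc b)) x \<in> FA a (Suc (Suc k))"
proof (induction a arbitrary: x k)
  case (Suc a)
  show ?case
  proof (cases "b = a")
    case True
    then show ?thesis using FA_last Suc.prems by blast
  next
    case False
    then have b: "b < a" using Suc.prems by simp
    show ?thesis using Suc.prems(2)
    proof (induction k arbitrary: x)
      case 0
      then show ?case using FA_Suc[OF Suc.IH[OF b]] by simp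
    next
      case (Suc k)
      let ?D = "L (- int (Suc a))" and ?B = "L (- int (Suc b))"
      obtain y z where x: "x = y + ?D z" "y \<in> FA a (Suc (Suc k))" "z \<in> FA (Suc a) (Suc k)"
        using Suc.prems by (rule FA_SucE)
      obtain c where "?B (?D z) \<doteq> ?D (?B z) + of_int (- int (Suc a) - - int (Suc b)) *s
          L (- int (Suc b) + - int (Suc a)) z + c *s z"
        using LL' by blast
      moreover have "?D (?B z) \<in> FA (Suc a) (Suc (Suc (Suc k)))"
        by (rule FA_last[OF Suc.IH[OF x(3)]])
      moreover have "z \<in> F (Suc k)" using x(3) by (rule FA_F)
      then have "L m z \<in> FA (Suc a) (Suc (Suc (Suc k)))" "z \<in> FA (Suc a) (Suc (Suc (Suc k)))" for m
        using F_L F_FA F_Suc_mem by blast+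
      ultimately have "?B (?D z) \<in> FA (Suc a) (Suc (Suc (Suc k)))"
        by (elim zspace_eqv[OF zspace_FA]) (intro zspace_add zspace_scale zspace_FA)
      then show ?case
        using endo_mem_add[OF endo_L zspace_FA x(1)] FA_Suc[OF \<open>\<And>x k. b < a \<Longrightarrow> x \<in> FA a (Suc k) \<Longrightarrow> L (- int (Suc b)) x \<in> FA a (Suc (Suc k))\<close>[OF b x(2)]]
        by blast
    qed
  qed
qed simp

text \<open>A given vector involves finitely many operators \<open>L\<close>, and those with
  nonnegative index do not raise the degree.\<close>

lemma F_ex_FA: "x \<in> F (Suc k) \<Longrightarrow> \<exists>a. x \<in> FA a (Suc k)"
proof (induction k arbitrary: x)
  case 0
  then show ?case by simp
next
  case (Suc k)
  let ?N = "\<Union>a. FA a (Suc (Suc k))"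
  have "zspace ?N"
    by (rule zspace_UN_chain[of "\<lambda>a. FA a (Suc (Suc k))"]) (auto intro: zspace_FA FA_Suc)
  moreover have base: "y \<in> ?N" if "y \<in> F (Suc k)" for y
    using F_FA[OF that] by blast
  moreover have "L m y \<in> ?N" if y: "y \<in> F (Suc k)" for m y
  proof (cases "0 \<le> m")
    case True
    then show ?thesis using base[OF F_L_nonneg[OF _ y]] by blast
  next
    case False
    define b where "b = nat (- m - 1)"
    have m: "m = - int (Suc b)"
      using False by (simp add: b_def)
    obtain a where "y \<in> FA a (Suc k)"
      using Suc.IH y by blast
    then have "y \<in> FA (max a (Suc b)) (Suc k)"
      using FA_mono[of a "max a (Suc b)"] by auto
    then have "L m y \<in> FA (max a (Suc b)) (Suc (Suc k))"
      unfolding m by (intro FA_L) auto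
    then show ?thesis by blast
  qed
  ultimately have "F (Suc (Suc k)) \<subseteq> ?N"
    unfolding F.simps(3) by (intro span_minimal zspace_subspace) auto
  then show ?case using Suc.prems by blast
qed

text \<open>The bracket of \<open>W m\<close> with \<open>L (-b)\<close> for
  \<open>b \<le> a\<close> is a multiple of \<open>W (m-b)\<close>, whose index is still above
  \<open>t\<close> and which therefore lowers the degree itself. So two factors \<open>L\<close>
  disappear: one is replaced by a \<open>W\<close>, and that \<open>W\<close> removes another. The
  part in the lower filtration step needs to lose only one.\<close>

lemma FA_W_lower: "int (t + a) < m \<Longrightarrow> x \<in> FA a (Suc (Suc k)) \<Longrightarrow> W m x \<in> F k"
proof (induction a arbitrary: x k)
  case 0
  then show ?case using F_W_lower by simp
next
  case (Suc a)
  show ?case using Suc.prems(2)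
  proof (induction k arbitrary: x)
    case 0
    show ?case
    proof -
      let ?n = "- int (Suc a)"
      obtain y z where x: "x = y + L ?n z" "y \<in> FA a (Suc (Suc 0))" "z \<in> FA (Suc a) (Suc 0)"
        using 0 by (rule FA_SucE)
      have z: "z \<in> U" using x(3) E_U by auto
      have m: "int t < ?n + m" using Suc.prems(1) by simp
      have "W m (L ?n z) \<in> F 0"
      proof (rule zspace_eqv[OF zspace_F WL'])
        have "L ?n (W m z) \<in> F 0" "W (?n + m) z \<in> F 0" "?n + m \<noteq> 0"
          using z m Suc.prems(1) by (auto simp: U_def Z_stable)
        then show "L ?n (W m z) + - of_int (?n + m) *s W (?n + m) z + - (if ?n + m = 0 then c2 else 0) *s z \<in> F 0"
          by (intro zspace_rules zspace_F) simp_all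
      qed
      moreover have "W m y \<in> F 0"
        using Suc.IH[OF _ x(2)] Suc.prems(1) by simp
      ultimately show ?thesis
        using endo_mem_add[OF endo_W zspace_F x(1)] by blast
    qed
  next
    case (Suc k)
    let ?n = "- int (Suc a)"
    obtain y z where x: "x = y + L ?n z" "y \<in> FA a (Suc (Suc (Suc k)))" "z \<in> FA (Suc a) (Suc (Suc k))"
      using Suc.prems by (rule FA_SucE)
    have m: "int t < ?n + m" using \<open>int (t + Suc a) < m\<close> by simp
    have z: "z \<in> F (Suc (Suc k))" by (rule FA_F[OF x(3)])
    have "W m (L ?n z) \<in> F (Suc k)"
    proof (rule zspace_eqv[OF zspace_F WL'])
      have "L ?n (W m z) \<in> F (Suc k)" "W (?n + m) z \<in> F (Suc k)" "?n + m \<noteq> 0"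
        using F_L[OF Suc.IH[OF x(3)]] F_W_lower[OF m z] m by simp_all
      then show "L ?n (W m z) + - of_int (?n + m) *s W (?n + m) z + - (if ?n + m = 0 then c2 else 0) *s z \<in> F (Suc k)"
        by (intro zspace_rules zspace_F) simp_all
    qed
    moreover have "W m y \<in> F (Suc k)"
      using \<open>\<And>x k. int (t + a) < m \<Longrightarrow> x \<in> FA a (Suc (Suc k)) \<Longrightarrow> W m x \<in> F k\<close>[OF _ x(2)]
        \<open>int (t + Suc a) < m\<close> by simp
    ultimately show ?case
      using endo_mem_add[OF endo_W zspace_F x(1)] by blast
  qed
qed

text \<open>Filtration degree in the quotient by \<open>K\<close>, the only place where injectivity
  of \<open>\<theta>\<close> is given.\<close>

definition FK where "FK k = {x + y | x y. x \<in> F k \<and> y \<in> K}"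

lemma zspace_FK: "zspace (FK k)"
  unfolding FK_def by (rule zspace_sum[OF zspace_F K])

lemma F_FK: "x \<in> F k \<Longrightarrow> x \<in> FK k"
proof -
  assume "x \<in> F k"
  moreover have "x = x + 0" by simp
  ultimately show ?thesis
    unfolding FK_def using zspace_0[OF K] by blast
qed

lemma K_FK: "x \<in> K \<Longrightarrow> x \<in> FK k"
proof -
  assume "x \<in> K"
  moreover have "x = 0 + x" by simp
  ultimately show ?thesis
    unfolding FK_def using zspace_0[OF zspace_F] by blast
qed

lemma \<theta>_W: "\<theta> (W m x) \<doteq> W m (\<theta> x)"
  by (rule eqv_sym[OF W_\<theta>])

lemma FK_lower_pow: "int t < m \<Longrightarrow> x \<in> FK k \<Longrightarrow> (W m ^^ n) x \<in> FK (k - n)"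
proof -
  assume m: "int t < m" and "x \<in> FK k"
  then obtain y z where x: "x = y + z" "y \<in> F k" "z \<in> K"
    by (auto simp: FK_def)
  have "(W m ^^ n) z \<in> K"
    by (induction n) (auto intro: K_stable x)
  then show ?thesis
    using endo_mem_add[OF endo_funpow[OF endo_W] zspace_FK x(1)] F_W_lower_pow[OF m x(2)] F_FK K_FK
    by blast
qed

lemma \<theta>_W_pow: "\<theta> ((W m ^^ n) x) \<doteq> (W m ^^ n) (\<theta> x)"
proof (induction n)
  case (Suc n)
  then show ?case
    using eqv_trans[OF \<theta>_W endo_eqv[OF endo_W]] by simp
qed simp

lemma F_\<theta>: "x \<in> F k \<Longrightarrow> \<theta> x \<in> F k"
  by (rule \<theta>_mem[OF zspace_F]) (auto intro: F_W)

text \<open>The leading-term argument for the \<open>L\<close>. In \<open>x = y + D z\<close> with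
  \<open>D = L (-a-1)\<close> the operator \<open>Y = W (t+a+1)\<close> lowers \<open>y\<close> by
  two degrees, while on powers of \<open>D\<close> it acts as \<open>- \<theta> d/dD\<close>; so
  \<open>z\<close> must have smaller degree, provided that \<open>\<theta>\<close> is injective on
  the graded pieces. The hypothesis concerns \<open>\<theta> (W m x)\<close> instead of
  \<open>W m x\<close> in order to serve twice: for vectors with \<open>W m x\<close> in
  \<open>K\<close>, and for proving that very injectivity, where only \<open>\<theta> x\<close> is
  under control.\<close>

lemma F_drop:
  assumes inj: "\<And>j z. j \<le> k \<Longrightarrow> z \<in> F (Suc j) \<Longrightarrow> \<theta> z \<in> FK j \<Longrightarrow> z \<in> F j"
    and x: "x \<in> F (Suc (Suc k))" and sing: "\<And>m. int t < m \<Longrightarrow> \<theta> (W m x) \<in> FK k"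
  shows "x \<in> F (Suc k)"
proof -
  obtain a where "x \<in> FA a (Suc (Suc k))"
    using F_ex_FA[OF x] by blast
  then show ?thesis using sing
  proof (induction a arbitrary: x)
    case 0
    then show ?case by simp
  next
    case (Suc a)
    define D Y where "D = L (- int (Suc a))" and "Y = W (int (t + Suc a))"
    have D: "endo D" and Y: "endo Y"
      by (simp_all add: D_def Y_def endo_L endo_W)
    have m: "int t < int (t + Suc a)" by simp
    obtain y z where x: "x = y + D z" "y \<in> FA a (Suc (Suc k))" "z \<in> FA (Suc a) (Suc k)"
      using Suc.prems(1) unfolding D_def by (rule FA_SucE)
    have zF: "z \<in> F (Suc k)" by (rule FA_F[OF x(3)])
    have e: "- int (Suc a) + int (t + Suc a) = int t" by simp
    \<comment> \<open>The minus sign arises because \<open>\<theta>\<close> is the bracket of an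
      \<open>L\<close> with a \<open>W\<close>, taken here in the opposite order.\<close>
    have YD: "Y (D x) \<doteq> D (Y x) + - \<theta> x" for x
      using WL'[of "int (t + Suc a)" "- int (Suc a)" x] unfolding e D_def Y_def
      by (simp only: \<theta>_def add.assoc of_nat_eq_0_iff of_int_of_nat_eq minus_add_distrib scale_minus_left)
    have minus: "endo (\<lambda>x. - \<theta> x)"
      using endo_\<theta> zspace_minus[OF zspace_Z_self] by (auto simp: endo_def)
    have Y\<theta>: "Y (- \<theta> x) \<doteq> - \<theta> (Y x)" for x
      using eqv_scale[OF W_\<theta>, of "-1"] unfolding Y_def endo_minus[OF endo_W] by simp
    have comm: "(Y ^^ Suc i) (D z) \<doteq> D ((Y ^^ Suc i) z) + of_nat (Suc i) *s - \<theta> ((Y ^^ i) z)" for i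
      by (rule funpow_commutator[OF D zspace_E Y minus YD, of UNIV]) (simp_all add: Y\<theta>)
    \<comment> \<open>Descending induction on the power of \<open>Y\<close>, as in the case of one
      variable. For \<open>j = 0\<close> the claim is a mere degree count, since each
      \<open>Y\<close> lowers the degree; each step gains one degree over that count, and
      \<open>j = Suc k\<close> is the desired \<open>z \<in> F k\<close>.\<close>
    have "j \<le> Suc k \<Longrightarrow> (Y ^^ (Suc k - j)) z \<in> F (j - 1)" for j
    proof (induction j)
      case 0
      then show ?case
        using F_W_lower_pow[OF m zF, of "Suc k"] by (simp add: Y_def)
    next
      case (Suc j)
      define i where "i = k - j"
      have i: "Suc k - j = Suc i" "k - i = j"
        using Suc.prems by (simp_all add: i_def)
      define u where "u = (Y ^^ i) z"
      have Dz: "D ((Y ^^ Suc i) z) \<in> F j"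
        using F_L_pred Suc i unfolding D_def by simp
      have "(Y ^^ Suc i) y = (Y ^^ i) (Y y)"
        by (simp add: funpow_swap1)
      moreover have "Y y \<in> F k"
        unfolding Y_def by (rule FA_W_lower[OF _ x(2)]) simp
      ultimately have y: "(Y ^^ Suc i) y \<in> F j"
        using F_W_lower_pow[OF m, of _ k i] i by (simp add: Y_def)
      have "(Y ^^ i) (\<theta> (Y x)) \<in> FK j"
        using FK_lower_pow[OF m, of _ k i] \<open>\<And>m. int t < m \<Longrightarrow> \<theta> (W m x) \<in> FK k\<close>[OF m] i
        by (simp add: Y_def)
      then have "\<theta> ((Y ^^ i) (Y x)) \<in> FK j"
        using zspace_eqv[OF zspace_FK \<theta>_W_pow] unfolding Y_def by blast
      then have "\<theta> ((Y ^^ Suc i) x) \<in> FK j"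
        by (simp add: funpow_swap1)
      moreover have "(Y ^^ Suc i) x = (Y ^^ Suc i) y + (Y ^^ Suc i) (D z)"
        unfolding x(1) by (rule endo_add[OF endo_funpow[OF Y]])
      moreover have "\<theta> ((Y ^^ Suc i) y) \<in> FK j"
        by (rule F_FK[OF F_\<theta>[OF y]])
      ultimately have "\<theta> ((Y ^^ Suc i) (D z)) \<in> FK j"
        using zspace_diff[OF zspace_FK] endo_add[OF endo_\<theta>] by (metis add_diff_cancel_left')
      then have "\<theta> (D ((Y ^^ Suc i) z) + of_nat (Suc i) *s - \<theta> u) \<in> FK j"
        using zspace_eqv[OF zspace_FK endo_eqv[OF endo_\<theta> eqv_sym[OF comm]]] unfolding u_def by blast
      moreover have "\<theta> (D ((Y ^^ Suc i) z)) \<in> FK j"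
        by (rule F_FK[OF F_\<theta>[OF Dz]])
      ultimately have "\<theta> (of_nat (Suc i) *s - \<theta> u) \<in> FK j"
        using zspace_diff[OF zspace_FK] endo_add[OF endo_\<theta>] by (metis add_diff_cancel_left')
      then have "of_nat (Suc i) *s - \<theta> (\<theta> u) \<in> FK j"
        by (simp only: endo_scale[OF endo_\<theta>] endo_minus[OF endo_\<theta>])
      then have "(- 1 / of_nat (Suc i)) *s of_nat (Suc i) *s - \<theta> (\<theta> u) \<in> FK j"
        by (rule zspace_scale[OF zspace_FK])
      \<comment> \<open>One \<open>\<theta>\<close> comes from the hypothesis on \<open>x\<close>
        and the other from the commutator; both are removed in turn by \<open>inj\<close>.\<close>
      then have \<theta>\<theta>: "\<theta> (\<theta> u) \<in> FK j"
        by (simp del: of_nat_Suc)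
      have "u \<in> F (Suc k - i)"
        unfolding u_def Y_def by (rule F_W_lower_pow[OF m zF])
      then have u: "u \<in> F (Suc j)"
        using Suc.prems by (simp add: i_def Suc_diff_le)
      have j: "j \<le> k" using Suc.prems by simp
      have "\<theta> u \<in> F j"
        by (rule inj[OF j F_\<theta>[OF u] \<theta>\<theta>])
      then have "u \<in> F j"
        by (intro inj[OF j u] F_FK)
      then show ?case
        by (simp add: u_def i_def)
    qed
    from this[of "Suc k"] have z: "z \<in> F k" by simp
    \<comment> \<open>Now \<open>D z\<close> has lower degree, so the hypothesis passes from
      \<open>x\<close> to \<open>y\<close>, in which the variable \<open>D\<close> no longer occurs
      in top degree.\<close>
    have "y \<in> F (Suc k)"
    proof (rule Suc.IH[OF x(2)])
      fix m assume m: "int t < m"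
      have "D z \<in> F (Suc k)" unfolding D_def by (rule F_L[OF z])
      then have "\<theta> (W m (D z)) \<in> FK k"
        by (intro F_FK F_\<theta> F_W_lower[OF m])
      moreover have "\<theta> (W m x) = \<theta> (W m y) + \<theta> (W m (D z))"
        unfolding x(1) by (simp add: endo_add endo_\<theta> W_add)
      ultimately show "\<theta> (W m y) \<in> FK k"
        using Suc.prems(2)[OF m] zspace_diff[OF zspace_FK] by (metis add_diff_cancel_right')
    qed
    then show ?case
      unfolding x(1) D_def by (intro zspace_add[OF zspace_F] F_L[OF z])
  qed
qed

text \<open>On \<open>E\<close> this is injectivity modulo \<open>K\<close> together with
  \<open>E \<inter> K \<subseteq> Z\<close>. In higher degree, applying \<open>W m\<close> with
  \<open>m > t\<close> to \<open>\<theta> z\<close> and commuting shows that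
  \<open>\<theta> (W m z)\<close> drops one further degree, which is the hypothesis of
  \<open>F_drop\<close>; the injectivity that \<open>F_drop\<close> itself requires concerns smaller
  degrees only.\<close>

lemma F_\<theta>_inj: "z \<in> F (Suc k) \<Longrightarrow> \<theta> z \<in> FK k \<Longrightarrow> z \<in> F k"
proof (induction k arbitrary: z rule: less_induct)
  case (less k)
  show ?case
  proof (cases k)
    case 0
    obtain f \<kappa> where "\<theta> z = f + \<kappa>" "f \<in> Z" "\<kappa> \<in> K"
      using less.prems(2) 0 by (auto simp: FK_def)
    then have "z \<in> K"
      using \<theta>_K zspace_add[OF K] zspace_Z[OF K] by simp
    then show ?thesis
      using less.prems(1) 0 E_K by auto
  next
    case (Suc i)
    show ?thesis unfolding Suc
    proof (rule F_drop)
      show "z \<in> F (Suc (Suc i))" using less.prems(1) Suc by simp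
      show "\<theta> (W m z) \<in> FK i" if "int t < m" for m
        using zspace_eqv[OF zspace_FK \<theta>_W] FK_lower_pow[OF that, of "\<theta> z" "Suc i" 1] less.prems(2) Suc
        by simp
    qed (use less.IH Suc in auto)
  qed
qed

text \<open>The conditions on the \<open>W m\<close> bring the degree in the \<open>L\<close> down
  until \<open>x\<close> lies in \<open>E\<close>; there the conditions on the \<open>G m\<close>
  strip the operators \<open>G\<close>, and those on the \<open>L m\<close> strip the operators
  \<open>W\<close>.\<close>

theorem singular_in_V:
  assumes "\<And>m. int (t + d) < m \<Longrightarrow> L m x \<in> K" "\<And>m. int t < m \<Longrightarrow> W m x \<in> K"
    "\<And>m. int t \<le> m \<Longrightarrow> G m x \<in> K"
  shows "x \<in> V"
proof -
  let ?N = "\<Union>k. F k"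
  have "?N = UNIV"
  proof (rule generated)
    show "zspace ?N"
      by (rule zspace_UN_chain[of F, OF zspace_F F_Suc])
    show "V \<subseteq> ?N"
      using E_V F.simps(2) by blast
    show "L m x \<in> ?N" if "x \<in> ?N" for m x
      using that F_L by blast
    show "W m x \<in> ?N" if "x \<in> ?N" for m x
      using that F_W by blast
    show "G m x \<in> ?N" if "x \<in> ?N" for m x
      using that F_G by blast
  qed
  then obtain k where "x \<in> F k" by blast
  then have "x \<in> F (Suc k)" by (rule F_Suc_mem)
  then have "x \<in> E"
  proof (induction k)
    case 0
    then show ?case by simp
  next
    case (Suc k)
    have "x \<in> F (Suc k)"
    proof (rule F_drop[OF _ Suc.prems])
      show "\<theta> (W m x) \<in> FK k" if "int t < m" for m
        by (intro K_FK \<theta>_mem[OF K] K_stable assms(2)[OF that])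
    qed (rule F_\<theta>_inj)
    then show ?case by (rule Suc.IH)
  qed
  then show ?thesis using E_singular assms by blast
qed

end

section \<open>Subalgebras, quotients and their modules\<close>

lemma CC_simps [simp]:
  "carrier CC = UNIV" "add CC = (+)" "monoid.mult CC = (*)" "one CC = 1" "ring.zero CC = 0"
  by (simp_all add: ring_of_type_algebra_def)

lemma cring_CC: "cring CC"
  by (rule cring_from_type_algebra)

lemma CC_inv:
  assumes "module CC M" "x \<in> carrier M"
  shows "(-1) \<odot>\<^bsub>M\<^esub> x = \<ominus>\<^bsub>M\<^esub> x"
proof -
  interpret module CC M by fact
  have "(-1) \<odot>\<^bsub>M\<^esub> x \<oplus>\<^bsub>M\<^esub> x = (-1) \<odot>\<^bsub>M\<^esub> x \<oplus>\<^bsub>M\<^esub> 1 \<odot>\<^bsub>M\<^esub> x"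
    using assms smult_one[of x] by simp
  also have "\<dots> = (-1 + 1) \<odot>\<^bsub>M\<^esub> x"
    using smult_l_distr[of "-1" 1 x] assms by simp
  also have "\<dots> = \<zero>\<^bsub>M\<^esub>"
    using smult_l_null[of x] assms by simp
  finally show ?thesis
    using assms smult_closed[of "-1" x] M.minus_equality[of "(-1) \<odot>\<^bsub>M\<^esub> x" x] by simp
qed

lemma CC_submoduleI:
  assumes "module CC M" "N \<subseteq> carrier M" "\<zero>\<^bsub>M\<^esub> \<in> N"
    and "\<And>x y. x \<in> N \<Longrightarrow> y \<in> N \<Longrightarrow> x \<oplus>\<^bsub>M\<^esub> y \<in> N" "\<And>c x. x \<in> N \<Longrightarrow> c \<odot>\<^bsub>M\<^esub> x \<in> N"
  shows "submodule N CC M"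
proof -
  interpret module CC M by fact
  show ?thesis
    using assms CC_inv[OF assms(1)] by (intro submoduleI) (auto simp: subset_iff, metis)
qed

lemma CC_submoduleD:
  assumes "submodule N CC M"
  shows "x \<in> N \<Longrightarrow> x \<in> carrier M" "\<zero>\<^bsub>M\<^esub> \<in> N" "x \<in> N \<Longrightarrow> y \<in> N \<Longrightarrow> x \<oplus>\<^bsub>M\<^esub> y \<in> N"
    "x \<in> N \<Longrightarrow> c \<odot>\<^bsub>M\<^esub> x \<in> N"
proof -
  interpret submodule N CC M by fact
  show "x \<in> N \<Longrightarrow> x \<in> carrier M" "\<zero>\<^bsub>M\<^esub> \<in> N" "x \<in> N \<Longrightarrow> y \<in> N \<Longrightarrow> x \<oplus>\<^bsub>M\<^esub> y \<in> N"
    "x \<in> N \<Longrightarrow> c \<odot>\<^bsub>M\<^esub> x \<in> N"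
    using subset one_closed m_closed smult_closed by auto
qed

lemma set_add_iff: "x \<in> A <+>\<^bsub>M\<^esub> B \<longleftrightarrow> (\<exists>a\<in>A. \<exists>b\<in>B. x = a \<oplus>\<^bsub>M\<^esub> b)"
  by (auto simp: set_add_def set_mult_def)

text \<open>Additive inverses are obtained by multiplication with -1, which is the purpose of the
  assumption \<open>null\<close>.\<close>

lemma module_CC_I:
  assumes "\<And>x y. x \<in> carrier M \<Longrightarrow> y \<in> carrier M \<Longrightarrow> x \<oplus>\<^bsub>M\<^esub> y \<in> carrier M" "\<zero>\<^bsub>M\<^esub> \<in> carrier M"
    "\<And>x y z. \<lbrakk>x \<in> carrier M; y \<in> carrier M; z \<in> carrier M\<rbrakk> \<Longrightarrow> (x \<oplus>\<^bsub>M\<^esub> y) \<oplus>\<^bsub>M\<^esub> z = x \<oplus>\<^bsub>M\<^esub> (y \<oplus>\<^bsub>M\<^esub> z)"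
    "\<And>x y. x \<in> carrier M \<Longrightarrow> y \<in> carrier M \<Longrightarrow> x \<oplus>\<^bsub>M\<^esub> y = y \<oplus>\<^bsub>M\<^esub> x"
    "\<And>x. x \<in> carrier M \<Longrightarrow> \<zero>\<^bsub>M\<^esub> \<oplus>\<^bsub>M\<^esub> x = x"
    "\<And>c x. x \<in> carrier M \<Longrightarrow> c \<odot>\<^bsub>M\<^esub> x \<in> carrier M"
    "\<And>a b x. x \<in> carrier M \<Longrightarrow> (a + b) \<odot>\<^bsub>M\<^esub> x = a \<odot>\<^bsub>M\<^esub> x \<oplus>\<^bsub>M\<^esub> b \<odot>\<^bsub>M\<^esub> x"
    "\<And>a x y. x \<in> carrier M \<Longrightarrow> y \<in> carrier M \<Longrightarrow> a \<odot>\<^bsub>M\<^esub> (x \<oplus>\<^bsub>M\<^esub> y) = a \<odot>\<^bsub>M\<^esub> x \<oplus>\<^bsub>M\<^esub> a \<odot>\<^bsub>M\<^esub> y"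
    "\<And>a b x. x \<in> carrier M \<Longrightarrow> (a * b) \<odot>\<^bsub>M\<^esub> x = a \<odot>\<^bsub>M\<^esub> (b \<odot>\<^bsub>M\<^esub> x)"
    "\<And>x. x \<in> carrier M \<Longrightarrow> 1 \<odot>\<^bsub>M\<^esub> x = x" and null: "\<And>x. x \<in> carrier M \<Longrightarrow> 0 \<odot>\<^bsub>M\<^esub> x = \<zero>\<^bsub>M\<^esub>"
  shows "module CC M"
proof (rule moduleI[OF cring_CC])
  have "(-1) \<odot>\<^bsub>M\<^esub> x \<oplus>\<^bsub>M\<^esub> x = \<zero>\<^bsub>M\<^esub>" if "x \<in> carrier M" for x
    using assms(7)[OF that, of "-1" 1] assms(10)[OF that] null[OF that] by simp
  then have inv: "\<exists>y\<in>carrier M. y \<oplus>\<^bsub>M\<^esub> x = \<zero>\<^bsub>M\<^esub>" if "x \<in> carrier M" for x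
    using assms(6)[OF that] that by blast
  show "abelian_group M"
    by (rule abelian_groupI) (rule assms(1-5) inv; assumption)+
qed (simp_all add: assms(6-10))

lemma (in superspace) hpartD:
  shows hpart_carrier: "x \<in> hpart V i \<Longrightarrow> x \<in> carrier V" and hpart_zero: "\<zero>\<^bsub>V\<^esub> \<in> hpart V i"
    and hpart_add: "x \<in> hpart V i \<Longrightarrow> y \<in> hpart V i \<Longrightarrow> x \<oplus>\<^bsub>V\<^esub> y \<in> hpart V i"
    and hpart_smult: "x \<in> hpart V i \<Longrightarrow> c \<odot>\<^bsub>V\<^esub> x \<in> hpart V i"
  using CC_submoduleD[OF hpart_submodule] by auto

lemma (in superspace) hpart_decomp:
  assumes "x \<in> carrier V"
  obtains a b where "a \<in> hpart V 0" "b \<in> hpart V 1" "x = a \<oplus>\<^bsub>V\<^esub> b"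
  using assms hpart_sum by (auto simp: set_add_iff)

lemma (in superspace) smult_CC:
  shows CC_smult_closed: "x \<in> carrier V \<Longrightarrow> c \<odot>\<^bsub>V\<^esub> x \<in> carrier V"
    and CC_l_distr: "x \<in> carrier V \<Longrightarrow> (a + b) \<odot>\<^bsub>V\<^esub> x = a \<odot>\<^bsub>V\<^esub> x \<oplus>\<^bsub>V\<^esub> b \<odot>\<^bsub>V\<^esub> x"
    and CC_r_distr: "x \<in> carrier V \<Longrightarrow> y \<in> carrier V \<Longrightarrow> c \<odot>\<^bsub>V\<^esub> (x \<oplus>\<^bsub>V\<^esub> y) = c \<odot>\<^bsub>V\<^esub> x \<oplus>\<^bsub>V\<^esub> c \<odot>\<^bsub>V\<^esub> y"
    and CC_assoc: "x \<in> carrier V \<Longrightarrow> (a * b) \<odot>\<^bsub>V\<^esub> x = a \<odot>\<^bsub>V\<^esub> (b \<odot>\<^bsub>V\<^esub> x)"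
    and CC_one: "x \<in> carrier V \<Longrightarrow> 1 \<odot>\<^bsub>V\<^esub> x = x"
    and CC_null: "x \<in> carrier V \<Longrightarrow> 0 \<odot>\<^bsub>V\<^esub> x = \<zero>\<^bsub>V\<^esub>"
    and CC_r_null: "c \<odot>\<^bsub>V\<^esub> \<zero>\<^bsub>V\<^esub> = \<zero>\<^bsub>V\<^esub>"
    and CC_minus: "x \<in> carrier V \<Longrightarrow> \<ominus>\<^bsub>V\<^esub> x = (-1) \<odot>\<^bsub>V\<^esub> x"
  using smult_closed[of c x] smult_l_distr[of a b x] smult_r_distr[of c x y] smult_assoc1[of a b x]
    smult_one[of x] smult_l_null[of x] smult_r_null[of c] CC_inv[OF module_axioms, of x] by simp_all

text \<open>The axioms pass along a surjection \<open>\<pi>\<close>, except that the images of the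
  two parts may meet; hence the hypothesis \<open>disjoint\<close>. With the identity for
  \<open>\<pi>\<close> the lemma also changes mere record fields.\<close>

lemma superspace_image:
  assumes V: "superspace V"
    and carrier: "carrier W = \<pi> ` carrier V" and im_zero: "\<zero>\<^bsub>W\<^esub> = \<pi> \<zero>\<^bsub>V\<^esub>"
    and add: "\<And>x y. x \<in> carrier V \<Longrightarrow> y \<in> carrier V \<Longrightarrow> \<pi> x \<oplus>\<^bsub>W\<^esub> \<pi> y = \<pi> (x \<oplus>\<^bsub>V\<^esub> y)"
    and smult: "\<And>c x. x \<in> carrier V \<Longrightarrow> c \<odot>\<^bsub>W\<^esub> \<pi> x = \<pi> (c \<odot>\<^bsub>V\<^esub> x)"
    and hpart: "\<And>i. hpart W i = \<pi> ` hpart V i"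
    and disjoint: "hpart W 0 \<inter> hpart W 1 \<subseteq> {\<zero>\<^bsub>W\<^esub>}"
  shows "superspace W"
proof -
  interpret superspace V by fact
  have W: "module CC W"
    by (rule module_CC_I)
      (auto simp: carrier im_zero add smult CC_smult_closed CC_l_distr CC_r_distr CC_assoc CC_one CC_null
        M.a_assoc intro: arg_cong[of _ _ \<pi>, OF M.a_comm])
  show ?thesis
  proof (intro superspace.intro superspace_axioms.intro)
    fix i show "submodule (hpart W i) CC W"
    proof (rule CC_submoduleI[OF W])
      show "hpart W i \<subseteq> carrier W"
        using hpart_carrier by (auto simp: carrier hpart)
      show "\<zero>\<^bsub>W\<^esub> \<in> hpart W i"
        using hpart_zero by (simp add: hpart im_zero)
    qed (use hpart_carrier hpart_add hpart_smult in \<open>auto simp: hpart add smult\<close>)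
    have "\<zero>\<^bsub>W\<^esub> \<in> hpart W i" for i
      using hpart_zero by (simp add: hpart im_zero)
    then show "hpart W 0 \<inter> hpart W 1 = {\<zero>\<^bsub>W\<^esub>}"
      using disjoint by blast
    show "carrier W = hpart W 0 <+>\<^bsub>W\<^esub> hpart W 1"
    proof (intro equalityI subsetI)
      fix x assume "x \<in> carrier W"
      then obtain y where "x = \<pi> y" "y \<in> carrier V" by (auto simp: carrier)
      then show "x \<in> hpart W 0 <+>\<^bsub>W\<^esub> hpart W 1"
        using hpart_carrier by (elim hpart_decomp) (auto simp: set_add_iff hpart add intro!: bexI)
    next
      fix x assume "x \<in> hpart W 0 <+>\<^bsub>W\<^esub> hpart W 1"
      then show "x \<in> carrier W"
        using hpart_carrier by (auto simp: set_add_iff hpart add carrier)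
    qed
  qed (fact W)
qed

lemma (in lie_superalgebra) bracket_closed:
  assumes "x \<in> carrier \<gg>" "y \<in> carrier \<gg>"
  shows "bracket \<gg> x y \<in> carrier \<gg>"
proof -
  obtain a b c d where *: "a \<in> hpart \<gg> 0" "b \<in> hpart \<gg> 1" "x = a \<oplus> b"
    "c \<in> hpart \<gg> 0" "d \<in> hpart \<gg> 1" "y = c \<oplus> d"
    using assms hpart_decomp by metis
  then show ?thesis
    using bracket_hpart[THEN hpart_carrier] hpart_carrier by (simp add: bracket_add_left bracket_add_right)
qed

lemma lie_superalgebra_image:
  assumes g: "lie_superalgebra \<gg>"
    and carrier: "carrier \<hh> = \<pi> ` carrier \<gg>" and im_zero: "\<zero>\<^bsub>\<hh>\<^esub> = \<pi> \<zero>\<^bsub>\<gg>\<^esub>"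
    and add: "\<And>x y. x \<in> carrier \<gg> \<Longrightarrow> y \<in> carrier \<gg> \<Longrightarrow> \<pi> x \<oplus>\<^bsub>\<hh>\<^esub> \<pi> y = \<pi> (x \<oplus>\<^bsub>\<gg>\<^esub> y)"
    and smult: "\<And>c x. x \<in> carrier \<gg> \<Longrightarrow> c \<odot>\<^bsub>\<hh>\<^esub> \<pi> x = \<pi> (c \<odot>\<^bsub>\<gg>\<^esub> x)"
    and hpart: "\<And>i. hpart \<hh> i = \<pi> ` hpart \<gg> i"
    and disjoint: "hpart \<hh> 0 \<inter> hpart \<hh> 1 \<subseteq> {\<zero>\<^bsub>\<hh>\<^esub>}"
    and bracket: "\<And>x y. x \<in> carrier \<gg> \<Longrightarrow> y \<in> carrier \<gg> \<Longrightarrow> bracket \<hh> (\<pi> x) (\<pi> y) = \<pi> (bracket \<gg> x y)"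
  shows "lie_superalgebra \<hh>"
proof -
  interpret lie_superalgebra \<gg> by fact
  have "superspace \<hh>"
    by (rule superspace_image[OF superspace_axioms carrier im_zero add smult hpart disjoint])
  then interpret h: superspace \<hh> .
  have inv: "\<ominus>\<^bsub>\<hh>\<^esub> (\<pi> x) = \<pi> (\<ominus>\<^bsub>\<gg>\<^esub> x)" if "x \<in> carrier \<gg>" for x
    using that h.CC_minus[of "\<pi> x"] CC_minus[of x] by (simp add: carrier smult)
  note [simp] = add smult bracket inv bracket_closed CC_smult_closed
  show ?thesis
  proof (intro lie_superalgebra.intro lie_superalgebra_axioms.intro, fact)
    show "bracket \<hh> x y \<in> hpart \<hh> (i + j)" if xy: "x \<in> hpart \<hh> i" "y \<in> hpart \<hh> j" for x y i j
    proof -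
      obtain a b where ab: "a \<in> hpart \<gg> i" "x = \<pi> a" "b \<in> hpart \<gg> j" "y = \<pi> b"
        using xy unfolding hpart by blast
      have "bracket \<hh> x y = \<pi> (bracket \<gg> a b)"
        unfolding ab(2,4) by (rule bracket[OF hpart_carrier[OF ab(1)] hpart_carrier[OF ab(3)]])
      then show ?thesis
        unfolding hpart using bracket_hpart[OF ab(1,3)] by (rule image_eqI)
    qed
    show "bracket \<hh> x y = \<ominus>\<^bsub>\<hh>\<^esub> (koszul i j \<odot>\<^bsub>\<hh>\<^esub> bracket \<hh> y x)"
      if xy: "x \<in> hpart \<hh> i" "y \<in> hpart \<hh> j" for x y i j
    proof -
      obtain a b where ab: "a \<in> hpart \<gg> i" "x = \<pi> a" "b \<in> hpart \<gg> j" "y = \<pi> b"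
        using xy unfolding hpart by blast
      then have "a \<in> carrier \<gg>" "b \<in> carrier \<gg>"
        using hpart_carrier by blast+
      then show ?thesis
        using bracket_skew[OF ab(1,3)] ab(2,4) by simp
    qed
    show "bracket \<hh> x (bracket \<hh> y z) = bracket \<hh> (bracket \<hh> x y) z \<oplus>\<^bsub>\<hh>\<^esub>
        koszul i j \<odot>\<^bsub>\<hh>\<^esub> bracket \<hh> y (bracket \<hh> x z)"
      if xyz: "x \<in> hpart \<hh> i" "y \<in> hpart \<hh> j" "z \<in> hpart \<hh> k" for x y z i j k
    proof -
      obtain a b c where abc: "a \<in> hpart \<gg> i" "x = \<pi> a" "b \<in> hpart \<gg> j" "y = \<pi> b"
          "c \<in> hpart \<gg> k" "z = \<pi> c"
        using xyz unfolding hpart by blast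
      then have "a \<in> carrier \<gg>" "b \<in> carrier \<gg>" "c \<in> carrier \<gg>"
        using hpart_carrier by blast+
      then show ?thesis
        using bracket_jacobi[OF abc(1,3,5)] abc(2,4,6) by simp
    qed
  qed (auto simp: carrier bracket_add_left bracket_add_right bracket_smult_left bracket_smult_right)
qed

lemma superspace_sub:
  assumes V: "superspace V" and N: "submodule N CC V"
    and graded: "N \<subseteq> (N \<inter> hpart V 0) <+>\<^bsub>V\<^esub> (N \<inter> hpart V 1)"
    and W: "carrier W = N" "\<zero>\<^bsub>W\<^esub> = \<zero>\<^bsub>V\<^esub>" "add W = add V" "module.smult W = module.smult V"
      "\<And>i. hpart W i = hpart V i \<inter> N"
  shows "superspace W"
proof -
  interpret superspace V by fact
  note ND = CC_submoduleD[OF N]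
  have mod: "module CC W"
  proof (rule module_CC_I)
    show "(x \<oplus>\<^bsub>W\<^esub> y) \<oplus>\<^bsub>W\<^esub> z = x \<oplus>\<^bsub>W\<^esub> (y \<oplus>\<^bsub>W\<^esub> z)"
      if "x \<in> carrier W" "y \<in> carrier W" "z \<in> carrier W" for x y z
      using that M.a_assoc[of x y z] by (simp add: W ND(1))
    show "x \<oplus>\<^bsub>W\<^esub> y = y \<oplus>\<^bsub>W\<^esub> x" if "x \<in> carrier W" "y \<in> carrier W" for x y
      using that M.a_comm[of x y] by (simp add: W ND(1))
  qed (simp_all add: W ND CC_smult_closed CC_l_distr CC_r_distr CC_assoc CC_one CC_null)
  show ?thesis
  proof (intro superspace.intro superspace_axioms.intro)
    show "submodule (hpart W i) CC W" for i
      by (rule CC_submoduleI[OF mod]) (simp_all add: W ND(2-4) hpart_zero hpart_add hpart_smult)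
    have "(hpart V 0 \<inter> N) \<inter> (hpart V 1 \<inter> N) = {\<zero>\<^bsub>V\<^esub>}"
      using hpart_disjoint ND(2) by blast
    then show "hpart W 0 \<inter> hpart W 1 = {\<zero>\<^bsub>W\<^esub>}"
      by (simp only: W)
    have eq: "hpart W 0 <+>\<^bsub>W\<^esub> hpart W 1 = (N \<inter> hpart V 0) <+>\<^bsub>V\<^esub> (N \<inter> hpart V 1)"
      by (simp add: set_add_def set_mult_def W Int_commute)
    have "(N \<inter> hpart V 0) <+>\<^bsub>V\<^esub> (N \<inter> hpart V 1) \<subseteq> N"
      unfolding subset_iff set_add_iff using ND(3) by blast
    then show "carrier W = hpart W 0 <+>\<^bsub>W\<^esub> hpart W 1"
      unfolding eq W(1) using graded by (rule equalityI[rotated])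
  qed (fact mod)
qed

lemma lie_superalgebra_sub:
  assumes g: "lie_superalgebra \<gg>" and H: "submodule H CC \<gg>"
    and graded: "H \<subseteq> (H \<inter> hpart \<gg> 0) <+>\<^bsub>\<gg>\<^esub> (H \<inter> hpart \<gg> 1)"
    and closed: "\<And>x y. x \<in> H \<Longrightarrow> y \<in> H \<Longrightarrow> bracket \<gg> x y \<in> H"
  shows "lie_superalgebra (sub_lsa \<gg> H)"
proof -
  interpret lie_superalgebra \<gg> by fact
  note HD = CC_submoduleD[OF H]
  have S: "superspace (sub_lsa \<gg> H)"
    by (rule superspace_sub[OF superspace_axioms H graded]) (simp_all add: sub_lsa_def)
  have [simp]: "carrier (sub_lsa \<gg> H) = H" "\<And>i. hpart (sub_lsa \<gg> H) i = hpart \<gg> i \<inter> H"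
    "bracket (sub_lsa \<gg> H) = bracket \<gg>" "add (sub_lsa \<gg> H) = add \<gg>"
    "module.smult (sub_lsa \<gg> H) = module.smult \<gg>"
    by (simp_all add: sub_lsa_def)
  have inv: "\<ominus>\<^bsub>sub_lsa \<gg> H\<^esub> x = \<ominus>\<^bsub>\<gg>\<^esub> x" if "x \<in> H" for x
    using superspace.CC_minus[OF S, of x] CC_minus[of x] that HD by simp
  show ?thesis
  proof (intro lie_superalgebra.intro lie_superalgebra_axioms.intro)
    show "superspace (sub_lsa \<gg> H)" by (fact S)
    show "bracket (sub_lsa \<gg> H) x y = \<ominus>\<^bsub>sub_lsa \<gg> H\<^esub> (koszul i j \<odot>\<^bsub>sub_lsa \<gg> H\<^esub> bracket (sub_lsa \<gg> H) y x)"
      if "x \<in> hpart (sub_lsa \<gg> H) i" "y \<in> hpart (sub_lsa \<gg> H) j" for x y i j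
      using that bracket_skew[of x i y j] closed HD by (simp add: inv)
    show "bracket (sub_lsa \<gg> H) x y \<in> hpart (sub_lsa \<gg> H) (i + j)"
      if "x \<in> hpart (sub_lsa \<gg> H) i" "y \<in> hpart (sub_lsa \<gg> H) j" for x y i j
      using that bracket_hpart[of x i y j] closed by simp
    show "bracket (sub_lsa \<gg> H) x (bracket (sub_lsa \<gg> H) y z) =
        bracket (sub_lsa \<gg> H) (bracket (sub_lsa \<gg> H) x y) z \<oplus>\<^bsub>sub_lsa \<gg> H\<^esub>
        koszul i j \<odot>\<^bsub>sub_lsa \<gg> H\<^esub> bracket (sub_lsa \<gg> H) y (bracket (sub_lsa \<gg> H) x z)"
      if "x \<in> hpart (sub_lsa \<gg> H) i" "y \<in> hpart (sub_lsa \<gg> H) j" "z \<in> hpart (sub_lsa \<gg> H) k"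
      for x y z i j k
      using that bracket_jacobi[of x i y j z k] by simp
  qed (simp_all add: bracket_add_left bracket_add_right bracket_smult_left bracket_smult_right HD(1))
qed

lemma lie_supermodule_sub:
  assumes M: "lie_supermodule \<gg> M" and h: "lie_superalgebra (sub_lsa \<gg> H)" and H: "H \<subseteq> carrier \<gg>"
    and N: "submodule N CC M" and graded: "N \<subseteq> (N \<inter> hpart M 0) <+>\<^bsub>M\<^esub> (N \<inter> hpart M 1)"
    and closed: "\<And>x v. x \<in> H \<Longrightarrow> v \<in> N \<Longrightarrow> act M x v \<in> N"
  shows "lie_supermodule (sub_lsa \<gg> H) (M\<lparr>carrier := N, hpart := \<lambda>i. hpart M i \<inter> N\<rparr>)"
    (is "lie_supermodule ?h ?N")
proof -
  interpret lie_supermodule \<gg> M by fact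
  note ND = CC_submoduleD[OF N]
  have S: "superspace ?N"
    by (rule superspace_sub[OF M.superspace_axioms N graded]) simp_all
  have [simp]: "carrier ?h = H" "\<And>i. hpart ?h i = hpart \<gg> i \<inter> H"
    "bracket ?h = bracket \<gg>" "add ?h = add \<gg>" "module.smult ?h = module.smult \<gg>"
    by (simp_all add: sub_lsa_def)
  have inv: "x \<ominus>\<^bsub>?N\<^esub> y = x \<ominus>\<^bsub>M\<^esub> y" if "x \<in> N" "y \<in> N" for x y
    using superspace.CC_minus[OF S, of y] M.CC_minus[of y] that ND by (simp add: a_minus_def)
  show ?thesis
  proof (intro lie_supermodule.intro lie_supermodule_axioms.intro)
    show "lie_superalgebra ?h" "superspace ?N" by fact+
    show "act ?N (bracket ?h x y) v = act ?N x (act ?N y v) \<ominus>\<^bsub>?N\<^esub> koszul i j \<odot>\<^bsub>?N\<^esub> act ?N y (act ?N x v)"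
      if "x \<in> hpart ?h i" "y \<in> hpart ?h j" "v \<in> carrier ?N" for x y i j v
      using that act_bracket[of x i y j v] closed ND by (simp add: inv)
    show "act ?N x v \<in> hpart ?N (i + j)" if "x \<in> hpart ?h i" "v \<in> hpart ?N j" for x v i j
      using that act_hpart[of x i v j] closed by simp
  qed (simp_all add: act_add_left act_add_right act_smult_left act_smult_right ND(1) subsetD[OF H])
qed

lemma superspace_cong:
  assumes "superspace V" "carrier W = carrier V" "\<zero>\<^bsub>W\<^esub> = \<zero>\<^bsub>V\<^esub>" "add W = add V"
    "module.smult W = module.smult V" "hpart W = hpart V"
  shows "superspace W"
proof -
  interpret superspace V by fact
  show ?thesis
  proof (rule superspace_image[OF assms(1), of W "\<lambda>x. x"])
    show "hpart W 0 \<inter> hpart W 1 \<subseteq> {\<zero>\<^bsub>W\<^esub>}"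
      unfolding assms(3,6) using hpart_disjoint by (rule equalityD1)
  qed (simp_all only: assms image_ident)
qed

lemma (in lie_supermodule) act_closed:
  assumes "x \<in> carrier \<gg>" "v \<in> carrier M"
  shows "act M x v \<in> carrier M"
proof -
  obtain a b c d where *: "a \<in> hpart \<gg> 0" "b \<in> hpart \<gg> 1" "x = a \<oplus>\<^bsub>\<gg>\<^esub> b"
    "c \<in> hpart M 0" "d \<in> hpart M 1" "v = c \<oplus>\<^bsub>M\<^esub> d"
    using assms hpart_decomp M.hpart_decomp by metis
  have c: "a \<in> carrier \<gg>" "b \<in> carrier \<gg>" "c \<in> carrier M" "d \<in> carrier M"
    using hpart_carrier[OF *(1)] hpart_carrier[OF *(2)] M.hpart_carrier[OF *(4)] M.hpart_carrier[OF *(5)]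
    by simp_all
  have "act M a c \<in> carrier M" "act M a d \<in> carrier M" "act M b c \<in> carrier M" "act M b d \<in> carrier M"
    using act_hpart[OF *(1,4)] act_hpart[OF *(1,5)] act_hpart[OF *(2,4)] act_hpart[OF *(2,5)]
    by (blast dest: M.hpart_carrier)+
  with c show ?thesis
    unfolding *(3,6) by (simp add: act_add_left act_add_right)
qed

text \<open>Applied both to the quotient map from \<open>Td d\<close>, for an action that factors
  through it, and to the identity, when only the record around the module changes.\<close>

lemma lie_supermodule_descend:
  assumes M: "lie_supermodule \<gg> M" and h: "lie_superalgebra \<hh>"
    and carrier: "carrier \<hh> = \<pi> ` carrier \<gg>"
    and add: "\<And>x y. x \<in> carrier \<gg> \<Longrightarrow> y \<in> carrier \<gg> \<Longrightarrow> \<pi> x \<oplus>\<^bsub>\<hh>\<^esub> \<pi> y = \<pi> (x \<oplus>\<^bsub>\<gg>\<^esub> y)"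
    and smult: "\<And>c x. x \<in> carrier \<gg> \<Longrightarrow> c \<odot>\<^bsub>\<hh>\<^esub> \<pi> x = \<pi> (c \<odot>\<^bsub>\<gg>\<^esub> x)"
    and hpart: "\<And>i. hpart \<hh> i = \<pi> ` hpart \<gg> i"
    and bracket: "\<And>x y. x \<in> carrier \<gg> \<Longrightarrow> y \<in> carrier \<gg> \<Longrightarrow> bracket \<hh> (\<pi> x) (\<pi> y) = \<pi> (bracket \<gg> x y)"
    and N: "carrier N = carrier M" "\<zero>\<^bsub>N\<^esub> = \<zero>\<^bsub>M\<^esub>" "add N = add M" "module.smult N = module.smult M"
      "hpart N = hpart M"
    and act: "\<And>x v. x \<in> carrier \<gg> \<Longrightarrow> v \<in> carrier M \<Longrightarrow> act N (\<pi> x) v = act M x v"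
  shows "lie_supermodule \<hh> N"
proof -
  interpret lie_supermodule \<gg> M by fact
  have S: "superspace N" by (rule superspace_cong[OF M.superspace_axioms N])
  have inv: "x \<ominus>\<^bsub>N\<^esub> y = x \<ominus>\<^bsub>M\<^esub> y" for x y
    by (simp add: a_minus_def a_inv_def m_inv_def N)
  note [simp] = add smult bracket inv act N act_closed bracket_closed CC_smult_closed M.CC_smult_closed
  show ?thesis
  proof (intro lie_supermodule.intro lie_supermodule_axioms.intro)
    show "lie_superalgebra \<hh>" "superspace N" by fact+
    show "act N x v \<in> hpart N (i + j)" if xv: "x \<in> hpart \<hh> i" "v \<in> hpart N j" for x v i j
    proof -
      obtain a where a: "a \<in> hpart \<gg> i" "x = \<pi> a" using xv(1) unfolding hpart by blast
      have v: "v \<in> hpart M j" using xv(2) by simp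
      show ?thesis
        using act_hpart[OF a(1) v] act[OF hpart_carrier[OF a(1)] M.hpart_carrier[OF v]] a(2) by simp
    qed
    show "act N (bracket \<hh> x y) v = act N x (act N y v) \<ominus>\<^bsub>N\<^esub> koszul i j \<odot>\<^bsub>N\<^esub> act N y (act N x v)"
      if xy: "x \<in> hpart \<hh> i" "y \<in> hpart \<hh> j" and v: "v \<in> carrier N" for x y i j v
    proof -
      obtain a b where ab: "a \<in> hpart \<gg> i" "x = \<pi> a" "b \<in> hpart \<gg> j" "y = \<pi> b"
        using xy unfolding hpart by blast
      then have "a \<in> carrier \<gg>" "b \<in> carrier \<gg>"
        using hpart_carrier by blast+
      then show ?thesis
        using act_bracket[OF ab(1,3), of v] ab(2,4) v by simp
    qed
    show "act N (x \<oplus>\<^bsub>\<hh>\<^esub> y) v = act N x v \<oplus>\<^bsub>N\<^esub> act N y v"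
      if xy: "x \<in> carrier \<hh>" "y \<in> carrier \<hh>" and v: "v \<in> carrier N" for x y v
    proof -
      obtain a b where ab: "a \<in> carrier \<gg>" "x = \<pi> a" "b \<in> carrier \<gg>" "y = \<pi> b"
        using xy unfolding carrier by blast
      then show ?thesis using v by (simp add: act_add_left)
    qed
    show "act N (c \<odot>\<^bsub>\<hh>\<^esub> x) v = c \<odot>\<^bsub>N\<^esub> act N x v"
      if x: "x \<in> carrier \<hh>" and v: "v \<in> carrier N" for c x v
    proof -
      obtain a where "a \<in> carrier \<gg>" "x = \<pi> a"
        using x unfolding carrier by blast
      then show ?thesis using v by (simp add: act_smult_left)
    qed
    show "act N x (v \<oplus>\<^bsub>N\<^esub> w) = act N x v \<oplus>\<^bsub>N\<^esub> act N x w"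
      if x: "x \<in> carrier \<hh>" and v: "v \<in> carrier N" "w \<in> carrier N" for x v w
    proof -
      obtain a where "a \<in> carrier \<gg>" "x = \<pi> a"
        using x unfolding carrier by blast
      then show ?thesis using v by (simp add: act_add_right)
    qed
    show "act N x (c \<odot>\<^bsub>N\<^esub> v) = c \<odot>\<^bsub>N\<^esub> act N x v"
      if x: "x \<in> carrier \<hh>" and v: "v \<in> carrier N" for c x v
    proof -
      obtain a where "a \<in> carrier \<gg>" "x = \<pi> a"
        using x unfolding carrier by blast
      then show ?thesis using v by (simp add: act_smult_right)
    qed
  qed
qed

lemma (in lie_superalgebra) abelian_subgroup_submodule:
  assumes "submodule I CC \<gg>"
  shows "abelian_subgroup I \<gg>"
  using assms M.abelian_group_axioms
  by (intro abelian_subgroupI3 additive_subgroup.intro) (auto simp: submodule_def)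

text \<open>The quotient operations are defined as unions over all representatives. Since
  \<open>I\<close> is an ideal, all members of each union coincide, so the union is the value at any
  one representative.\<close>

lemma (in lie_superalgebra) quot_lsa_ops:
  assumes I: "submodule I CC \<gg>"
    and left: "\<And>x y. x \<in> I \<Longrightarrow> y \<in> carrier \<gg> \<Longrightarrow> bracket \<gg> x y \<in> I"
    and right: "\<And>x y. x \<in> carrier \<gg> \<Longrightarrow> y \<in> I \<Longrightarrow> bracket \<gg> x y \<in> I"
  defines "\<pi> \<equiv> \<lambda>x. I +>\<^bsub>\<gg>\<^esub> x"
  shows quot_lsa_carrier: "carrier (quot_lsa \<gg> I) = \<pi> ` carrier \<gg>"
    and quot_lsa_zero: "\<zero>\<^bsub>quot_lsa \<gg> I\<^esub> = \<pi> \<zero>"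
    and quot_lsa_add: "\<lbrakk>x \<in> carrier \<gg>; y \<in> carrier \<gg>\<rbrakk> \<Longrightarrow> \<pi> x \<oplus>\<^bsub>quot_lsa \<gg> I\<^esub> \<pi> y = \<pi> (x \<oplus> y)"
    and quot_lsa_smult: "x \<in> carrier \<gg> \<Longrightarrow> c \<odot>\<^bsub>quot_lsa \<gg> I\<^esub> \<pi> x = \<pi> (c \<odot>\<^bsub>\<gg>\<^esub> x)"
    and quot_lsa_bracket: "\<lbrakk>x \<in> carrier \<gg>; y \<in> carrier \<gg>\<rbrakk> \<Longrightarrow>
      bracket (quot_lsa \<gg> I) (\<pi> x) (\<pi> y) = \<pi> (bracket \<gg> x y)"
    and quot_lsa_hpart: "hpart (quot_lsa \<gg> I) i = \<pi> ` hpart \<gg> i"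
proof -
  interpret I: abelian_subgroup I \<gg>
    by (rule abelian_subgroup_submodule[OF I])
  note ID = CC_submoduleD[OF I]
  have mem: "y \<in> \<pi> x \<longleftrightarrow> (\<exists>h\<in>I. y = h \<oplus> x)" for x y
    by (auto simp: \<pi>_def a_r_coset_def')
  have self: "x \<in> \<pi> x" if "x \<in> carrier \<gg>" for x
    using that I.a_rcos_self by (simp add: \<pi>_def)
  have eq: "\<pi> y = \<pi> x" if "y = h \<oplus> x" "h \<in> I" "x \<in> carrier \<gg>" for x y h
  proof -
    have "y \<in> \<pi> x" using that mem by blast
    then show ?thesis
      using I.a_repr_independence'[of y x] that(3) by (simp add: \<pi>_def)
  qed
  show "carrier (quot_lsa \<gg> I) = \<pi> ` carrier \<gg>"
    unfolding quot_lsa_def A_RCOSETS_def' \<pi>_def by auto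
  show "\<zero>\<^bsub>quot_lsa \<gg> I\<^esub> = \<pi> \<zero>"
    using I.a_subset by (simp add: quot_lsa_def \<pi>_def)
  show "hpart (quot_lsa \<gg> I) i = \<pi> ` hpart \<gg> i"
    by (simp add: quot_lsa_def \<pi>_def)
  show "\<pi> x \<oplus>\<^bsub>quot_lsa \<gg> I\<^esub> \<pi> y = \<pi> (x \<oplus> y)" if "x \<in> carrier \<gg>" "y \<in> carrier \<gg>"
    using that by (simp add: quot_lsa_def \<pi>_def I.a_rcos_sum)
  show "c \<odot>\<^bsub>quot_lsa \<gg> I\<^esub> \<pi> x = \<pi> (c \<odot>\<^bsub>\<gg>\<^esub> x)" if x: "x \<in> carrier \<gg>"
  proof -
    have "\<pi> (c \<odot>\<^bsub>\<gg>\<^esub> y) = \<pi> (c \<odot>\<^bsub>\<gg>\<^esub> x)" if y: "y \<in> \<pi> x" for y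
    proof -
      obtain h where h: "h \<in> I" "y = h \<oplus> x" using y unfolding mem by blast
      then have "c \<odot>\<^bsub>\<gg>\<^esub> y = c \<odot>\<^bsub>\<gg>\<^esub> h \<oplus> c \<odot>\<^bsub>\<gg>\<^esub> x"
        using CC_r_distr[OF ID(1)[OF h(1)] x] by simp
      then show ?thesis
        by (rule eq[OF _ ID(4)[OF h(1)] CC_smult_closed[OF x]])
    qed
    then have "(\<Union>y\<in>\<pi> x. \<pi> (c \<odot>\<^bsub>\<gg>\<^esub> y)) = \<pi> (c \<odot>\<^bsub>\<gg>\<^esub> x)"
      by (intro UN_constant_eq[OF self[OF x]] ballI)
    then show ?thesis by (simp add: quot_lsa_def \<pi>_def)
  qed
  show "bracket (quot_lsa \<gg> I) (\<pi> x) (\<pi> y) = \<pi> (bracket \<gg> x y)" if xy: "x \<in> carrier \<gg>" "y \<in> carrier \<gg>"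
  proof -
    have "\<pi> (bracket \<gg> x' y') = \<pi> (bracket \<gg> x y)" if xy': "x' \<in> \<pi> x" "y' \<in> \<pi> y" for x' y'
    proof -
      obtain h k where hk: "h \<in> I" "x' = h \<oplus> x" "k \<in> I" "y' = k \<oplus> y" using xy' unfolding mem by blast
      have c: "h \<in> carrier \<gg>" "k \<in> carrier \<gg>" by (rule ID(1)[OF hk(1)], rule ID(1)[OF hk(3)])
      have "bracket \<gg> x' y' = (bracket \<gg> h k \<oplus> bracket \<gg> x k) \<oplus> (bracket \<gg> h y \<oplus> bracket \<gg> x y)"
        unfolding hk(2,4) using c xy by (simp add: bracket_add_left bracket_add_right)
      also have "\<dots> = ((bracket \<gg> h k \<oplus> bracket \<gg> x k) \<oplus> bracket \<gg> h y) \<oplus> bracket \<gg> x y"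
        using c xy by (simp add: bracket_closed M.a_assoc)
      finally show ?thesis
        by (rule eq) (intro ID(3) left[OF hk(1)] right[OF xy(1) hk(3)] c xy bracket_closed)+
    qed
    then have "(\<Union>x'\<in>\<pi> x. \<Union>y'\<in>\<pi> y. \<pi> (bracket \<gg> x' y')) = \<pi> (bracket \<gg> x y)"
      by (intro UN_constant_eq[OF self[OF xy(1)]] UN_constant_eq[OF self[OF xy(2)]] ballI)
    then show ?thesis by (simp add: quot_lsa_def \<pi>_def)
  qed
qed

text \<open>The point is that a coset with an even representative \<open>a\<close> and an odd one
  \<open>b\<close> is zero. Write \<open>a = k0 + k1 + b\<close> with \<open>k0\<close>,
  \<open>k1\<close> the homogeneous parts of an element of the graded ideal \<open>I\<close>; then
  \<open>a - k0 = k1 + b\<close> is both even and odd, so it vanishes and \<open>a = k0\<close>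
  belongs to \<open>I\<close>.\<close>

lemma (in lie_superalgebra) lie_superalgebra_quot:
  assumes I: "submodule I CC \<gg>"
    and graded: "I \<subseteq> (I \<inter> hpart \<gg> 0) <+>\<^bsub>\<gg>\<^esub> (I \<inter> hpart \<gg> 1)"
    and left: "\<And>x y. x \<in> I \<Longrightarrow> y \<in> carrier \<gg> \<Longrightarrow> bracket \<gg> x y \<in> I"
    and right: "\<And>x y. x \<in> carrier \<gg> \<Longrightarrow> y \<in> I \<Longrightarrow> bracket \<gg> x y \<in> I"
  shows "lie_superalgebra (quot_lsa \<gg> I)"
proof (rule lie_superalgebra_image[OF lie_superalgebra_axioms, where \<pi> = "\<lambda>x. I +>\<^bsub>\<gg>\<^esub> x"])
  show "hpart (quot_lsa \<gg> I) 0 \<inter> hpart (quot_lsa \<gg> I) 1 \<subseteq> {\<zero>\<^bsub>quot_lsa \<gg> I\<^esub>}"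
  proof
    interpret I: abelian_subgroup I \<gg>
      by (rule abelian_subgroup_submodule[OF I])
    fix A assume "A \<in> hpart (quot_lsa \<gg> I) 0 \<inter> hpart (quot_lsa \<gg> I) 1"
    then obtain a b where a: "A = I +>\<^bsub>\<gg>\<^esub> a" "a \<in> hpart \<gg> 0" and b: "A = I +>\<^bsub>\<gg>\<^esub> b" "b \<in> hpart \<gg> 1"
      by (auto simp: quot_lsa_def)
    have ab: "a \<in> carrier \<gg>" "b \<in> carrier \<gg>"
      by (rule hpart_carrier[OF a(2)], rule hpart_carrier[OF b(2)])
    have "a \<in> I +>\<^bsub>\<gg>\<^esub> b"
      using I.a_rcos_self[OF ab(1)] a(1) b(1) by simp
    then obtain k where k: "k \<in> I" "a = k \<oplus> b"
      by (auto simp: a_r_coset_def')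
    obtain k0 k1 where k01: "k = k0 \<oplus> k1" "k0 \<in> I" "k0 \<in> hpart \<gg> 0" "k1 \<in> hpart \<gg> 1"
      using subsetD[OF graded k(1)] by (auto simp: set_add_iff)
    have c: "k0 \<in> carrier \<gg>" "k1 \<in> carrier \<gg>"
      by (rule hpart_carrier[OF k01(3)], rule hpart_carrier[OF k01(4)])
    have "(-1) \<odot>\<^bsub>\<gg>\<^esub> k0 \<oplus> a = ((-1) \<odot>\<^bsub>\<gg>\<^esub> k0 \<oplus> k0) \<oplus> (k1 \<oplus> b)"
      using k(2) k01(1) c ab CC_smult_closed[OF c(1)] by (simp add: M.a_assoc)
    also have "\<dots> = k1 \<oplus> b"
      using c ab CC_minus[OF c(1)] M.l_neg[OF c(1)] by simp
    finally have eq: "(-1) \<odot>\<^bsub>\<gg>\<^esub> k0 \<oplus> a = k1 \<oplus> b" .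
    have "(-1) \<odot>\<^bsub>\<gg>\<^esub> k0 \<oplus> a \<in> hpart \<gg> 0"
      by (intro hpart_add hpart_smult k01 a)
    moreover have "k1 \<oplus> b \<in> hpart \<gg> 1"
      by (intro hpart_add k01 b)
    ultimately have z: "k1 \<oplus> b = \<zero>"
      using eq hpart_disjoint by auto
    have "a = k0 \<oplus> (k1 \<oplus> b)"
      using k(2) k01(1) c ab by (simp add: M.a_assoc)
    then have "a \<in> I"
      using z c k01 by simp
    then have "A = I"
      using a(1) I.a_rcos_const by simp
    then show "A \<in> {\<zero>\<^bsub>quot_lsa \<gg> I\<^esub>}"
      by (simp add: quot_lsa_def)
  qed
qed (rule quot_lsa_ops[OF I left right]; assumption)+

section \<open>Enveloping algebras\<close>

lemma poly_mapping_single_induct [case_names zero add]: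
  assumes "Q 0" "\<And>p k c. k \<notin> Poly_Mapping.keys p \<Longrightarrow> c \<noteq> 0 \<Longrightarrow> Q p \<Longrightarrow>
    Q (Poly_Mapping.single k c + (p :: 'k \<Rightarrow>\<^sub>0 'a::ab_group_add))"
  shows "Q p"
proof (induction p rule: update_induct)
  case const
  then show ?case using assms(1) by simp
next
  case (update p k c)
  have "Poly_Mapping.update k c p = Poly_Mapping.single k c + p"
  proof (rule poly_mapping_eqI)
    fix i show "Poly_Mapping.lookup (Poly_Mapping.update k c p) i = Poly_Mapping.lookup (Poly_Mapping.single k c + p) i"
      using update by (auto simp: lookup_update lookup_add lookup_single in_keys_iff)
  qed
  then show ?case using assms(2) update by metis
qed

text \<open>The linear extension of a map given on the basis of a space of finitely supported
  functions.\<close>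

definition pm_lift :: "('v, 'c) superspace_scheme \<Rightarrow> ('k \<Rightarrow> 'v) \<Rightarrow> ('k \<Rightarrow>\<^sub>0 complex) \<Rightarrow> 'v" where
  "pm_lift M h p = (\<Oplus>\<^bsub>M\<^esub>k\<in>Poly_Mapping.keys p. Poly_Mapping.lookup p k \<odot>\<^bsub>M\<^esub> h k)"

context superspace
begin

lemma pm_lift_superset:
  assumes "\<And>k. h k \<in> carrier V" "finite S" "Poly_Mapping.keys p \<subseteq> S"
  shows "pm_lift V h p = (\<Oplus>\<^bsub>V\<^esub>k\<in>S. Poly_Mapping.lookup p k \<odot>\<^bsub>V\<^esub> h k)"
  unfolding pm_lift_def
  by (rule M.add.finprod_mono_neutral_cong_left)
    (use assms in \<open>auto simp: in_keys_iff CC_null CC_smult_closed\<close>)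

lemma pm_lift_closed: "(\<And>k. h k \<in> carrier V) \<Longrightarrow> pm_lift V h p \<in> carrier V"
  unfolding pm_lift_def by (rule M.finsum_closed) (auto simp: CC_smult_closed)

lemma pm_lift_add:
  assumes h: "\<And>k. h k \<in> carrier V"
  shows "pm_lift V h (p + q) = pm_lift V h p \<oplus>\<^bsub>V\<^esub> pm_lift V h q"
proof -
  let ?S = "Poly_Mapping.keys p \<union> Poly_Mapping.keys q"
  have "pm_lift V h (p + q) = (\<Oplus>\<^bsub>V\<^esub>k\<in>?S. Poly_Mapping.lookup (p + q) k \<odot>\<^bsub>V\<^esub> h k)"
    using keys_add[of p q] by (intro pm_lift_superset h) auto
  also have "\<dots> = (\<Oplus>\<^bsub>V\<^esub>k\<in>?S. Poly_Mapping.lookup p k \<odot>\<^bsub>V\<^esub> h k \<oplus>\<^bsub>V\<^esub> Poly_Mapping.lookup q k \<odot>\<^bsub>V\<^esub> h k)"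
    by (simp only: lookup_add CC_l_distr[OF h])
  also have "\<dots> = (\<Oplus>\<^bsub>V\<^esub>k\<in>?S. Poly_Mapping.lookup p k \<odot>\<^bsub>V\<^esub> h k) \<oplus>\<^bsub>V\<^esub>
      (\<Oplus>\<^bsub>V\<^esub>k\<in>?S. Poly_Mapping.lookup q k \<odot>\<^bsub>V\<^esub> h k)"
    by (rule M.finsum_addf) (auto intro: CC_smult_closed h)
  also have "\<dots> = pm_lift V h p \<oplus>\<^bsub>V\<^esub> pm_lift V h q"
    using pm_lift_superset[OF h, of ?S p] pm_lift_superset[OF h, of ?S q] by simp
  finally show ?thesis .
qed

lemma pm_lift_single:
  assumes "\<And>k. h k \<in> carrier V"
  shows "pm_lift V h (Poly_Mapping.single k c) = c \<odot>\<^bsub>V\<^esub> h k"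
proof -
  have "pm_lift V h (Poly_Mapping.single k c) = (\<Oplus>\<^bsub>V\<^esub>i\<in>{k}. Poly_Mapping.lookup (Poly_Mapping.single k c) i \<odot>\<^bsub>V\<^esub> h i)"
    by (rule pm_lift_superset) (auto simp: assms)
  then show ?thesis
    using assms CC_smult_closed by (simp add: M.finsum_insert M.finsum_empty)
qed

end

definition pm_scale :: "complex \<Rightarrow> ('k \<Rightarrow>\<^sub>0 complex) \<Rightarrow> 'k \<Rightarrow>\<^sub>0 complex" where
  "pm_scale c = Poly_Mapping.map ((*) c)"

lemma lookup_pm_scale [simp]: "Poly_Mapping.lookup (pm_scale c p) k = c * Poly_Mapping.lookup p k"
  by (simp add: pm_scale_def map.rep_eq when_def)

lemma pm_scale_0 [simp]: "pm_scale c 0 = 0"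
  by (rule poly_mapping_eqI) simp

lemma pm_scale_single [simp]: "pm_scale c (Poly_Mapping.single k a) = Poly_Mapping.single k (c * a)"
  by (simp add: pm_scale_def)

lemma free_alg_simps [simp]:
  "carrier (free_alg \<gg>) = {p. \<forall>w\<in>Poly_Mapping.keys p. set (letters w) \<subseteq> carrier \<gg>}"
  "add (free_alg \<gg>) = (+)" "monoid.mult (free_alg \<gg>) = (*)" "one (free_alg \<gg>) = 1"
  "ring.zero (free_alg \<gg>) = 0"
  by (simp_all add: free_alg_def ring_of_type_algebra_def)

lemma letters_simps [simp]: "letters (u + v) = letters u @ letters v" "letters 0 = []"
  by (simp_all add: plus_gword_def zero_gword_def)

lemma free_alg_closed:
  shows free_alg_add: "p \<in> carrier (free_alg \<gg>) \<Longrightarrow> q \<in> carrier (free_alg \<gg>) \<Longrightarrow> p + q \<in> carrier (free_alg \<gg>)"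
    and free_alg_mult: "p \<in> carrier (free_alg \<gg>) \<Longrightarrow> q \<in> carrier (free_alg \<gg>) \<Longrightarrow> p * q \<in> carrier (free_alg \<gg>)"
    and free_alg_uminus: "p \<in> carrier (free_alg \<gg>) \<Longrightarrow> - p \<in> carrier (free_alg \<gg>)"
    and free_alg_minus: "p \<in> carrier (free_alg \<gg>) \<Longrightarrow> q \<in> carrier (free_alg \<gg>) \<Longrightarrow> p - q \<in> carrier (free_alg \<gg>)"
    and free_alg_0: "0 \<in> carrier (free_alg \<gg>)" and free_alg_1: "1 \<in> carrier (free_alg \<gg>)"
    and free_alg_single: "set (letters w) \<subseteq> carrier \<gg> \<Longrightarrow> Poly_Mapping.single w c \<in> carrier (free_alg \<gg>)"
proof -
  show add: "p + q \<in> carrier (free_alg \<gg>)" if "p \<in> carrier (free_alg \<gg>)" "q \<in> carrier (free_alg \<gg>)" for p q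
    using that keys_add[of p q] by fastforce
  show "p * q \<in> carrier (free_alg \<gg>)" if "p \<in> carrier (free_alg \<gg>)" "q \<in> carrier (free_alg \<gg>)"
    using that keys_mult[of p q] by (fastforce simp: subset_iff)
  show min: "- p \<in> carrier (free_alg \<gg>)" if "p \<in> carrier (free_alg \<gg>)" for p
    using that by (simp add: in_keys_iff)
  show "p - q \<in> carrier (free_alg \<gg>)" if "p \<in> carrier (free_alg \<gg>)" "q \<in> carrier (free_alg \<gg>)"
    using add[OF that(1) min[OF that(2)]] by simp
  show "Poly_Mapping.single w c \<in> carrier (free_alg \<gg>)" if "set (letters w) \<subseteq> carrier \<gg>"
    using that by (cases "c = 0") auto
qed (auto simp flip: single_one)

lemma free_alg_letter: "x \<in> carrier \<gg> \<Longrightarrow> letter x \<in> carrier (free_alg \<gg>)"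
  unfolding letter_def by (rule free_alg_single) simp

lemma free_alg_const: "const c \<in> carrier (free_alg \<gg>)"
  unfolding const_def by (rule free_alg_single) simp

lemma ring_free_alg: "ring (free_alg \<gg>)"
proof (rule ringI)
  show "abelian_group (free_alg \<gg>)"
  proof (rule abelian_groupI)
    fix x assume "x \<in> carrier (free_alg \<gg>)"
    then show "\<exists>y\<in>carrier (free_alg \<gg>). y \<oplus>\<^bsub>free_alg \<gg>\<^esub> x = \<zero>\<^bsub>free_alg \<gg>\<^esub>"
      using free_alg_uminus by (intro bexI[of _ "- x"]) auto
  qed (use free_alg_add free_alg_0 in \<open>auto simp del: free_alg_simps(1) simp: ac_simps\<close>)
  show "Group.monoid (free_alg \<gg>)"
    by (rule Group.monoidI) (use free_alg_mult free_alg_1 in \<open>auto simp del: free_alg_simps(1) simp: mult.assoc\<close>)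
qed (auto simp: algebra_simps)

lemma free_alg_a_inv:
  assumes "p \<in> carrier (free_alg \<gg>)"
  shows "\<ominus>\<^bsub>free_alg \<gg>\<^esub> p = - p"
proof -
  interpret ring "free_alg \<gg>" by (rule ring_free_alg)
  show ?thesis
    using minus_equality[of "- p" p] assms free_alg_uminus[OF assms] by simp
qed

lemma idealI_free_alg:
  assumes "I \<subseteq> carrier (free_alg \<gg>)" "0 \<in> I" "\<And>p q. p \<in> I \<Longrightarrow> q \<in> I \<Longrightarrow> p + q \<in> I"
    and "\<And>p q. p \<in> I \<Longrightarrow> q \<in> carrier (free_alg \<gg>) \<Longrightarrow> q * p \<in> I"
    and "\<And>p q. p \<in> I \<Longrightarrow> q \<in> carrier (free_alg \<gg>) \<Longrightarrow> p * q \<in> I"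
  shows "ideal I (free_alg \<gg>)"
proof (rule idealI[OF ring_free_alg])
  interpret ring "free_alg \<gg>" by (rule ring_free_alg)
  show "subgroup I (add_monoid (free_alg \<gg>))"
  proof (rule subgroup.intro)
    fix p assume p: "p \<in> I"
    have "(- 1) * p \<in> I"
      using assms(4)[OF p free_alg_uminus[OF free_alg_1]] .
    then show "inv\<^bsub>add_monoid (free_alg \<gg>)\<^esub> p \<in> I"
      using p assms(1) free_alg_a_inv[of p \<gg>] by (auto simp: a_inv_def simp del: free_alg_simps)
  qed (use assms in auto)
qed (use assms(4,5) in \<open>auto simp del: free_alg_simps(1)\<close>)

lemma (in lie_superalgebra) env_rel_closed: "env_rel \<gg> \<subseteq> carrier (free_alg \<gg>)"
  unfolding env_rel_def
  by (auto simp del: free_alg_simps intro!: free_alg_minus free_alg_mult free_alg_letter free_alg_const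
      bracket_closed CC_smult_closed M.a_closed elim: hpart_carrier)

lemma (in lie_superalgebra) ideal_env_ideal: "ideal (env_ideal \<gg>) (free_alg \<gg>)"
  unfolding env_ideal_def by (rule ring.genideal_ideal[OF ring_free_alg env_rel_closed])

lemma (in lie_superalgebra) env_rel_ideal: "env_rel \<gg> \<subseteq> env_ideal \<gg>"
  unfolding env_ideal_def by (rule ring.genideal_self[OF ring_free_alg env_rel_closed])

lemma free_alg_induct [consumes 1, case_names zero add]:
  assumes "p \<in> carrier (free_alg \<gg>)" "Q 0"
    and "\<And>w c p. set (letters w) \<subseteq> carrier \<gg> \<Longrightarrow> p \<in> carrier (free_alg \<gg>) \<Longrightarrow> Q p \<Longrightarrow> Q (Poly_Mapping.single w c + p)"
  shows "Q p"
proof -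
  have "p \<in> carrier (free_alg \<gg>) \<longrightarrow> Q p"
  proof (induction p rule: poly_mapping_single_induct)
    case zero
    then show ?case using assms(2) by blast
  next
    case (add p w c)
    have "Poly_Mapping.keys (Poly_Mapping.single w c + p) = insert w (Poly_Mapping.keys p)"
      using add.hyps by (auto simp: in_keys_iff lookup_add lookup_single when_def split: if_splits)
    then show ?case
      using add assms(3)[of w p c] by auto
  qed
  then show ?thesis using assms(1) by blast
qed

context lie_superalgebra
begin

lemma env_class_mem: "q \<in> env_class \<gg> p \<longleftrightarrow> q - p \<in> env_ideal \<gg>"
  by (auto simp: env_class_def a_r_coset_def') (metis diff_add_cancel)

lemma env_ideal_closed:
  shows env_ideal_carrier: "p \<in> env_ideal \<gg> \<Longrightarrow> p \<in> carrier (free_alg \<gg>)"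
    and env_ideal_add: "p \<in> env_ideal \<gg> \<Longrightarrow> q \<in> env_ideal \<gg> \<Longrightarrow> p + q \<in> env_ideal \<gg>"
    and env_ideal_0: "0 \<in> env_ideal \<gg>"
    and env_ideal_uminus: "p \<in> env_ideal \<gg> \<Longrightarrow> - p \<in> env_ideal \<gg>"
    and env_ideal_left: "p \<in> env_ideal \<gg> \<Longrightarrow> q \<in> carrier (free_alg \<gg>) \<Longrightarrow> q * p \<in> env_ideal \<gg>"
    and env_ideal_right: "p \<in> env_ideal \<gg> \<Longrightarrow> q \<in> carrier (free_alg \<gg>) \<Longrightarrow> p * q \<in> env_ideal \<gg>"
proof -
  interpret I: ideal "env_ideal \<gg>" "free_alg \<gg>" by (rule ideal_env_ideal)
  show c: "p \<in> env_ideal \<gg> \<Longrightarrow> p \<in> carrier (free_alg \<gg>)" for p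
    by (rule I.a_Hcarr)
  show "p \<in> env_ideal \<gg> \<Longrightarrow> q \<in> env_ideal \<gg> \<Longrightarrow> p + q \<in> env_ideal \<gg>"
    using additive_subgroup.a_closed[OF ideal.axioms(1)[OF ideal_env_ideal], of p q] by (simp del: free_alg_simps(1))
  show "0 \<in> env_ideal \<gg>"
    using additive_subgroup.zero_closed[OF ideal.axioms(1)[OF ideal_env_ideal]] by (simp del: free_alg_simps(1))
  show "p \<in> env_ideal \<gg> \<Longrightarrow> - p \<in> env_ideal \<gg>"
    using additive_subgroup.a_inv_closed[OF ideal.axioms(1)[OF ideal_env_ideal], of p] free_alg_a_inv[OF c, of p] by simp
  show "p \<in> env_ideal \<gg> \<Longrightarrow> q \<in> carrier (free_alg \<gg>) \<Longrightarrow> q * p \<in> env_ideal \<gg>"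
    using I.I_l_closed[of p q] by (simp del: free_alg_simps(1))
  show "p \<in> env_ideal \<gg> \<Longrightarrow> q \<in> carrier (free_alg \<gg>) \<Longrightarrow> p * q \<in> env_ideal \<gg>"
    using I.I_r_closed[of p q] by (simp del: free_alg_simps(1))
qed

lemma env_class_self: "p \<in> env_class \<gg> p"
  using env_class_mem env_ideal_0 by simp

lemma env_class_eqI:
  assumes "p - q \<in> env_ideal \<gg>"
  shows "env_class \<gg> p = env_class \<gg> q"
proof -
  have "r - p \<in> env_ideal \<gg> \<longleftrightarrow> r - q \<in> env_ideal \<gg>" for r
    using env_ideal_add[of "r - p" "p - q"] env_ideal_add[of "r - q" "- (p - q)"]
      env_ideal_uminus[OF assms] assms by auto
  then show ?thesis
    using env_class_mem by blast
qed

lemma carrier_env: "carrier (env \<gg>) = env_class \<gg> ` carrier (free_alg \<gg>)"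
  unfolding env_def FactRing_def A_RCOSETS_def' env_class_def by auto

lemma env_class_add:
  assumes "p \<in> carrier (free_alg \<gg>)" "q \<in> carrier (free_alg \<gg>)"
  shows "env_class \<gg> p \<oplus>\<^bsub>env \<gg>\<^esub> env_class \<gg> q = env_class \<gg> (p + q)"
proof -
  interpret I: ideal "env_ideal \<gg>" "free_alg \<gg>" by (rule ideal_env_ideal)
  show ?thesis
    using I.a_rcos_sum[OF assms] by (simp add: env_def FactRing_def env_class_def)
qed

lemma env_class_mult:
  assumes "p \<in> carrier (free_alg \<gg>)" "q \<in> carrier (free_alg \<gg>)"
  shows "env_class \<gg> p \<otimes>\<^bsub>env \<gg>\<^esub> env_class \<gg> q = env_class \<gg> (p * q)"
proof -
  interpret I: ideal "env_ideal \<gg>" "free_alg \<gg>" by (rule ideal_env_ideal)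
  show ?thesis
    using I.rcoset_mult_add[OF assms] by (simp add: env_def FactRing_def env_class_def)
qed

text \<open>The ideal of \<open>\<gg>\<close>, intersected with the free algebra on
  \<open>H\<close>, is an ideal there and contains the relations of the subalgebra, so by minimality
  it contains the ideal of the subalgebra. Injectivity of the map between the enveloping algebras is
  not asserted.\<close>

lemma env_incl_class:
  assumes h: "lie_superalgebra (sub_lsa \<gg> H)" and H: "H \<subseteq> carrier \<gg>"
    and p: "p \<in> carrier (free_alg (sub_lsa \<gg> H))"
  shows "env_incl \<gg> (env_class (sub_lsa \<gg> H) p) = env_class \<gg> p"
proof -
  let ?h = "sub_lsa \<gg> H"
  interpret h: lie_superalgebra ?h by (rule h)
  have sub: "q \<in> carrier (free_alg \<gg>)" if "q \<in> carrier (free_alg ?h)" for q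
    using that H by (force simp: sub_lsa_def)
  let ?I = "env_ideal \<gg> \<inter> carrier (free_alg ?h)"
  have "ideal ?I (free_alg ?h)"
  proof (rule idealI_free_alg)
    show "0 \<in> ?I"
      using env_ideal_0 free_alg_0 by (rule IntI)
    show "p + q \<in> ?I" if "p \<in> ?I" "q \<in> ?I" for p q
      using that by (intro IntI env_ideal_add free_alg_add; elim IntE)
    show "q * p \<in> ?I" if p: "p \<in> ?I" and q: "q \<in> carrier (free_alg ?h)" for p q
      by (intro IntI env_ideal_left free_alg_mult sub[OF q] q IntD1[OF p] IntD2[OF p])
    show "p * q \<in> ?I" if p: "p \<in> ?I" and q: "q \<in> carrier (free_alg ?h)" for p q
      by (intro IntI env_ideal_right free_alg_mult sub[OF q] q IntD1[OF p] IntD2[OF p])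
  qed (rule Int_lower2)
  moreover have "env_rel ?h \<subseteq> env_rel \<gg>"
  proof
    fix p assume "p \<in> env_rel ?h"
    then consider (add) x y where "p = letter (x \<oplus>\<^bsub>\<gg>\<^esub> y) - letter x - letter y" "x \<in> H" "y \<in> H"
      | (smult) c x where "p = letter (c \<odot>\<^bsub>\<gg>\<^esub> x) - const c * letter x" "x \<in> H"
      | (bracket) x y i j where "p = letter x * letter y - const (koszul i j) * letter y * letter x - letter (bracket \<gg> x y)"
          "x \<in> hpart \<gg> i" "y \<in> hpart \<gg> j"
      unfolding env_rel_def sub_lsa_def by auto
    then show "p \<in> env_rel \<gg>"
    proof cases
      case add
      then show ?thesis using subsetD[OF H] unfolding env_rel_def by blast
    next
      case smult
      then show ?thesis using subsetD[OF H] unfolding env_rel_def by blast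
    next
      case bracket
      then show ?thesis unfolding env_rel_def by blast
    qed
  qed
  ultimately have sub_ideal: "env_ideal ?h \<subseteq> env_ideal \<gg>"
    using ring.genideal_minimal[OF ring_free_alg, of ?I ?h "env_rel ?h"]
      env_rel_ideal h.env_rel_closed unfolding env_ideal_def[of ?h] by (meson Int_subset_iff order_trans)
  show ?thesis
  proof (intro equalityI subsetI)
    fix r assume "r \<in> env_incl \<gg> (env_class ?h p)"
    then obtain i q where r: "r = i + q" "i \<in> env_ideal \<gg>" "q \<in> env_class ?h p"
      by (auto simp: env_incl_def set_add_iff)
    then have "q - p \<in> env_ideal \<gg>"
      using h.env_class_mem sub_ideal by blast
    then have "i + (q - p) \<in> env_ideal \<gg>"
      using env_ideal_add r(2) by blast
    then show "r \<in> env_class \<gg> p"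
      by (simp add: env_class_mem r(1) add_diff_eq)
  next
    fix r assume "r \<in> env_class \<gg> p"
    then have "r - p \<in> env_ideal \<gg>" "r = (r - p) + p"
      by (simp_all add: env_class_mem)
    then show "r \<in> env_incl \<gg> (env_class ?h p)"
      unfolding env_incl_def set_add_iff
      by (intro bexI[of _ "r - p"] bexI[OF _ h.env_class_self[of p]]) simp_all
  qed
qed

end

context lie_supermodule
begin

lemma act_zero: "x \<in> carrier \<gg> \<Longrightarrow> act M x \<zero>\<^bsub>M\<^esub> = \<zero>\<^bsub>M\<^esub>"
  using act_smult_right[of x "\<zero>\<^bsub>M\<^esub>" 0] by (simp add: M.CC_null act_closed)

abbreviation word_act :: "'g gword \<Rightarrow> 'v \<Rightarrow> 'v" where
  "word_act w \<equiv> foldr (act M) (letters w)"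

lemma foldr_act:
  assumes "set xs \<subseteq> carrier \<gg>"
  shows foldr_act_closed: "v \<in> carrier M \<Longrightarrow> foldr (act M) xs v \<in> carrier M"
    and foldr_act_add: "v \<in> carrier M \<Longrightarrow> w \<in> carrier M \<Longrightarrow>
      foldr (act M) xs (v \<oplus>\<^bsub>M\<^esub> w) = foldr (act M) xs v \<oplus>\<^bsub>M\<^esub> foldr (act M) xs w"
    and foldr_act_smult: "v \<in> carrier M \<Longrightarrow> foldr (act M) xs (c \<odot>\<^bsub>M\<^esub> v) = c \<odot>\<^bsub>M\<^esub> foldr (act M) xs v"
proof -
  have cl: "foldr (act M) xs v \<in> carrier M" if "v \<in> carrier M" "set xs \<subseteq> carrier \<gg>" for v xs
    using that by (induction xs) (auto intro: act_closed)
  show "v \<in> carrier M \<Longrightarrow> foldr (act M) xs v \<in> carrier M"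
    using cl assms by blast
  show "v \<in> carrier M \<Longrightarrow> w \<in> carrier M \<Longrightarrow>
      foldr (act M) xs (v \<oplus>\<^bsub>M\<^esub> w) = foldr (act M) xs v \<oplus>\<^bsub>M\<^esub> foldr (act M) xs w"
    using assms by (induction xs) (simp_all add: cl act_add_right)
  show "v \<in> carrier M \<Longrightarrow> foldr (act M) xs (c \<odot>\<^bsub>M\<^esub> v) = c \<odot>\<^bsub>M\<^esub> foldr (act M) xs v"
    using assms by (induction xs) (simp_all add: cl act_smult_right)
qed

text \<open>The value zero on words with foreign letters makes the extension total, since the rules
  for \<open>pm_lift\<close> ask every basis value to lie in the module.\<close>

definition lift_act :: "'v \<Rightarrow> ('g gword \<Rightarrow>\<^sub>0 complex) \<Rightarrow> 'v" where
  "lift_act v = pm_lift M (\<lambda>w. if set (letters w) \<subseteq> carrier \<gg> then word_act w v else \<zero>\<^bsub>M\<^esub>)"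

lemma free_act_lift:
  assumes "p \<in> carrier (free_alg \<gg>)" "v \<in> carrier M"
  shows "free_act M p v = lift_act v p"
  unfolding free_act_def lift_act_def pm_lift_def
  by (rule M.finsum_cong') (use assms in \<open>auto intro!: M.CC_smult_closed foldr_act_closed\<close>)

context
  fixes v assumes v: "v \<in> carrier M"
begin

lemma word_act_total: "(if set (letters w) \<subseteq> carrier \<gg> then word_act w v else \<zero>\<^bsub>M\<^esub>) \<in> carrier M"
  using v by (auto intro: foldr_act_closed)

lemma free_act_closed: "p \<in> carrier (free_alg \<gg>) \<Longrightarrow> free_act M p v \<in> carrier M"
  using v M.pm_lift_closed[OF word_act_total] by (simp add: free_act_lift lift_act_def del: free_alg_simps(1))

lemma free_act_0: "free_act M 0 v = \<zero>\<^bsub>M\<^esub>"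
  by (simp add: free_act_def)

lemma free_act_add:
  "p \<in> carrier (free_alg \<gg>) \<Longrightarrow> q \<in> carrier (free_alg \<gg>) \<Longrightarrow>
    free_act M (p + q) v = free_act M p v \<oplus>\<^bsub>M\<^esub> free_act M q v"
  using v M.pm_lift_add[OF word_act_total] by (simp add: free_act_lift lift_act_def free_alg_add del: free_alg_simps(1))

lemma free_act_single:
  "set (letters w) \<subseteq> carrier \<gg> \<Longrightarrow> free_act M (Poly_Mapping.single w c) v = c \<odot>\<^bsub>M\<^esub> word_act w v"
  using v M.pm_lift_single[OF word_act_total, where k = w and c = c] by (simp add: free_act_lift lift_act_def free_alg_single del: free_alg_simps(1))

lemma free_act_letter: "x \<in> carrier \<gg> \<Longrightarrow> free_act M (letter x) v = act M x v"
  unfolding letter_def using v by (simp add: free_act_single M.CC_one act_closed)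

lemma free_act_const: "free_act M (const c) v = c \<odot>\<^bsub>M\<^esub> v"
  unfolding const_def by (simp add: free_act_single)

lemma free_act_diff:
  assumes "p \<in> carrier (free_alg \<gg>)" "q \<in> carrier (free_alg \<gg>)"
  shows "free_act M (p - q) v = free_act M p v \<ominus>\<^bsub>M\<^esub> free_act M q v"
proof -
  have d: "p - q \<in> carrier (free_alg \<gg>)"
    using free_alg_minus assms .
  have "free_act M p v = free_act M (p - q) v \<oplus>\<^bsub>M\<^esub> free_act M q v"
    using free_act_add[OF d assms(2)] by simp
  then show ?thesis
    using free_act_closed[OF d] free_act_closed[OF assms(2)]
    by (simp add: a_minus_def M.a_assoc M.r_neg)
qed

end

lemma free_act_right:
  assumes p: "p \<in> carrier (free_alg \<gg>)" and v: "v \<in> carrier M"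
  shows free_act_add_right: "w \<in> carrier M \<Longrightarrow> free_act M p (v \<oplus>\<^bsub>M\<^esub> w) = free_act M p v \<oplus>\<^bsub>M\<^esub> free_act M p w"
    and free_act_smult_right: "free_act M p (c \<odot>\<^bsub>M\<^esub> v) = c \<odot>\<^bsub>M\<^esub> free_act M p v"
proof -
  show "free_act M p (v \<oplus>\<^bsub>M\<^esub> w) = free_act M p v \<oplus>\<^bsub>M\<^esub> free_act M p w" if w: "w \<in> carrier M"
    using p
  proof (induction p rule: free_alg_induct)
    case zero
    then show ?case using v w by (simp add: free_act_0)
  next
    case (add u c p)
    have "c \<odot>\<^bsub>M\<^esub> word_act u v \<in> carrier M" "c \<odot>\<^bsub>M\<^esub> word_act u w \<in> carrier M"
      "free_act M p v \<in> carrier M" "free_act M p w \<in> carrier M"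
      using add v w by (auto intro!: M.CC_smult_closed foldr_act_closed free_act_closed simp del: free_alg_simps(1))
    then show ?case
      using add v w
      by (simp add: free_act_add free_act_single free_alg_single foldr_act_add foldr_act_closed M.CC_r_distr
          M.add.m_ac del: free_alg_simps(1))
  qed
  show "free_act M p (c \<odot>\<^bsub>M\<^esub> v) = c \<odot>\<^bsub>M\<^esub> free_act M p v"
    using p
  proof (induction p rule: free_alg_induct)
    case zero
    then show ?case using v by (simp add: free_act_0 M.CC_r_null M.CC_smult_closed)
  next
    case (add u a p)
    have "a \<odot>\<^bsub>M\<^esub> (c \<odot>\<^bsub>M\<^esub> word_act u v) = c \<odot>\<^bsub>M\<^esub> (a \<odot>\<^bsub>M\<^esub> word_act u v)"
      using add.hyps v by (simp add: M.CC_assoc[symmetric] foldr_act_closed mult.commute)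
    then show ?case
      using add v
      by (simp add: free_act_add free_act_single free_alg_single foldr_act_smult foldr_act_closed M.CC_r_distr
          M.CC_smult_closed free_act_closed del: free_alg_simps(1))
  qed
qed

lemma free_act_single_mult:
  assumes q: "q \<in> carrier (free_alg \<gg>)" and v: "v \<in> carrier M" and w: "set (letters w) \<subseteq> carrier \<gg>"
  shows "free_act M (Poly_Mapping.single w c * q) v = c \<odot>\<^bsub>M\<^esub> word_act w (free_act M q v)"
  using q
proof (induction q rule: free_alg_induct)
  case zero
  have "word_act w \<zero>\<^bsub>M\<^esub> = \<zero>\<^bsub>M\<^esub>"
    using foldr_act_smult[OF w, of "\<zero>\<^bsub>M\<^esub>" 0] foldr_act_closed[OF w] by (simp add: M.CC_null)
  then show ?case using v by (simp add: free_act_0 M.CC_r_null)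
next
  case (add u a q)
  have s: "Poly_Mapping.single (w + u) (c * a) \<in> carrier (free_alg \<gg>)"
    using w add.hyps by (intro free_alg_single) auto
  have q: "Poly_Mapping.single w c * q \<in> carrier (free_alg \<gg>)"
    by (intro free_alg_mult free_alg_single w add.hyps)
  have "free_act M (Poly_Mapping.single w c * (Poly_Mapping.single u a + q)) v =
      (c * a) \<odot>\<^bsub>M\<^esub> word_act w (word_act u v) \<oplus>\<^bsub>M\<^esub> c \<odot>\<^bsub>M\<^esub> word_act w (free_act M q v)"
    using w add.hyps by (simp add: distrib_left mult_single free_act_add[OF v s q] add.IH free_act_single[OF v]
        del: free_alg_simps(1))
  also have "\<dots> = c \<odot>\<^bsub>M\<^esub> word_act w (a \<odot>\<^bsub>M\<^esub> word_act u v \<oplus>\<^bsub>M\<^esub> free_act M q v)"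
    using w add.hyps v
    by (simp add: foldr_act_add foldr_act_smult foldr_act_closed M.CC_smult_closed free_act_closed M.CC_assoc
        M.CC_r_distr del: free_alg_simps(1))
  finally show ?case
    using add.hyps v by (simp add: free_act_add free_alg_single free_act_single del: free_alg_simps(1))
qed

lemma free_act_mult:
  assumes p: "p \<in> carrier (free_alg \<gg>)" and q: "q \<in> carrier (free_alg \<gg>)" and v: "v \<in> carrier M"
  shows "free_act M (p * q) v = free_act M p (free_act M q v)"
  using p
proof (induction p rule: free_alg_induct)
  case zero
  then show ?case using v q by (simp add: free_act_0 free_act_closed)
next
  case (add w c p)
  then show ?case
    using q v by (simp add: distrib_right free_act_add free_act_single_mult free_alg_mult free_alg_single
        free_act_single free_act_closed del: free_alg_simps(1))
qed

lemma free_act_const_mult: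
  "p \<in> carrier (free_alg \<gg>) \<Longrightarrow> v \<in> carrier M \<Longrightarrow> free_act M (const c * p) v = c \<odot>\<^bsub>M\<^esub> free_act M p v"
  by (simp add: free_act_mult free_act_const free_act_closed free_alg_const del: free_alg_simps(1))

text \<open>The elements of the free algebra that annihilate the module form a two-sided ideal, and
  the module axioms say that it contains the defining relations.\<close>

lemma free_act_env_ideal:
  assumes "p \<in> env_ideal \<gg>" "v \<in> carrier M"
  shows "free_act M p v = \<zero>\<^bsub>M\<^esub>"
proof -
  let ?A = "{p \<in> carrier (free_alg \<gg>). \<forall>v\<in>carrier M. free_act M p v = \<zero>\<^bsub>M\<^esub>}"
  have zero: "free_act M p \<zero>\<^bsub>M\<^esub> = \<zero>\<^bsub>M\<^esub>" if "p \<in> carrier (free_alg \<gg>)" for p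
    using free_act_smult_right[OF that, of "\<zero>\<^bsub>M\<^esub>" 0] free_act_closed[OF _ that] by (simp add: M.CC_null)
  have "ideal ?A (free_alg \<gg>)"
  proof (rule idealI_free_alg)
    show "p + q \<in> ?A" if "p \<in> ?A" "q \<in> ?A" for p q
      using that by (auto simp: free_act_add intro: free_alg_add simp del: free_alg_simps(1))
    show "q * p \<in> ?A" if "p \<in> ?A" "q \<in> carrier (free_alg \<gg>)" for p q
      using that by (auto simp: free_act_mult zero intro: free_alg_mult simp del: free_alg_simps(1))
    show "p * q \<in> ?A" if "p \<in> ?A" "q \<in> carrier (free_alg \<gg>)" for p q
      using that by (auto simp: free_act_mult free_act_closed intro: free_alg_mult simp del: free_alg_simps(1))
  qed (auto simp: free_act_0)
  moreover have "env_rel \<gg> \<subseteq> ?A"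
  proof -
    have "free_act M p v = \<zero>\<^bsub>M\<^esub>" if p: "p \<in> env_rel \<gg>" and v: "v \<in> carrier M" for p v
    proof -
      consider (add) x y where "p = letter (x \<oplus>\<^bsub>\<gg>\<^esub> y) - letter x - letter y" "x \<in> carrier \<gg>" "y \<in> carrier \<gg>"
        | (smult) c x where "p = letter (c \<odot>\<^bsub>\<gg>\<^esub> x) - const c * letter x" "x \<in> carrier \<gg>"
        | (bracket) x y i j where "p = letter x * letter y - const (koszul i j) * letter y * letter x - letter (bracket \<gg> x y)"
            "x \<in> hpart \<gg> i" "y \<in> hpart \<gg> j"
        using p unfolding env_rel_def by blast
      then show ?thesis
      proof cases
        case add
        then have c: "x \<oplus>\<^bsub>\<gg>\<^esub> y \<in> carrier \<gg>" "act M x v \<in> carrier M" "act M y v \<in> carrier M"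
          using v by (auto intro: act_closed)
        then have "free_act M p v = (act M x v \<oplus>\<^bsub>M\<^esub> act M y v) \<ominus>\<^bsub>M\<^esub> act M x v \<ominus>\<^bsub>M\<^esub> act M y v"
          using add v by (simp add: free_act_diff free_alg_letter free_alg_minus free_act_letter act_add_left
              del: free_alg_simps(1))
        also have "\<dots> = \<zero>\<^bsub>M\<^esub>"
          using c M.r_neg[of "act M x v \<oplus>\<^bsub>M\<^esub> act M y v"]
          by (simp add: a_minus_def M.minus_add M.a_assoc)
        finally show ?thesis .
      next
        case smult
        then have c: "c \<odot>\<^bsub>\<gg>\<^esub> x \<in> carrier \<gg>" "act M x v \<in> carrier M"
          using v by (auto intro: act_closed CC_smult_closed)
        then show ?thesis
          using smult v by (simp add: free_act_diff free_alg_letter free_alg_mult free_alg_const free_act_letter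
              free_act_const_mult act_smult_left M.CC_smult_closed a_minus_def M.r_neg del: free_alg_simps(1))
      next
        case bracket
        have x: "x \<in> carrier \<gg>" "y \<in> carrier \<gg>"
          by (rule hpart_carrier[OF bracket(2)], rule hpart_carrier[OF bracket(3)])
        then have c: "act M x v \<in> carrier M" "act M y v \<in> carrier M" "act M x (act M y v) \<in> carrier M"
            "act M y (act M x v) \<in> carrier M" "bracket \<gg> x y \<in> carrier \<gg>"
          using v by (auto intro: act_closed bracket_closed)
        have "free_act M p v = (act M x (act M y v) \<ominus>\<^bsub>M\<^esub> koszul i j \<odot>\<^bsub>M\<^esub> act M y (act M x v)) \<ominus>\<^bsub>M\<^esub>
            act M (bracket \<gg> x y) v"
          using bracket(1) x c v by (simp add: free_act_diff free_alg_letter free_alg_mult free_alg_const free_act_letter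
              free_alg_minus free_act_const free_act_const_mult free_act_mult mult.assoc del: free_alg_simps(1))
        also have "\<dots> = \<zero>\<^bsub>M\<^esub>"
          using act_bracket[OF bracket(2,3) v] c M.CC_smult_closed[OF c(4), of "koszul i j"]
          by (simp add: a_minus_def M.r_neg)
        finally show ?thesis .
      qed
    qed
    then show ?thesis using env_rel_closed by blast
  qed
  ultimately have "env_ideal \<gg> \<subseteq> ?A"
    unfolding env_ideal_def by (rule ring.genideal_minimal[OF ring_free_alg])
  then show ?thesis using assms by blast
qed

lemma env_act_class:
  assumes p: "p \<in> carrier (free_alg \<gg>)" and v: "v \<in> carrier M"
  shows "env_act M (env_class \<gg> p) v = free_act M p v"
proof -
  have "free_act M q v = free_act M p v" if "q \<in> env_class \<gg> p" for q
  proof -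
    have d: "q - p \<in> env_ideal \<gg>"
      using that env_class_mem by blast
    have "free_act M ((q - p) + p) v = \<zero>\<^bsub>M\<^esub> \<oplus>\<^bsub>M\<^esub> free_act M p v"
      using free_act_add[OF v env_ideal_carrier[OF d] p] free_act_env_ideal[OF d v] by simp
    then show ?thesis
      using free_act_closed[OF v p] by simp
  qed
  then have "(\<lambda>q. free_act M q v) ` env_class \<gg> p = (\<lambda>q. free_act M p v) ` env_class \<gg> p"
    by (intro image_cong refl)
  then have "(\<lambda>q. free_act M q v) ` env_class \<gg> p = {free_act M p v}"
    by (simp only: image_constant[OF env_class_self])
  then show ?thesis
    unfolding env_act_def by simp
qed

end

section \<open>Induced modules\<close>

text \<open>\<open>V\<close> lies inside \<open>P\<close> and carries the restricted operations;
  this is what provides the canonical map from the induced module to \<open>P\<close>. As every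
  element of the type belongs to \<open>\<gg>\<close>, every word is admissible and the free algebra
  is the whole type.\<close>

locale induced_module = P: lie_supermodule \<gg> P + V: lie_supermodule "sub_lsa \<gg> H" V
  for \<gg> :: "('g, 'b) lie_superalgebra_scheme" and H
    and P :: "('g, 'v, 'c) lie_supermodule_scheme" and V :: "('g, 'v, 'd) lie_supermodule_scheme" +
  assumes univ: "carrier \<gg> = UNIV"
    and V_sub: "carrier V \<subseteq> carrier P" "add V = add P" "\<zero>\<^bsub>V\<^esub> = \<zero>\<^bsub>P\<^esub>"
      "module.smult V = module.smult P"
    and V_act: "x \<in> H \<Longrightarrow> v \<in> carrier V \<Longrightarrow> act V x v = act P x v"
    and V_hpart: "hpart V i = hpart P i \<inter> carrier V"
begin

abbreviation S where "S \<equiv> carrier (env \<gg>) \<times> carrier V"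
abbreviation FA where "FA \<equiv> free_Abelian_group S"
abbreviation Ker where "Ker \<equiv> ind_ker \<gg> H V"
abbreviation h where "h \<equiv> sub_lsa \<gg> H"

text \<open>The first argument is a representative in the free algebra, so that calculations need
  not manipulate cosets of the enveloping algebra.\<close>

definition tens :: "('g gword \<Rightarrow>\<^sub>0 complex) \<Rightarrow> 'v \<Rightarrow> (('g gword \<Rightarrow>\<^sub>0 complex) set \<times> 'v) \<Rightarrow>\<^sub>0 int" where
  "tens p v = frag_of (env_class \<gg> p, v)"

lemma free_alg_UNIV [simp]: "carrier (free_alg \<gg>) = UNIV"
  by (simp add: univ)

declare free_alg_simps(1) [simp del]

lemma carrier_env_UNIV: "carrier (env \<gg>) = range (env_class \<gg>)"
  using P.carrier_env by simp

lemma carrier_sub: "carrier h = H"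
  by (simp add: sub_lsa_def)

lemma tens_mem: "v \<in> carrier V \<Longrightarrow> tens p v \<in> carrier FA"
  by (simp add: tens_def carrier_env_UNIV)

lemma carrier_FA: "carrier FA = {t. Poly_Mapping.keys t \<subseteq> S}"
  by (simp add: free_Abelian_group_def)

declare carrier_free_Abelian_group_iff [simp del]

lemma FA_closed:
  shows FA_add: "s \<in> carrier FA \<Longrightarrow> t \<in> carrier FA \<Longrightarrow> s + t \<in> carrier FA"
    and FA_diff: "s \<in> carrier FA \<Longrightarrow> t \<in> carrier FA \<Longrightarrow> s - t \<in> carrier FA"
    and FA_uminus: "s \<in> carrier FA \<Longrightarrow> - s \<in> carrier FA"
    and FA_0: "0 \<in> carrier FA"
  using keys_add[of s t] keys_diff[of s t] unfolding carrier_FA by auto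

abbreviation rel where
  "rel \<equiv> tensor_rel (env h) (env \<gg>) V (\<lambda>u a. u \<otimes>\<^bsub>env \<gg>\<^esub> env_incl \<gg> a) (env_act V)"

lemma Ker_generate: "Ker = generate FA rel"
  by (simp add: ind_ker_def tensor_ker_def)

lemma rel_cases:
  assumes "t \<in> rel"
  obtains (left) p q v where "t = tens (p + q) v - tens p v - tens q v" "v \<in> carrier V"
    | (right) p v w where "t = tens p (v \<oplus>\<^bsub>V\<^esub> w) - tens p v - tens p w" "v \<in> carrier V" "w \<in> carrier V"
    | (balanced) p q v where "t = tens (p * q) v - tens p (free_act V q v)" "q \<in> carrier (free_alg h)" "v \<in> carrier V"
proof -
  consider (1) x y v where "t = frag_of (x \<oplus>\<^bsub>env \<gg>\<^esub> y, v) - frag_of (x, v) - frag_of (y, v)"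
        "x \<in> carrier (env \<gg>)" "y \<in> carrier (env \<gg>)" "v \<in> carrier V"
    | (2) x v w where "t = frag_of (x, v \<oplus>\<^bsub>V\<^esub> w) - frag_of (x, v) - frag_of (x, w)"
        "x \<in> carrier (env \<gg>)" "v \<in> carrier V" "w \<in> carrier V"
    | (3) x a v where "t = frag_of (x \<otimes>\<^bsub>env \<gg>\<^esub> env_incl \<gg> a, v) - frag_of (x, env_act V a v)"
        "x \<in> carrier (env \<gg>)" "a \<in> carrier (env h)" "v \<in> carrier V"
    using assms unfolding tensor_rel_def by blast
  then show ?thesis
  proof cases
    case 1
    then obtain p q where "x = env_class \<gg> p" "y = env_class \<gg> q"
      by (auto simp: carrier_env_UNIV)
    then show ?thesis
      using left[of p q v] 1 P.env_class_add[of p q] by (simp add: tens_def)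
  next
    case 2
    then obtain p where "x = env_class \<gg> p"
      by (auto simp: carrier_env_UNIV)
    then show ?thesis
      using right[of p v w] 2 by (simp add: tens_def)
  next
    case 3
    then obtain p where p: "x = env_class \<gg> p"
      by (auto simp: carrier_env_UNIV)
    obtain q where q: "a = env_class h q" "q \<in> carrier (free_alg h)"
      using 3(3) unfolding V.carrier_env by blast
    have "env_incl \<gg> a = env_class \<gg> q"
      using P.env_incl_class[OF V.lie_superalgebra_axioms _ q(2)] q(1) univ by simp
    then show ?thesis
      using balanced[of p q v] 3 p q P.env_class_mult[of p q] V.env_act_class[OF q(2) 3(4)]
      by (simp add: tens_def)
  qed
qed

lemma rel_intros:
  shows rel_left: "v \<in> carrier V \<Longrightarrow> tens (p + q) v - tens p v - tens q v \<in> rel"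
    and rel_right: "v \<in> carrier V \<Longrightarrow> w \<in> carrier V \<Longrightarrow> tens p (v \<oplus>\<^bsub>V\<^esub> w) - tens p v - tens p w \<in> rel"
    and rel_balanced: "q \<in> carrier (free_alg h) \<Longrightarrow> v \<in> carrier V \<Longrightarrow> tens (p * q) v - tens p (free_act V q v) \<in> rel"
proof -
  have c: "env_class \<gg> p \<in> carrier (env \<gg>)" for p
    by (simp add: carrier_env_UNIV)
  show "tens (p + q) v - tens p v - tens q v \<in> rel" if "v \<in> carrier V"
    using that c[of p] c[of q] P.env_class_add[of p q, symmetric] unfolding tensor_rel_def tens_def
    by (intro UnI1 CollectI exI[of _ "env_class \<gg> p"] exI[of _ "env_class \<gg> q"] exI[of _ v]) simp
  show "tens p (v \<oplus>\<^bsub>V\<^esub> w) - tens p v - tens p w \<in> rel" if "v \<in> carrier V" "w \<in> carrier V"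
    using that c[of p] unfolding tensor_rel_def tens_def
    by (intro UnI1[OF UnI2] CollectI exI[of _ "env_class \<gg> p"] exI[of _ v] exI[of _ w]) simp
  show "tens (p * q) v - tens p (free_act V q v) \<in> rel" if q: "q \<in> carrier (free_alg h)" and v: "v \<in> carrier V"
  proof -
    have "env_incl \<gg> (env_class h q) = env_class \<gg> q"
      using P.env_incl_class[OF V.lie_superalgebra_axioms _ q] univ by simp
    then show ?thesis
      using v c[of p] q P.env_class_mult[of p q, symmetric] V.env_act_class[OF q v] unfolding tensor_rel_def tens_def
      by (intro UnI2 CollectI exI[of _ "env_class \<gg> p"] exI[of _ "env_class h q"] exI[of _ v])
        (simp add: V.carrier_env)
  qed
qed

lemma rel_FA: "rel \<subseteq> carrier FA"
proof
  fix t assume "t \<in> rel"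
  then show "t \<in> carrier FA"
    by (cases rule: rel_cases) (simp_all add: FA_diff tens_mem V.free_act_closed)
qed

lemma group_FA: "group FA" and comm_group_FA: "comm_group FA"
  by (simp_all add: abelian_free_Abelian_group)

lemma inv_FA: "t \<in> carrier FA \<Longrightarrow> inv\<^bsub>FA\<^esub> t = - t"
  by (rule group.inv_equality[OF group_FA]) (auto simp: FA_uminus)

lemma subgroup_Ker: "subgroup Ker FA"
  unfolding Ker_generate by (rule group.generate_is_subgroup[OF group_FA rel_FA])

lemma Ker_closed:
  shows Ker_FA: "t \<in> Ker \<Longrightarrow> t \<in> carrier FA"
    and Ker_0: "0 \<in> Ker"
    and Ker_add: "s \<in> Ker \<Longrightarrow> t \<in> Ker \<Longrightarrow> s + t \<in> Ker"
    and Ker_uminus: "t \<in> Ker \<Longrightarrow> - t \<in> Ker"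
    and Ker_diff: "s \<in> Ker \<Longrightarrow> t \<in> Ker \<Longrightarrow> s - t \<in> Ker"
proof -
  show FA: "t \<in> carrier FA" if "t \<in> Ker" for t
    using subgroup.subset[OF subgroup_Ker] that by blast
  show "0 \<in> Ker"
    using subgroup.one_closed[OF subgroup_Ker] by simp
  show add: "s + t \<in> Ker" if "s \<in> Ker" "t \<in> Ker" for s t
    using subgroup.m_closed[OF subgroup_Ker that] by simp
  show min: "- t \<in> Ker" if "t \<in> Ker" for t
    using subgroup.m_inv_closed[OF subgroup_Ker that] inv_FA[OF FA[OF that]] by simp
  show "s - t \<in> Ker" if "s \<in> Ker" "t \<in> Ker"
    using add[OF that(1) min[OF that(2)]] by simp
qed

lemma Ker_tens:
  shows Ker_left: "v \<in> carrier V \<Longrightarrow> tens (p + q) v - tens p v - tens q v \<in> Ker"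
    and Ker_right: "v \<in> carrier V \<Longrightarrow> w \<in> carrier V \<Longrightarrow> tens p (v \<oplus>\<^bsub>V\<^esub> w) - tens p v - tens p w \<in> Ker"
    and Ker_balanced: "q \<in> carrier (free_alg h) \<Longrightarrow> v \<in> carrier V \<Longrightarrow> tens (p * q) v - tens p (free_act V q v) \<in> Ker"
  unfolding Ker_generate by (auto intro: generate.incl rel_left rel_right rel_balanced)

text \<open>The form in which a map out of the tensor product is checked to be well defined: only
  bilinearity and balancedness remain to be verified.\<close>

lemma Ker_minimal:
  assumes "0 \<in> N" "\<And>s t. s \<in> N \<Longrightarrow> t \<in> N \<Longrightarrow> s + t \<in> N" "\<And>t. t \<in> N \<Longrightarrow> - t \<in> N"
    and "\<And>p q v. v \<in> carrier V \<Longrightarrow> tens (p + q) v - tens p v - tens q v \<in> N"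
    and "\<And>p v w. v \<in> carrier V \<Longrightarrow> w \<in> carrier V \<Longrightarrow> tens p (v \<oplus>\<^bsub>V\<^esub> w) - tens p v - tens p w \<in> N"
    and "\<And>p q v. q \<in> carrier (free_alg h) \<Longrightarrow> v \<in> carrier V \<Longrightarrow> tens (p * q) v - tens p (free_act V q v) \<in> N"
  shows "Ker \<subseteq> N"
proof
  have rel: "t \<in> N" if "t \<in> rel" for t
    using that by (cases rule: rel_cases) (simp_all add: assms(4-6))
  fix t assume "t \<in> Ker"
  then show "t \<in> N"
    unfolding Ker_generate
  proof (induction rule: generate.induct)
    case one
    then show ?case using assms(1) by simp
  next
    case (incl t)
    then show ?case by (rule rel)
  next
    case (inv t)
    then show ?case
      using assms(3)[OF rel[OF inv]] inv_FA[OF subsetD[OF rel_FA inv]] by simp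
  next
    case (eng s t)
    then show ?case using assms(2) by simp
  qed
qed

lemma tens_0: "v \<in> carrier V \<Longrightarrow> tens 0 v \<in> Ker"
  using Ker_uminus[OF Ker_left[of v 0 0]] by simp

definition lmul where
  "lmul p = frag_extend (\<lambda>(u, v). frag_of (env_class \<gg> p \<otimes>\<^bsub>env \<gg>\<^esub> u, v))"

lemma lmul_tens: "lmul p (tens q v) = tens (p * q) v"
  using P.env_class_mult[of p q] by (simp add: lmul_def tens_def)

lemma lmul_linear:
  shows lmul_add: "lmul p (s + t) = lmul p s + lmul p t" and lmul_diff: "lmul p (s - t) = lmul p s - lmul p t"
    and lmul_uminus: "lmul p (- t) = - lmul p t" and lmul_0: "lmul p 0 = 0"
  unfolding lmul_def by (simp_all add: frag_extend_add frag_extend_diff frag_extend_minus)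

lemma lmul_Ker: "t \<in> Ker \<Longrightarrow> lmul p t \<in> Ker"
proof -
  have "Ker \<subseteq> {t. lmul p t \<in> Ker}"
    by (rule Ker_minimal)
      (auto simp: lmul_linear lmul_tens Ker_0 Ker_add Ker_uminus distrib_left mult.assoc[symmetric]
        intro!: Ker_tens simp del: mult.assoc)
  then show "t \<in> Ker \<Longrightarrow> lmul p t \<in> Ker" by blast
qed

lemma FA_induct [consumes 1, case_names zero tens diff]:
  assumes "t \<in> carrier FA" "Q 0" "\<And>p v. v \<in> carrier V \<Longrightarrow> Q (tens p v)"
    and "\<And>s t. s \<in> carrier FA \<Longrightarrow> t \<in> carrier FA \<Longrightarrow> Q s \<Longrightarrow> Q t \<Longrightarrow> Q (s - t)"
  shows "Q t"
proof -
  have "Poly_Mapping.keys t \<subseteq> S"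
    using assms(1) by (simp add: carrier_FA)
  then have "t \<in> carrier FA \<and> Q t"
  proof (induction t rule: frag_induction)
    case zero
    then show ?case using assms(2) FA_0 by blast
  next
    case (one x)
    then obtain p v where "x = (env_class \<gg> p, v)" "v \<in> carrier V"
      by (auto simp: carrier_env_UNIV)
    then show ?case using assms(3)[of v p] tens_mem[of v p] by (simp add: tens_def)
  next
    case (diff a b)
    then show ?case using assms(4) FA_diff by blast
  qed
  then show ?thesis by blast
qed

lemma lmul_FA: "t \<in> carrier FA \<Longrightarrow> lmul p t \<in> carrier FA"
  by (induction t rule: FA_induct) (simp_all only: lmul_0 lmul_tens lmul_diff FA_0 FA_diff tens_mem)

text \<open>The choice merely names the homomorphism; its existence is the universal property of
  free abelian groups, invoked in \<open>ev_hom\<close>.\<close>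

definition ev where
  "ev = (SOME f. f \<in> hom FA (add_monoid P) \<and> (\<forall>p. \<forall>v\<in>carrier V. f (tens p v) = free_act P p v))"

lemma V_P: "v \<in> carrier V \<Longrightarrow> v \<in> carrier P"
  using V_sub by blast

lemma ev_hom: "ev \<in> hom FA (add_monoid P)"
  and ev_tens: "v \<in> carrier V \<Longrightarrow> ev (tens p v) = free_act P p v"
proof -
  let ?f = "\<lambda>(u, v). env_act P u v"
  have "?f ` S \<subseteq> carrier (add_monoid P)"
    using P.env_act_class P.free_act_closed V_P by (auto simp: carrier_env_UNIV)
  then obtain f where f: "f \<in> hom FA (add_monoid P)" "\<And>x. x \<in> S \<Longrightarrow> f (frag_of x) = ?f x"
  proof (rule comm_group.free_Abelian_group_universal[OF P.M.a_comm_group], goal_cases)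
    case (1 f)
    show ?case by (rule 1(1)[OF 1(2)]) (rule 1(3))
  qed
  have "f (tens p v) = free_act P p v" if "v \<in> carrier V" for p v
    using f(2)[of "(env_class \<gg> p, v)"] that P.env_act_class[of p v] V_P by (simp add: tens_def carrier_env_UNIV)
  with f(1) have "f \<in> hom FA (add_monoid P) \<and> (\<forall>p. \<forall>v\<in>carrier V. f (tens p v) = free_act P p v)"
    by blast
  then have "ev \<in> hom FA (add_monoid P) \<and> (\<forall>p. \<forall>v\<in>carrier V. ev (tens p v) = free_act P p v)"
    unfolding ev_def
    by (rule someI[of "\<lambda>f. f \<in> hom FA (add_monoid P) \<and> (\<forall>p. \<forall>v\<in>carrier V. f (tens p v) = free_act P p v)"])
  then show "ev \<in> hom FA (add_monoid P)" "v \<in> carrier V \<Longrightarrow> ev (tens p v) = free_act P p v"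
    by blast+
qed

lemma ev_closed: "t \<in> carrier FA \<Longrightarrow> ev t \<in> carrier P"
  using ev_hom by (auto simp: hom_def)

lemma ev_add: "s \<in> carrier FA \<Longrightarrow> t \<in> carrier FA \<Longrightarrow> ev (s + t) = ev s \<oplus>\<^bsub>P\<^esub> ev t"
  using hom_mult[OF ev_hom, of s t] by simp

lemma ev_0: "ev 0 = \<zero>\<^bsub>P\<^esub>"
  using hom_one[OF ev_hom group_FA P.M.a_group] by simp

lemma ev_diff:
  assumes "s \<in> carrier FA" "t \<in> carrier FA"
  shows "ev (s - t) = ev s \<ominus>\<^bsub>P\<^esub> ev t"
proof -
  have "ev s = ev (s - t) \<oplus>\<^bsub>P\<^esub> ev t"
    using ev_add[OF FA_diff[OF assms] assms(2)] by simp
  then show ?thesis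
    using assms FA_diff[OF assms] ev_closed by (simp add: a_minus_def P.M.a_assoc P.M.r_neg)
qed

lemma ev_Ker: "t \<in> Ker \<Longrightarrow> ev t = \<zero>\<^bsub>P\<^esub>"
proof -
  have eq: "t = \<zero>\<^bsub>P\<^esub> \<oplus>\<^bsub>P\<^esub> x \<Longrightarrow> x \<in> carrier P \<Longrightarrow> t \<ominus>\<^bsub>P\<^esub> x = \<zero>\<^bsub>P\<^esub>" for t x
    by (simp add: a_minus_def P.M.r_neg)
  have sum: "(a \<oplus>\<^bsub>P\<^esub> b) \<ominus>\<^bsub>P\<^esub> a \<ominus>\<^bsub>P\<^esub> b = \<zero>\<^bsub>P\<^esub>" if "a \<in> carrier P" "b \<in> carrier P" for a b
    using that P.M.r_neg[of "a \<oplus>\<^bsub>P\<^esub> b"] by (simp add: a_minus_def P.M.minus_add P.M.a_assoc)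
  have fc: "free_act P p v \<in> carrier P" if "v \<in> carrier V" for p v
    using P.free_act_closed[of v p] V_P[OF that] by simp
  have fV: "free_act V q v = free_act P q v" if q: "q \<in> carrier (free_alg h)" and v: "v \<in> carrier V" for q v
    using q
  proof (induction q rule: free_alg_induct)
    case zero
    then show ?case using V_sub V_P v by (simp add: V.free_act_0 P.free_act_0)
  next
    case (add w c q)
    have fold: "foldr (act V) xs v = foldr (act P) xs v" if "set xs \<subseteq> H" for xs
      using that
    proof (induction xs)
      case (Cons x xs)
      have "foldr (act V) xs v \<in> carrier V"
        using Cons.prems carrier_sub by (intro V.foldr_act_closed v) auto
      then show ?case
        using Cons V_act[of x "foldr (act V) xs v"] by simp
    qed simp
    show ?case
      using add v V_P[OF v] carrier_sub fold[of "letters w"] V_sub(2,4) by (simp add: V.free_act_add V.free_act_single P.free_act_add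
          P.free_act_single free_alg_single univ)
  qed
  have "Ker \<subseteq> {t \<in> carrier FA. ev t = \<zero>\<^bsub>P\<^esub>}"
  proof (rule Ker_minimal)
    show "- t \<in> {t \<in> carrier FA. ev t = \<zero>\<^bsub>P\<^esub>}" if "t \<in> {t \<in> carrier FA. ev t = \<zero>\<^bsub>P\<^esub>}" for t
      using that ev_diff[OF FA_0, of t] FA_uminus by (simp add: ev_0 a_minus_def)
    show "tens (p + q) v - tens p v - tens q v \<in> {t \<in> carrier FA. ev t = \<zero>\<^bsub>P\<^esub>}" if "v \<in> carrier V" for p q v
      using that V_P[OF that] by (simp add: FA_diff tens_mem ev_diff ev_tens P.free_act_add sum fc)
    show "tens p (v \<oplus>\<^bsub>V\<^esub> w) - tens p v - tens p w \<in> {t \<in> carrier FA. ev t = \<zero>\<^bsub>P\<^esub>}"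
      if "v \<in> carrier V" "w \<in> carrier V" for p v w
      using that V_P[OF that(1)] V_P[OF that(2)] V.M.a_closed[OF that] V_sub(2)
      by (simp add: FA_diff tens_mem ev_diff ev_tens P.free_act_add_right sum fc)
    show "tens (p * q) v - tens p (free_act V q v) \<in> {t \<in> carrier FA. ev t = \<zero>\<^bsub>P\<^esub>}"
      if q: "q \<in> carrier (free_alg h)" and v: "v \<in> carrier V" for p q v
      using V.free_act_closed[OF v q] V_P[OF v] v fc[OF v]
      by (simp add: FA_diff tens_mem ev_diff ev_tens P.free_act_mult fV[OF q v] a_minus_def P.M.r_neg P.free_act_closed)
  qed (auto simp: FA_0 ev_0 ev_add FA_add)
  then show "t \<in> Ker \<Longrightarrow> ev t = \<zero>\<^bsub>P\<^esub>" by blast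
qed

lemma ev_lmul: "t \<in> carrier FA \<Longrightarrow> ev (lmul p t) = free_act P p (ev t)"
proof (induction t rule: FA_induct)
  case zero
  then show ?case
    using P.free_act_smult_right[of p "\<zero>\<^bsub>P\<^esub>" 0] P.free_act_closed[of "\<zero>\<^bsub>P\<^esub>" p]
    by (simp add: lmul_0 ev_0 P.M.CC_null)
next
  case (tens q v)
  then show ?case using V_P by (simp add: lmul_tens ev_tens P.free_act_mult)
next
  case (diff s t)
  have "ev s = (ev s \<ominus>\<^bsub>P\<^esub> ev t) \<oplus>\<^bsub>P\<^esub> ev t"
    using diff ev_closed by (simp add: a_minus_def P.M.a_assoc P.M.l_neg)
  then have "free_act P p (ev s) = free_act P p (ev s \<ominus>\<^bsub>P\<^esub> ev t) \<oplus>\<^bsub>P\<^esub> free_act P p (ev t)"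
    using diff ev_closed P.free_act_add_right[of p "ev s \<ominus>\<^bsub>P\<^esub> ev t" "ev t"] by simp
  then have "free_act P p (ev s) \<ominus>\<^bsub>P\<^esub> free_act P p (ev t) = free_act P p (ev s \<ominus>\<^bsub>P\<^esub> ev t)"
    using diff ev_closed by (simp add: a_minus_def P.M.a_assoc P.M.r_neg P.free_act_closed)
  then show ?case
    using diff by (simp add: lmul_diff ev_diff lmul_FA)
qed

end

section \<open>The free module over the free algebra as a model of the induced module\<close>

lemma const_add: "const (a + b) = const a + const b"
  and const_mult: "const a * const b = const (a * b)"
  and const_1: "const 1 = 1"
  by (simp_all add: const_def single_add mult_single)

lemma const_commute: "const c * p = p * const c"
proof (induction p rule: poly_mapping_single_induct)
  case (add p w a)
  then show ?case
    by (simp add: distrib_left distrib_right const_def mult_single mult.commute)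
qed simp

lemma const_mult_single: "const c * Poly_Mapping.single w a = Poly_Mapping.single w (c * a)"
  by (simp add: const_def mult_single)

lemma const_uminus_1: "const (- 1) = - 1"
  by (simp add: const_def single_uminus)

text \<open>Finitely supported functions from vectors to the free algebra are the free left module
  on the vectors, and \<open>lm\<close> is its scalar multiplication. Being a whole type with a
  complex vector space structure, this module can carry the locale \<open>lowering\<close>, which
  the cosets that make up \<open>Ind\<close> cannot.\<close>

definition lm :: "'a::ring_1 \<Rightarrow> ('v \<Rightarrow>\<^sub>0 'a) \<Rightarrow> 'v \<Rightarrow>\<^sub>0 'a" where
  "lm p = Poly_Mapping.map ((*) p)"

lemma lookup_lm [simp]: "Poly_Mapping.lookup (lm p x) v = p * Poly_Mapping.lookup x v"
  by (simp add: lm_def map.rep_eq when_def)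

lemma lm_linear:
  shows lm_add: "lm p (x + y) = lm p x + lm p y" and lm_add_left: "lm (p + q) x = lm p x + lm q x"
    and lm_diff_left: "lm (p - q) x = lm p x - lm q x" and lm_mult: "lm (p * q) x = lm p (lm q x)"
    and lm_1: "lm 1 x = x" and lm_single: "lm p (Poly_Mapping.single v q) = Poly_Mapping.single v (p * q)"
    and lm_0: "lm p 0 = 0"
  by (rule poly_mapping_eqI; simp add: lookup_add lookup_minus lookup_single when_def algebra_simps mult.assoc)+

lemma vector_space_lm: "vector_space (\<lambda>c. lm (const c) :: ('v \<Rightarrow>\<^sub>0 ('g gword \<Rightarrow>\<^sub>0 complex)) \<Rightarrow> _)"
  by unfold_locales (simp_all only: lm_add const_add lm_add_left lm_mult[symmetric] const_mult const_1 lm_1)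

context induced_module
begin

definition trm :: "'v \<Rightarrow> ('g gword \<Rightarrow>\<^sub>0 complex) \<Rightarrow> (('g gword \<Rightarrow>\<^sub>0 complex) set \<times> 'v) \<Rightarrow>\<^sub>0 int" where
  "trm v p = (if v \<in> carrier V then tens p v else 0)"

text \<open>Sends a formal combination to a representative of the corresponding tensor; coefficients
  at vectors outside \<open>V\<close> count as zero. Since \<open>tens\<close> is additive only up
  to the tensor relations, all rules for \<open>tau\<close> assert that a difference lies in
  \<open>Ker\<close>.\<close>

definition tau :: "('v \<Rightarrow>\<^sub>0 ('g gword \<Rightarrow>\<^sub>0 complex)) \<Rightarrow> (('g gword \<Rightarrow>\<^sub>0 complex) set \<times> 'v) \<Rightarrow>\<^sub>0 int" where
  "tau x = (\<Sum>v\<in>Poly_Mapping.keys x. trm v (Poly_Mapping.lookup x v))"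

lemma trm_in: "v \<in> carrier V \<Longrightarrow> trm v p = tens p v" and trm_out: "v \<notin> carrier V \<Longrightarrow> trm v p = 0"
  by (simp_all add: trm_def)

lemma trm_add: "trm v (p + q) - trm v p - trm v q \<in> Ker"
proof (cases "v \<in> carrier V")
  case True
  show ?thesis unfolding trm_in[OF True] by (rule Ker_left[OF True])
qed (simp add: trm_out Ker_0)

lemma trm_0: "trm v 0 \<in> Ker"
  by (cases "v \<in> carrier V") (simp_all add: trm_in trm_out tens_0 Ker_0)

lemma trm_mult: "trm v (p * q) = lmul p (trm v q)"
  by (cases "v \<in> carrier V") (simp_all add: trm_in trm_out lmul_tens lmul_0)

lemma trm_FA: "trm v p \<in> carrier FA"
  by (cases "v \<in> carrier V") (simp_all add: trm_in trm_out tens_mem FA_0)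

lemma Ker_sum: "(\<And>i. i \<in> I \<Longrightarrow> f i \<in> Ker) \<Longrightarrow> sum f I \<in> Ker"
  by (induction I rule: infinite_finite_induct) (simp_all add: Ker_0 Ker_add)

lemma tau_FA: "tau x \<in> carrier FA"
proof -
  have "sum f I \<in> carrier FA" if "\<And>i. f i \<in> carrier FA" for f :: "'v \<Rightarrow> _" and I
    by (induction I rule: infinite_finite_induct) (simp_all add: FA_0 FA_add that)
  from this[OF trm_FA] show ?thesis unfolding tau_def .
qed

lemma tau_superset:
  assumes "finite A" "Poly_Mapping.keys x \<subseteq> A"
  shows "(\<Sum>v\<in>A. trm v (Poly_Mapping.lookup x v)) - tau x \<in> Ker"
proof -
  have "(\<Sum>v\<in>A. trm v (Poly_Mapping.lookup x v)) =
      (\<Sum>v\<in>A - Poly_Mapping.keys x. trm v (Poly_Mapping.lookup x v)) + tau x"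
    unfolding tau_def by (rule sum.subset_diff[OF assms(2,1)])
  moreover have "(\<Sum>v\<in>A - Poly_Mapping.keys x. trm v (Poly_Mapping.lookup x v)) \<in> Ker"
    by (rule Ker_sum) (simp add: in_keys_iff trm_0)
  ultimately show ?thesis by simp
qed

lemma tau_add: "tau (x + y) - (tau x + tau y) \<in> Ker"
proof -
  let ?A = "Poly_Mapping.keys x \<union> Poly_Mapping.keys y"
  let ?s = "\<lambda>x. \<Sum>v\<in>?A. trm v (Poly_Mapping.lookup x v)"
  have sup: "?s x - tau x \<in> Ker" "?s y - tau y \<in> Ker" "?s (x + y) - tau (x + y) \<in> Ker"
    using keys_add[of x y] by (intro tau_superset; auto)+
  have "(\<Sum>v\<in>?A. trm v (Poly_Mapping.lookup x v + Poly_Mapping.lookup y v) -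
      trm v (Poly_Mapping.lookup x v) - trm v (Poly_Mapping.lookup y v)) \<in> Ker"
    by (rule Ker_sum) (rule trm_add)
  then have d: "?s (x + y) - ?s x - ?s y \<in> Ker"
    by (simp only: sum_subtractf lookup_add)
  have "(?s (x + y) - ?s x - ?s y) + (?s x - tau x) + (?s y - tau y) - (?s (x + y) - tau (x + y)) \<in> Ker"
    by (rule Ker_diff[OF Ker_add[OF Ker_add[OF d sup(1)] sup(2)] sup(3)])
  then show ?thesis by (simp add: algebra_simps)
qed

lemma tau_lm: "tau (lm p x) - lmul p (tau x) \<in> Ker"
proof -
  have "lmul p (sum f I) = (\<Sum>i\<in>I. lmul p (f i))" for f :: "'v \<Rightarrow> _" and I
    by (induction I rule: infinite_finite_induct) (simp_all add: lmul_0 lmul_add)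
  then have "lmul p (tau x) = (\<Sum>v\<in>Poly_Mapping.keys x. trm v (Poly_Mapping.lookup (lm p x) v))"
    by (simp add: tau_def trm_mult)
  moreover have "Poly_Mapping.keys (lm p x) \<subseteq> Poly_Mapping.keys x"
    by (auto simp: in_keys_iff)
  ultimately show ?thesis
    using Ker_uminus[OF tau_superset[of "Poly_Mapping.keys x" "lm p x"]] by simp
qed

lemma tau_single: "tau (Poly_Mapping.single v p) - trm v p \<in> Ker"
  using Ker_uminus[OF tau_superset[of "{v}" "Poly_Mapping.single v p"]] by simp

lemma Ker_trans: "s - t \<in> Ker \<Longrightarrow> t \<in> Ker \<Longrightarrow> s \<in> Ker"
  using Ker_add[of "s - t" t] by simp

text \<open>These are the relations of the induced module seen in the free module: the quotient by
  \<open>Z\<close> is the induced module, and \<open>f\<close> below is its canonical map to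
  \<open>P\<close>.\<close>

definition Z where "Z = {x. tau x \<in> Ker}"

definition f where "f x = ev (tau x)"

lemma f_closed: "f x \<in> carrier P"
  by (simp add: f_def ev_closed tau_FA)

lemma ev_cong: "s - t \<in> Ker \<Longrightarrow> t \<in> carrier FA \<Longrightarrow> ev s = ev t"
  using ev_add[of "s - t" t] Ker_FA[of "s - t"] ev_Ker[of "s - t"] ev_closed[of t] by simp

lemma f_add: "f (x + y) = f x \<oplus>\<^bsub>P\<^esub> f y"
  unfolding f_def using ev_cong[OF tau_add] by (simp add: FA_add ev_add tau_FA)

lemma f_lm: "f (lm p x) = free_act P p (f x)"
  unfolding f_def using ev_cong[OF tau_lm] by (simp add: lmul_FA ev_lmul tau_FA)

lemma f_single: "v \<in> carrier V \<Longrightarrow> f (Poly_Mapping.single v p) = free_act P p v"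
  unfolding f_def using ev_cong[OF tau_single trm_FA] by (simp add: trm_def ev_tens)

lemma f_Z: "x \<in> Z \<Longrightarrow> f x = \<zero>\<^bsub>P\<^esub>"
  by (simp add: f_def Z_def ev_Ker)

lemma Z_add: "x \<in> Z \<Longrightarrow> y \<in> Z \<Longrightarrow> x + y \<in> Z"
  unfolding Z_def by (auto intro: Ker_trans[OF tau_add] Ker_add)

lemma Z_0: "0 \<in> Z"
  by (simp add: Z_def tau_def Ker_0)

lemma Z_lm: "x \<in> Z \<Longrightarrow> lm p x \<in> Z"
  unfolding Z_def by (auto intro: Ker_trans[OF tau_lm] lmul_Ker)

lemma lm_uminus_1: "lm (const (- 1)) x = - x"
  unfolding const_uminus_1 by (rule poly_mapping_eqI) simp

lemma Z_uminus: "x \<in> Z \<Longrightarrow> - x \<in> Z"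
  using Z_lm[of x "const (- 1)"] by (simp add: lm_uminus_1)

lemma Z_diff: "x \<in> Z \<Longrightarrow> y \<in> Z \<Longrightarrow> x - y \<in> Z"
  using Z_add[of x "- y"] Z_uminus by simp

text \<open>The ideal is two-sided, so a coefficient multiplied by one of its elements becomes
  trivial in the enveloping algebra. This makes the defining relations of the enveloping algebra
  hold modulo \<open>Z\<close>.\<close>

lemma Z_ideal: "p \<in> env_ideal \<gg> \<Longrightarrow> lm p x \<in> Z"
proof -
  assume p: "p \<in> env_ideal \<gg>"
  have "trm v (p * q) \<in> Ker" for v q
  proof -
    have "env_class \<gg> (p * q) = env_class \<gg> 0"
      using P.env_ideal_right[OF p, of q] by (intro P.env_class_eqI) simp
    then have "trm v (p * q) = trm v 0" by (simp add: trm_def tens_def)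
    then show ?thesis using trm_0 by simp
  qed
  then have "tau (lm p x) \<in> Ker"
    unfolding tau_def by (intro Ker_sum) simp
  then show ?thesis by (simp add: Z_def)
qed

lemma Z_single: "tens p v - tens q w \<in> Ker \<Longrightarrow> v \<in> carrier V \<Longrightarrow> w \<in> carrier V \<Longrightarrow>
    Poly_Mapping.single v p - Poly_Mapping.single w q \<in> Z"
proof -
  assume *: "tens p v - tens q w \<in> Ker" "v \<in> carrier V" "w \<in> carrier V"
  let ?x = "Poly_Mapping.single v p" and ?y = "Poly_Mapping.single w q"
  have "tau ?x - (tau (?x - ?y) + tau ?y) \<in> Ker"
    using tau_add[of "?x - ?y" ?y] by simp
  moreover have "tau ?x - tens p v \<in> Ker" "tau ?y - tens q w \<in> Ker"
    using tau_single[of v p] tau_single[of w q] * by (simp_all add: trm_in)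
  ultimately have "(tau ?x - tens p v) + (tens p v - tens q w) - (tau ?y - tens q w)
      - (tau ?x - (tau (?x - ?y) + tau ?y)) \<in> Ker"
    using *(1) Ker_add Ker_diff by metis
  then show ?thesis by (simp add: Z_def algebra_simps)
qed

lemma Z_outside: "v \<notin> carrier V \<Longrightarrow> Poly_Mapping.single v p \<in> Z"
  using tau_single[of v p] by (simp add: Z_def trm_def)

abbreviation emb :: "'v \<Rightarrow> 'v \<Rightarrow>\<^sub>0 ('g gword \<Rightarrow>\<^sub>0 complex)" where "emb v \<equiv> Poly_Mapping.single v 1"

lemma emb_add:
  assumes v: "v \<in> carrier V" "w \<in> carrier V"
  shows "emb (v \<oplus>\<^bsub>V\<^esub> w) - (emb v + emb w) \<in> Z"
proof -
  let ?x = "emb (v \<oplus>\<^bsub>V\<^esub> w)" and ?y = "emb v" and ?z = "emb w"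
  have c: "v \<oplus>\<^bsub>V\<^esub> w \<in> carrier V" using v by simp
  have s: "tau (emb u) - tens 1 u \<in> Ker" if "u \<in> carrier V" for u
    using tau_single[of u 1] that by (simp add: trm_in)
  have 1: "tau ?x - (tau (?x - (?y + ?z)) + tau (?y + ?z)) \<in> Ker"
    using tau_add[of "?x - (?y + ?z)" "?y + ?z"] by simp
  have "(tau ?x - tens 1 (v \<oplus>\<^bsub>V\<^esub> w)) + (tens 1 (v \<oplus>\<^bsub>V\<^esub> w) - tens 1 v - tens 1 w)
     - (tau ?y - tens 1 v) - (tau ?z - tens 1 w) - (tau (?y + ?z) - (tau ?y + tau ?z))
     - (tau ?x - (tau (?x - (?y + ?z)) + tau (?y + ?z))) \<in> Ker"
    by (rule Ker_diff[OF Ker_diff[OF Ker_diff[OF Ker_diff[OF Ker_add[OF s[OF c] Ker_right[OF v]]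
      s[OF v(1)]] s[OF v(2)]] tau_add] 1])
  then show ?thesis by (simp add: Z_def algebra_simps)
qed

lemma lm_emb:
  assumes "p \<in> carrier (free_alg h)" "v \<in> carrier V"
  shows "lm p (emb v) - emb (free_act V p v) \<in> Z"
  using Z_single[OF _ assms(2) V.free_act_closed[OF assms(2,1)], of p 1] Ker_balanced[OF assms, of 1]
  by (simp add: lm_single)

lemma emb_zero: "emb \<zero>\<^bsub>V\<^esub> \<in> Z"
proof -
  have "emb \<zero>\<^bsub>V\<^esub> - (emb \<zero>\<^bsub>V\<^esub> + emb \<zero>\<^bsub>V\<^esub>) \<in> Z"
    using emb_add[of "\<zero>\<^bsub>V\<^esub>" "\<zero>\<^bsub>V\<^esub>"] by simp
  then show ?thesis using Z_uminus by fastforce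
qed

text \<open>Words applied to vectors of \<open>V\<close> span the free module modulo
  \<open>Z\<close>, because terms at vectors outside \<open>V\<close> already lie in
  \<open>Z\<close>.\<close>

lemma generation:
  assumes Z: "Z \<subseteq> N" and add: "\<And>x y. x \<in> N \<Longrightarrow> y \<in> N \<Longrightarrow> x + y \<in> N"
    and emb: "\<And>v. v \<in> carrier V \<Longrightarrow> emb v \<in> N"
    and scale: "\<And>c x. x \<in> N \<Longrightarrow> lm (const c) x \<in> N" and letter: "\<And>a x. x \<in> N \<Longrightarrow> lm (letter a) x \<in> N"
  shows "x \<in> N"
proof -
  have word: "Poly_Mapping.single v (Poly_Mapping.single (Word as) 1) \<in> N" if v: "v \<in> carrier V" for v as
  proof (induction as)
    case Nil
    then show ?case using emb[OF v] by (simp add: zero_gword_def[symmetric])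
  next
    case (Cons a as)
    have "letter a * Poly_Mapping.single (Word as) 1 = Poly_Mapping.single (Word (a # as)) 1"
      by (simp add: letter_def mult_single plus_gword_def)
    then show ?case
      using letter[OF Cons, of a] by (simp add: lm_single)
  qed
  have single: "Poly_Mapping.single v p \<in> N" for v p
  proof (cases "v \<in> carrier V")
    case True
    show ?thesis
    proof (induction p rule: poly_mapping_single_induct)
      case zero
      then show ?case using Z Z_0 by auto
    next
      case (add p w c)
      obtain as where w: "w = Word as" by (cases w)
      have "lm (const c) (Poly_Mapping.single v (Poly_Mapping.single w 1)) \<in> N"
        using scale word[OF True] w by blast
      then have "Poly_Mapping.single v (Poly_Mapping.single w c) \<in> N"
        by (simp add: lm_single const_mult_single)
      then show ?case
        using add.IH assms(2) by (simp add: single_add)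
    qed
  next
    case False
    then show ?thesis using Z Z_outside by blast
  qed
  show ?thesis
  proof (induction x rule: poly_mapping_single_induct)
    case zero
    then show ?case using Z Z_0 by blast
  next
    case (add x v p)
    then show ?case using assms(2) single by blast
  qed
qed

end

section \<open>Parity of words and of their action\<close>

lemma word_parity_add:
  assumes "word_parity \<gg> u i" "word_parity \<gg> w j"
  shows "word_parity \<gg> (u + w) (i + j)"
proof -
  obtain ks js where "list_all2 (\<lambda>x j. x \<in> hpart \<gg> j) (letters u) ks" "sum_list ks = i"
    "list_all2 (\<lambda>x j. x \<in> hpart \<gg> j) (letters w) js" "sum_list js = j"
    using assms unfolding word_parity_def by blast
  then show ?thesis
    unfolding word_parity_def letters_simps(1)
    by (intro exI[of _ "ks @ js"]) (simp only: list_all2_appendI sum_list_append simp_thms)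
qed

definition parity_alg :: "('g, 'b) lie_superalgebra_scheme \<Rightarrow> bit \<Rightarrow> ('g gword \<Rightarrow>\<^sub>0 complex) set" where
  "parity_alg \<gg> i = {p. \<forall>w\<in>Poly_Mapping.keys p. word_parity \<gg> w i}"

lemma parity_alg_mult:
  assumes "p \<in> parity_alg \<gg> i" "q \<in> parity_alg \<gg> j"
  shows "p * q \<in> parity_alg \<gg> (i + j)"
  unfolding parity_alg_def
proof (intro CollectI ballI)
  fix w assume "w \<in> Poly_Mapping.keys (p * q)"
  then obtain u v where "w = u + v" "u \<in> Poly_Mapping.keys p" "v \<in> Poly_Mapping.keys q"
    using keys_mult[of p q] by blast
  then show "word_parity \<gg> w (i + j)"
    using assms word_parity_add unfolding parity_alg_def by blast
qed

lemma parity_alg_const: "const c \<in> parity_alg \<gg> 0"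
  by (simp add: parity_alg_def const_def word_parity_def)

lemma parity_alg_letter: "x \<in> hpart \<gg> i \<Longrightarrow> letter x \<in> parity_alg \<gg> i"
  unfolding parity_alg_def letter_def word_parity_def by (auto intro!: exI[of _ "[i]"])

lemma parity_alg_1: "1 \<in> parity_alg \<gg> 0"
  using parity_alg_const[of 1] by (simp add: const_1)

lemma (in lie_supermodule) free_act_parity:
  assumes "p \<in> parity_alg \<gg> i" "v \<in> hpart M j"
  shows "free_act M p v \<in> hpart M (i + j)"
proof -
  have v: "v \<in> carrier M" by (rule M.hpart_carrier[OF assms(2)])
  have list: "foldr (act M) xs v \<in> hpart M (sum_list ks + j)" "set xs \<subseteq> carrier \<gg>"
    if "list_all2 (\<lambda>x j. x \<in> hpart \<gg> j) xs ks" for xs ks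
    using that
  proof (induction rule: list_all2_induct)
    case Nil
    { case 1 then show ?case using assms(2) by (simp only: foldr_Nil id_apply sum_list.Nil add_0_left) }
    { case 2 then show ?case by simp }
  next
    case (Cons x xs i ks)
    { case 1 then show ?case using act_hpart[OF Cons(1) Cons(3)]
        by (simp only: foldr_Cons comp_apply sum_list.Cons add.assoc) }
    { case 2 then show ?case using Cons(4) hpart_carrier[OF Cons(1)] by simp }
  qed
  have "p \<in> parity_alg \<gg> i \<longrightarrow> free_act M p v \<in> hpart M (i + j) \<and> p \<in> carrier (free_alg \<gg>)"
  proof (induction p rule: poly_mapping_single_induct)
    case zero
    then show ?case using v by (simp add: free_act_0 M.hpart_zero)
  next
    case (add p w c)
    have keys: "Poly_Mapping.keys (Poly_Mapping.single w c + p) = insert w (Poly_Mapping.keys p)"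
      using add.hyps by (auto simp: in_keys_iff lookup_add lookup_single when_def split: if_splits)
    show ?case
    proof
      assume "Poly_Mapping.single w c + p \<in> parity_alg \<gg> i"
      then have p: "p \<in> parity_alg \<gg> i" and "word_parity \<gg> w i"
        unfolding parity_alg_def mem_Collect_eq keys by blast+
      then obtain ks where ks: "list_all2 (\<lambda>x j. x \<in> hpart \<gg> j) (letters w) ks" "sum_list ks = i"
        unfolding word_parity_def by blast
      have pc: "p \<in> carrier (free_alg \<gg>)" using add.IH p by blast
      have sc: "Poly_Mapping.single w c \<in> carrier (free_alg \<gg>)"
        by (rule free_alg_single[OF list(2)[OF ks(1)]])
      have "free_act M (Poly_Mapping.single w c) v \<in> hpart M (i + j)"
        unfolding free_act_single[OF v list(2)[OF ks(1)]] using list(1)[OF ks(1)] ks(2) by (simp add: M.hpart_smult)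
      then show "free_act M (Poly_Mapping.single w c + p) v \<in> hpart M (i + j) \<and>
          Poly_Mapping.single w c + p \<in> carrier (free_alg \<gg>)"
        unfolding free_act_add[OF v sc pc] using M.hpart_add add.IH p free_alg_add[OF sc pc] by blast
    qed
  qed
  then show ?thesis using assms(1) by blast
qed

section \<open>The induced module as a group of cosets, and its comparison with
  \<open>P\<close>\<close>

context induced_module
begin

abbreviation cls where "cls \<equiv> ind_class \<gg> H V"
abbreviation I where "I \<equiv> Ind \<gg> H V"

lemma cls_mem: "s \<in> cls t \<longleftrightarrow> s - t \<in> Ker"
proof -
  have "s \<in> cls t \<longleftrightarrow> (\<exists>k\<in>Ker. s = k + t)"
    by (simp add: ind_class_def r_coset_def)
  also have "\<dots> \<longleftrightarrow> s - t \<in> Ker"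
    by (metis add_diff_cancel diff_add_cancel)
  finally show ?thesis .
qed

lemma cls_self: "t \<in> cls t"
  by (simp add: cls_mem Ker_0)

lemma cls_eqD: "cls s = cls t \<Longrightarrow> s - t \<in> Ker"
  using cls_self[of s] cls_mem by blast

lemma cls_eqI: "s - t \<in> Ker \<Longrightarrow> cls s = cls t"
proof -
  assume st: "s - t \<in> Ker"
  have "r - s \<in> Ker \<Longrightarrow> r - t \<in> Ker" "r - t \<in> Ker \<Longrightarrow> r - s \<in> Ker" for r
    using Ker_add[OF _ st, of "r - s"] Ker_diff[OF _ st, of "r - t"] by simp_all
  then show ?thesis
    by (intro equalityI subsetI) (simp_all only: cls_mem)
qed

lemma normal_Ker: "Ker \<lhd> FA"
  by (rule comm_group.normal_iff_subgroup[OF comm_group_FA, THEN iffD2, OF subgroup_Ker])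

lemma ind_group_eq: "ind_group \<gg> H V = FA Mod Ker"
  by (simp add: ind_group_def tensor_prod_def ind_ker_def)

lemma group_ind: "group (ind_group \<gg> H V)"
  unfolding ind_group_eq by (rule normal.factorgroup_is_group[OF normal_Ker])

lemma carrier_ind: "carrier (ind_group \<gg> H V) = cls ` carrier FA"
  unfolding ind_group_eq FactGroup_def RCOSETS_def ind_class_def by auto

lemma mult_ind: "s \<in> carrier FA \<Longrightarrow> t \<in> carrier FA \<Longrightarrow> cls s \<otimes>\<^bsub>ind_group \<gg> H V\<^esub> cls t = cls (s + t)"
  unfolding ind_group_eq FactGroup_def ind_class_def
  using normal.rcos_sum[OF normal_Ker, of s t] by simp

lemma one_ind: "\<one>\<^bsub>ind_group \<gg> H V\<^esub> = cls 0"
proof -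
  have "Ker #>\<^bsub>FA\<^esub> 0 = Ker"
    by (auto simp: r_coset_def)
  then show ?thesis
    by (simp add: ind_group_eq ind_class_def)
qed

lemma inv_ind:
  assumes t: "t \<in> carrier FA"
  shows "inv\<^bsub>ind_group \<gg> H V\<^esub> (cls t) = cls (- t)"
  by (rule group.inv_equality[OF group_ind])
    (use t FA_uminus[OF t] mult_ind[OF FA_uminus[OF t] t] in \<open>auto simp: one_ind carrier_ind\<close>)

lemma ind_mult_cls: "ind_mult \<gg> H V (env_class \<gg> p) (cls t) = cls (lmul p t)"
proof -
  have "cls (lmul p s) = cls (lmul p t)" if "s \<in> cls t" for s
    using that lmul_Ker[of "s - t" p] by (intro cls_eqI) (simp add: cls_mem lmul_diff)
  then have "(\<Union>s\<in>cls t. cls (lmul p s)) = cls (lmul p t)"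
    by (intro UN_constant_eq[OF cls_self] ballI)
  then show ?thesis
    by (simp add: ind_mult_def lmul_def)
qed

lemma Ind_ops:
  shows carrier_Ind: "carrier I = cls ` carrier FA"
    and add_Ind: "s \<in> carrier FA \<Longrightarrow> t \<in> carrier FA \<Longrightarrow> cls s \<oplus>\<^bsub>I\<^esub> cls t = cls (s + t)"
    and smult_Ind: "c \<odot>\<^bsub>I\<^esub> cls t = cls (lmul (const c) t)"
    and act_Ind: "act I x (cls t) = cls (lmul (letter x) t)"
  by (simp_all add: Ind_def carrier_ind mult_ind ind_mult_cls)

definition gens where
  "gens i = {tens p v | p v j k. p \<in> parity_alg \<gg> j \<and> v \<in> hpart V k \<and> j + k = i}"

lemma gensI: "p \<in> parity_alg \<gg> j \<Longrightarrow> v \<in> hpart V k \<Longrightarrow> tens p v \<in> gens (j + k)"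
  unfolding gens_def by blast

lemma hpart_Ind: "hpart I i = generate (ind_group \<gg> H V) (cls ` gens i)"
proof -
  have "{cls (frag_of (u, v)) | u v j k. u \<in> env_hpart \<gg> j \<and> v \<in> hpart V k \<and> j + k = i} = cls ` gens i"
    unfolding gens_def env_hpart_def parity_alg_def[symmetric] tens_def by blast
  then show ?thesis by (simp add: Ind_def)
qed

lemma gens_FA: "t \<in> gens i \<Longrightarrow> t \<in> carrier FA"
  unfolding gens_def using tens_mem V.M.hpart_carrier by blast

text \<open>Representatives of the homogeneous classes of the induced module. Reasoning with them
  does not presuppose that its two parts meet trivially or span it.\<close>

definition D where "D i = {t \<in> carrier FA. cls t \<in> hpart I i}"

lemma D_intros:
  shows D_gens: "t \<in> gens i \<Longrightarrow> t \<in> D i" and D_0: "0 \<in> D i"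
    and D_add: "s \<in> D i \<Longrightarrow> t \<in> D i \<Longrightarrow> s + t \<in> D i" and D_uminus: "t \<in> D i \<Longrightarrow> - t \<in> D i"
    and D_cong: "s \<in> D i \<Longrightarrow> s - t \<in> Ker \<Longrightarrow> t \<in> carrier FA \<Longrightarrow> t \<in> D i"
proof -
  have sub: "cls ` gens i \<subseteq> carrier (ind_group \<gg> H V)"
    using gens_FA by (auto simp: carrier_ind)
  show "t \<in> gens i \<Longrightarrow> t \<in> D i"
    using gens_FA generate.incl[of "cls t" "cls ` gens i"] by (simp add: D_def hpart_Ind)
  show "0 \<in> D i"
    using generate.one[of "ind_group \<gg> H V" "cls ` gens i"] by (simp add: D_def hpart_Ind FA_0 one_ind)
  show "s \<in> D i \<Longrightarrow> t \<in> D i \<Longrightarrow> s + t \<in> D i"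
    using generate.eng[of "cls s" "ind_group \<gg> H V" "cls ` gens i" "cls t"] mult_ind[of s t]
    by (simp add: D_def hpart_Ind FA_add)
  show "t \<in> D i \<Longrightarrow> - t \<in> D i"
    using group.generate_m_inv_closed[OF group_ind sub, of "cls t"] inv_ind[of t]
    by (simp add: D_def hpart_Ind FA_uminus)
  show "s \<in> D i \<Longrightarrow> s - t \<in> Ker \<Longrightarrow> t \<in> carrier FA \<Longrightarrow> t \<in> D i"
    using cls_eqI[of s t] by (simp add: D_def)
qed

lemma hpart_Ind_induct:
  assumes "T \<in> hpart I i"
    and "Q 0" "\<And>t. t \<in> gens i \<Longrightarrow> Q t" "\<And>t. t \<in> carrier FA \<Longrightarrow> Q t \<Longrightarrow> Q (- t)"
    and "\<And>s t. s \<in> carrier FA \<Longrightarrow> t \<in> carrier FA \<Longrightarrow> Q s \<Longrightarrow> Q t \<Longrightarrow> Q (s + t)"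
  shows "\<exists>t\<in>carrier FA. T = cls t \<and> Q t"
  using assms(1) unfolding hpart_Ind
proof (induction rule: generate.induct)
  case one
  then show ?case using assms(2) FA_0 one_ind by (intro bexI[of _ 0]) auto
next
  case (incl T)
  then show ?case using assms(3) gens_FA by blast
next
  case (inv T)
  then obtain t where t: "T = cls t" "t \<in> gens i" by blast
  have "cls (- t) = inv\<^bsub>ind_group \<gg> H V\<^esub> T"
    using inv_ind[OF gens_FA[OF t(2)]] t(1) by simp
  then show ?case
    using FA_uminus[OF gens_FA[OF t(2)]] assms(3,4)[of t] gens_FA[OF t(2)] t(2) by metis
next
  case (eng T1 T2)
  then obtain s t where st: "s \<in> carrier FA" "T1 = cls s" "Q s" "t \<in> carrier FA" "T2 = cls t" "Q t"
    by blast
  then show ?case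
    using mult_ind[OF st(1,4)] FA_add[OF st(1,4)] assms(5)[OF st(1,4,3,6)] by metis
qed

lemma ev_D:
  assumes "t \<in> D i"
  shows "ev t \<in> hpart P i"
proof -
  have "\<exists>s\<in>carrier FA. cls t = cls s \<and> ev s \<in> hpart P i"
  proof (rule hpart_Ind_induct)
    show "cls t \<in> hpart I i" using assms by (simp add: D_def)
    show "ev t \<in> hpart P i" if "t \<in> gens i" for t
    proof -
      obtain p v j k where *: "t = tens p v" "p \<in> parity_alg \<gg> j" "v \<in> hpart V k" "j + k = i"
        using \<open>t \<in> gens i\<close> unfolding gens_def by blast
      have "v \<in> hpart P k" "v \<in> carrier V"
        using *(3) V_hpart by auto
      then show ?thesis
        using P.free_act_parity[OF *(2), of v k] *(1,4) by (simp add: ev_tens)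
    qed
    show "ev (- t) \<in> hpart P i" if "t \<in> carrier FA" "ev t \<in> hpart P i" for t
    proof -
      have "ev (- t) = (-1) \<odot>\<^bsub>P\<^esub> ev t"
        using ev_diff[OF FA_0 that(1)] ev_closed[OF that(1)] by (simp add: ev_0 a_minus_def P.M.CC_minus P.M.CC_smult_closed)
      then show ?thesis using P.M.hpart_smult[OF that(2)] by simp
    qed
    show "ev (s + t) \<in> hpart P i" if "s \<in> carrier FA" "t \<in> carrier FA" "ev s \<in> hpart P i" "ev t \<in> hpart P i" for s t
      using that P.M.hpart_add by (simp add: ev_add)
  qed (simp add: ev_0 P.M.hpart_zero)
  then show ?thesis
    using cls_eqD ev_cong by metis
qed

lemma lmul_D:
  assumes "t \<in> D i" "p \<in> parity_alg \<gg> j"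
  shows "lmul p t \<in> D (j + i)"
proof -
  have "\<exists>s\<in>carrier FA. cls t = cls s \<and> lmul p s \<in> D (j + i)"
  proof (rule hpart_Ind_induct)
    show "cls t \<in> hpart I i" using assms by (simp add: D_def)
    show "lmul p t \<in> D (j + i)" if "t \<in> gens i" for t
    proof -
      obtain q v k l where *: "t = tens q v" "q \<in> parity_alg \<gg> k" "v \<in> hpart V l" "k + l = i"
        using \<open>t \<in> gens i\<close> unfolding gens_def by blast
      have "tens (p * q) v \<in> gens ((j + k) + l)"
        by (rule gensI[OF parity_alg_mult[OF assms(2) *(2)] *(3)])
      then show ?thesis
        using D_gens *(1,4) by (simp only: lmul_tens add.assoc)
    qed
  qed (simp_all add: lmul_0 lmul_add lmul_uminus D_0 D_add D_uminus)
  then obtain s where s: "s \<in> carrier FA" "cls t = cls s" "lmul p s \<in> D (j + i)" by blast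
  have "t \<in> carrier FA" using assms(1) by (simp add: D_def)
  moreover have "lmul p s - lmul p t \<in> Ker"
    using lmul_Ker[OF cls_eqD[OF s(2)[symmetric]]] by (simp add: lmul_diff)
  ultimately show ?thesis
    using D_cong[OF s(3)] lmul_FA by blast
qed

text \<open>Makes statements about the free module, such as injectivity of \<open>f\<close> modulo
  \<open>Z\<close>, available for arbitrary cosets.\<close>

lemma tau_surj: "t \<in> carrier FA \<Longrightarrow> \<exists>x. tau x - t \<in> Ker"
proof (induction t rule: FA_induct)
  case zero
  have "tau 0 - 0 \<in> Ker" by (simp add: tau_def Ker_0)
  then show ?case by blast
next
  case (tens p v)
  then show ?case using tau_single[of v p] by (metis trm_in)
next
  case (diff s t)
  then obtain x y where xy: "tau x - s \<in> Ker" "tau y - t \<in> Ker" by blast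
  have "(tau x - s) - (tau y - t) - (tau x - (tau (x - y) + tau y)) \<in> Ker"
    using tau_add[of "x - y" y] by (intro Ker_diff[OF Ker_diff[OF xy]]) simp
  then have "tau (x - y) - (s - t) \<in> Ker" by (simp add: algebra_simps)
  then show ?case by blast
qed

lemma D_FA: "t \<in> D i \<Longrightarrow> t \<in> carrier FA"
  by (simp add: D_def)

text \<open>The sums of evaluated even and odd representatives form a graded submodule that contains
  the nonzero space \<open>V\<close>, so simplicity makes it all of \<open>P\<close>. Keeping the
  two homogeneous representatives in the statement is what later allows the gradings to be
  matched.\<close>

lemma ev_surj:
  assumes simple: "\<And>N. graded_submodule \<gg> P N \<Longrightarrow> N = {\<zero>\<^bsub>P\<^esub>} \<or> N = carrier P"
    and nonzero: "carrier V \<noteq> {\<zero>\<^bsub>P\<^esub>}" and y: "y \<in> carrier P"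
  shows "\<exists>s\<in>D 0. \<exists>t\<in>D 1. y = ev (s + t)"
proof -
  define N where "N = {y. \<exists>s\<in>D 0. \<exists>t\<in>D 1. y = ev (s + t)}"
  have N_I: "ev t \<in> N" if "t \<in> D i" for t i
  proof (cases "i = 0")
    case True
    then show ?thesis using that D_0[of 1] unfolding N_def by force
  next
    case False
    then have "i = 1" by (cases i) auto
    then show ?thesis using that D_0[of 0] unfolding N_def by force
  qed
  have N_add: "x \<oplus>\<^bsub>P\<^esub> y \<in> N" if "x \<in> N" "y \<in> N" for x y
  proof -
    obtain s t s' t' where *: "s \<in> D 0" "t \<in> D 1" "x = ev (s + t)" "s' \<in> D 0" "t' \<in> D 1" "y = ev (s' + t')"
      using \<open>x \<in> N\<close> \<open>y \<in> N\<close> unfolding N_def by blast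
    then have "x \<oplus>\<^bsub>P\<^esub> y = ev ((s + s') + (t + t'))"
      using D_FA by (simp add: ev_add[symmetric] FA_add ac_simps)
    then show ?thesis
      unfolding N_def using D_add *(1,2,4,5) by blast
  qed
  have N_lmul: "free_act P p y \<in> N" if "p \<in> parity_alg \<gg> j" "y \<in> N" for p j y
  proof -
    obtain s t where *: "s \<in> D 0" "t \<in> D 1" "y = ev (s + t)"
      using \<open>y \<in> N\<close> unfolding N_def by blast
    have "free_act P p y = ev (lmul p s) \<oplus>\<^bsub>P\<^esub> ev (lmul p t)"
      unfolding *(3) ev_lmul[OF FA_add[OF D_FA[OF *(1)] D_FA[OF *(2)]], symmetric] lmul_add
      by (rule ev_add[OF lmul_FA[OF D_FA[OF *(1)]] lmul_FA[OF D_FA[OF *(2)]]])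
    then show ?thesis
      using N_add N_I lmul_D that(1) *(1,2) by metis
  qed
  have N_P: "y \<in> carrier P" if "y \<in> N" for y
    using that D_FA ev_closed FA_add unfolding N_def by blast
  have "graded_submodule \<gg> P N"
    unfolding graded_submodule_def
  proof (intro conjI ballI)
    show "submodule N CC P"
    proof (rule CC_submoduleI[OF P.M.module_axioms])
      show "\<zero>\<^bsub>P\<^esub> \<in> N" using N_I[OF D_0] by (simp add: ev_0)
      show "c \<odot>\<^bsub>P\<^esub> x \<in> N" if "x \<in> N" for c x
        using N_lmul[OF parity_alg_const that] N_P[OF that] by (simp add: P.free_act_const)
    qed (use N_P N_add in blast)+
    show "act P x y \<in> N" if x: "x \<in> carrier \<gg>" and y: "y \<in> N" for x y
    proof -
      obtain a b where ab: "a \<in> hpart \<gg> 0" "b \<in> hpart \<gg> 1" "x = a \<oplus>\<^bsub>\<gg>\<^esub> b"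
        using x by (rule P.hpart_decomp)
      have "act P a y \<in> N" "act P b y \<in> N"
        using N_lmul[OF parity_alg_letter[OF ab(1)] y] N_lmul[OF parity_alg_letter[OF ab(2)] y] N_P[OF y]
        by (simp_all add: P.free_act_letter univ)
      then show ?thesis
        using N_add P.act_add_left[of a b y] N_P[OF y] ab(3) univ by simp
    qed
    show "N = (N \<inter> hpart P 0) <+>\<^bsub>P\<^esub> (N \<inter> hpart P 1)"
    proof (intro equalityI subsetI)
      fix y assume "y \<in> N"
      then obtain s t where *: "s \<in> D 0" "t \<in> D 1" "y = ev (s + t)"
        unfolding N_def by blast
      then have "y = ev s \<oplus>\<^bsub>P\<^esub> ev t" using D_FA ev_add by blast
      then show "y \<in> (N \<inter> hpart P 0) <+>\<^bsub>P\<^esub> (N \<inter> hpart P 1)"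
        unfolding set_add_iff using N_I ev_D *(1,2) by blast
    next
      fix y assume "y \<in> (N \<inter> hpart P 0) <+>\<^bsub>P\<^esub> (N \<inter> hpart P 1)"
      then show "y \<in> N" unfolding set_add_iff using N_add by blast
    qed
  qed
  moreover have V_N: "v \<in> N" if v: "v \<in> carrier V" for v
  proof -
    obtain a b where ab: "a \<in> hpart V 0" "b \<in> hpart V 1" "v = a \<oplus>\<^bsub>V\<^esub> b"
      using v by (rule V.M.hpart_decomp)
    have "u \<in> N" if "u \<in> hpart V i" for u i
    proof -
      have u: "u \<in> carrier V" by (rule V.M.hpart_carrier[OF that])
      have "ev (tens 1 u) \<in> N"
        using N_I[OF D_gens[OF gensI[OF parity_alg_1 that]]] .
      then show ?thesis
        using u V_P[OF u] P.free_act_const[of u 1] by (simp add: ev_tens const_1 P.M.CC_one)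
    qed
    then show ?thesis
      using ab N_add V_sub(2) by metis
  qed
  ultimately have "N = carrier P"
    using simple[of N] nonzero V.M.zero_closed V_sub(3) by fastforce
  then show ?thesis using y unfolding N_def by blast
qed

lemma f_surj:
  assumes "\<And>N. graded_submodule \<gg> P N \<Longrightarrow> N = {\<zero>\<^bsub>P\<^esub>} \<or> N = carrier P"
    and "carrier V \<noteq> {\<zero>\<^bsub>P\<^esub>}" and "y \<in> carrier P"
  shows "\<exists>x. y = f x"
proof -
  obtain s t where st: "s \<in> D 0" "t \<in> D 1" "y = ev (s + t)"
    using ev_surj[OF _ assms(2,3)] assms(1) by blast
  have c: "s + t \<in> carrier FA"
    using D_FA st by (intro FA_add)
  obtain x where "tau x - (s + t) \<in> Ker"
    using tau_surj[OF c] by blast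
  then show ?thesis
    using ev_cong[OF _ c] st(3) by (metis f_def)
qed

text \<open>The isomorphism is the inverse of evaluation: \<open>ev t\<close> goes to the class of
  \<open>t\<close>, well defined by \<open>inj\<close> and total by \<open>ev_surj\<close>. For the
  gradings, a homogeneous \<open>y = ev s + ev t\<close> with \<open>s\<close> even and
  \<open>t\<close> odd has a vanishing component in the other parity, so a single homogeneous
  representative is enough.\<close>

theorem supermodule_iso_Ind:
  assumes simple: "\<And>N. graded_submodule \<gg> P N \<Longrightarrow> N = {\<zero>\<^bsub>P\<^esub>} \<or> N = carrier P"
    and nonzero: "carrier V \<noteq> {\<zero>\<^bsub>P\<^esub>}" and inj: "\<And>x. f x = \<zero>\<^bsub>P\<^esub> \<Longrightarrow> x \<in> Z"
  shows "supermodule_iso \<gg> P I"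
proof -
  have inj_cls: "cls s = cls t" if st: "s \<in> carrier FA" "t \<in> carrier FA" "ev s = ev t" for s t
  proof -
    have "ev (s - t) = \<zero>\<^bsub>P\<^esub>"
      using st ev_diff ev_closed by (simp add: a_minus_def P.M.r_neg)
    moreover obtain x where x: "tau x - (s - t) \<in> Ker"
      using tau_surj[OF FA_diff[OF st(1,2)]] by blast
    ultimately have "f x = \<zero>\<^bsub>P\<^esub>"
      using ev_cong[OF x FA_diff[OF st(1,2)]] by (simp add: f_def)
    then have "tau x \<in> Ker" using inj by (simp add: Z_def)
    then have "tau x - (tau x - (s - t)) \<in> Ker" by (rule Ker_diff[OF _ x])
    moreover have "tau x - (tau x - (s - t)) = s - t" by (simp add: algebra_simps)
    ultimately show ?thesis by (intro cls_eqI) simp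
  qed
  have ex: "\<exists>s\<in>D 0. \<exists>t\<in>D 1. y = ev (s + t)" if "y \<in> carrier P" for y
    by (rule ev_surj[OF _ nonzero that]) (rule simple)
  have surj: "\<exists>t\<in>carrier FA. y = ev t" if "y \<in> carrier P" for y
    using ex[OF that] D_FA FA_add by blast
  have hpart: "\<exists>t\<in>D i. y = ev t" if y: "y \<in> hpart P i" for y i
  proof -
    obtain s t where *: "s \<in> D 0" "t \<in> D 1" "y = ev (s + t)"
      using ex[OF P.M.hpart_carrier[OF y]] by blast
    have c: "ev s \<in> carrier P" "ev t \<in> carrier P" using ev_closed D_FA * by blast+
    have p: "ev s \<in> hpart P 0" "ev t \<in> hpart P 1" using ev_D * by blast+
    have eq: "y = ev s \<oplus>\<^bsub>P\<^esub> ev t" using * D_FA ev_add by blast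
    show ?thesis
    proof (cases "i = 0")
      case True
      have "ev t = (-1) \<odot>\<^bsub>P\<^esub> ev s \<oplus>\<^bsub>P\<^esub> y"
        unfolding eq using c
        by (simp add: P.M.CC_minus[OF c(1), symmetric] P.M.a_assoc[symmetric] P.M.l_neg)
      then have "ev t \<in> hpart P 0"
        using P.M.hpart_add[OF P.M.hpart_smult[OF p(1)]] y True by simp
      then have "ev t = \<zero>\<^bsub>P\<^esub>" using p(2) P.M.hpart_disjoint by blast
      then have "y = ev s" using eq c by simp
      then show ?thesis using *(1) True by blast
    next
      case False
      then have i: "i = 1" by (cases i) auto
      have "ev s = (-1) \<odot>\<^bsub>P\<^esub> ev t \<oplus>\<^bsub>P\<^esub> y"
        unfolding eq P.M.a_comm[OF c] using c
        by (simp add: P.M.CC_minus[OF c(2), symmetric] P.M.a_assoc[symmetric] P.M.l_neg)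
      then have "ev s \<in> hpart P 1"
        using P.M.hpart_add[OF P.M.hpart_smult[OF p(2)]] y i by simp
      then have "ev s = \<zero>\<^bsub>P\<^esub>" using p(1) P.M.hpart_disjoint by blast
      then have "y = ev t" using eq c by simp
      then show ?thesis using *(2) i by blast
    qed
  qed
  define F where "F y = cls (SOME t. t \<in> carrier FA \<and> ev t = y)" for y
  have F: "F (ev t) = cls t" if t: "t \<in> carrier FA" for t
  proof -
    have "(SOME s. s \<in> carrier FA \<and> ev s = ev t) \<in> carrier FA \<and> ev (SOME s. s \<in> carrier FA \<and> ev s = ev t) = ev t"
      by (rule someI[of "\<lambda>s. s \<in> carrier FA \<and> ev s = ev t" t]) (simp add: t)
    then show ?thesis unfolding F_def using inj_cls t by blast
  qed
  show ?thesis
    unfolding supermodule_iso_def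
  proof (intro exI[of _ F] conjI ballI allI)
    show "bij_betw F (carrier P) (carrier I)"
      unfolding bij_betw_def
    proof
      show "inj_on F (carrier P)"
      proof (rule inj_onI)
        fix x y assume "x \<in> carrier P" "y \<in> carrier P" and eq: "F x = F y"
        then obtain s t where st: "s \<in> carrier FA" "x = ev s" "t \<in> carrier FA" "y = ev t"
          using surj by meson
        then have "s - t \<in> Ker" using eq F by (simp add: cls_eqD)
        then show "x = y" using ev_cong st by simp
      qed
      show "F ` carrier P = carrier I"
      proof (intro equalityI subsetI)
        fix T assume "T \<in> F ` carrier P"
        then obtain t where "t \<in> carrier FA" "T = F (ev t)" using surj by blast
        then show "T \<in> carrier I" using F carrier_Ind by blast
      next
        fix T assume "T \<in> carrier I"
        then obtain t where "t \<in> carrier FA" "T = cls t" using carrier_Ind by blast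
        then show "T \<in> F ` carrier P" using F ev_closed by (metis imageI)
      qed
    qed
    show "F (x \<oplus>\<^bsub>P\<^esub> y) = F x \<oplus>\<^bsub>I\<^esub> F y" if xy: "x \<in> carrier P" "y \<in> carrier P" for x y
    proof -
      obtain s t where st: "s \<in> carrier FA" "x = ev s" "t \<in> carrier FA" "y = ev t"
        using xy surj by meson
      then show ?thesis by (simp add: ev_add[symmetric] F FA_add add_Ind)
    qed
    show "F (c \<odot>\<^bsub>P\<^esub> x) = c \<odot>\<^bsub>I\<^esub> F x" if x: "x \<in> carrier P" for c x
    proof -
      obtain t where t: "t \<in> carrier FA" "x = ev t" using x surj by blast
      have "c \<odot>\<^bsub>P\<^esub> x = ev (lmul (const c) t)"
        using t ev_lmul[OF t(1), of "const c"] P.free_act_const ev_closed by simp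
      then show ?thesis using t F lmul_FA by (simp add: smult_Ind)
    qed
    show "F (act P x y) = act I x (F y)" if y: "x \<in> carrier \<gg>" "y \<in> carrier P" for x y
    proof -
      obtain t where t: "t \<in> carrier FA" "y = ev t" using y surj by blast
      have "act P x y = ev (lmul (letter x) t)"
        using t ev_lmul[OF t(1), of "letter x"] P.free_act_letter y by simp
      then show ?thesis using t F lmul_FA by (simp add: act_Ind)
    qed
    show "F ` hpart P i = hpart I i" for i
    proof (intro equalityI subsetI)
      fix T assume "T \<in> F ` hpart P i"
      then obtain t where "t \<in> D i" "T = F (ev t)" using hpart by blast
      then show "T \<in> hpart I i" using F by (simp add: D_def)
    next
      fix T assume T: "T \<in> hpart I i"
      have "\<exists>t\<in>carrier FA. T = cls t \<and> True"
        by (rule hpart_Ind_induct[OF T]) simp_all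
      then obtain t where t: "t \<in> carrier FA" "T = cls t" by blast
      then have "t \<in> D i" using T by (simp add: D_def)
      then show "T \<in> F ` hpart P i" using ev_D F[OF t(1)] t(2) by (metis imageI)
    qed
  qed
qed

end

section \<open>The super extended Ovsienko--Roger algebra\<close>

lemma SOR_simps [simp]:
  "carrier SOR = UNIV" "add SOR = (+)" "\<zero>\<^bsub>SOR\<^esub> = 0" "module.smult SOR = sor_smult"
  "hpart SOR i = sor_span {a. index_parity a = i}" "bracket SOR = sor_bracket"
  by (simp_all add: SOR_def)

lemma sor_smult_eq: "sor_smult = pm_scale"
  by (rule ext) (simp add: sor_smult_def pm_scale_def)

lemma sor_span_closed:
  shows sor_span_0: "0 \<in> sor_span B"
    and sor_span_add: "x \<in> sor_span B \<Longrightarrow> y \<in> sor_span B \<Longrightarrow> x + y \<in> sor_span B"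
    and sor_span_uminus: "x \<in> sor_span B \<Longrightarrow> - x \<in> sor_span B"
    and sor_span_smult: "x \<in> sor_span B \<Longrightarrow> sor_smult c x \<in> sor_span B"
    and sor_span_gen: "a \<in> B \<Longrightarrow> gen a \<in> sor_span B"
  using keys_add[of x y] by (auto simp: sor_span_def sor_smult_eq gen_def in_keys_iff)

lemma sor_span_mono: "B \<subseteq> C \<Longrightarrow> sor_span B \<subseteq> sor_span C"
  by (auto simp: sor_span_def)

lemma sor_span_sum: "(\<And>i. i \<in> I \<Longrightarrow> f i \<in> sor_span B) \<Longrightarrow> sum f I \<in> sor_span B"
  by (induction I rule: infinite_finite_induct) (simp_all add: sor_span_0 sor_span_add)

lemma sor_span_induct [consumes 1, case_names zero add]:
  assumes "x \<in> sor_span B" "Q 0"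
    and "\<And>a c y. a \<in> B \<Longrightarrow> y \<in> sor_span B \<Longrightarrow> Q y \<Longrightarrow> Q (sor_smult c (gen a) + y)"
  shows "Q x"
proof -
  have "x \<in> sor_span B \<longrightarrow> Q x"
  proof (induction x rule: poly_mapping_single_induct)
    case zero
    then show ?case using assms(2) by blast
  next
    case (add y a c)
    have "Poly_Mapping.keys (Poly_Mapping.single a c + y) = insert a (Poly_Mapping.keys y)"
      using add.hyps by (auto simp: in_keys_iff lookup_add lookup_single when_def split: if_splits)
    moreover have "Poly_Mapping.single a c = sor_smult c (gen a)"
      by (simp add: sor_smult_eq gen_def)
    ultimately show ?case
      using add.IH assms(3)[of a y c] by (auto simp: sor_span_def)
  qed
  then show ?thesis using assms(1) by blast
qed

lemma sor_span_diff: "x \<in> sor_span B \<Longrightarrow> y \<in> sor_span B \<Longrightarrow> x - y \<in> sor_span B"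
  using sor_span_add[of x B "- y"] sor_span_uminus by simp

lemma sor_span_UNIV: "sor_span UNIV = UNIV"
  by (simp add: sor_span_def)

lemma sor_bracket_span:
  assumes "\<And>a b. a \<in> A \<Longrightarrow> b \<in> B \<Longrightarrow> basis_bracket a b \<in> sor_span C" "x \<in> sor_span A" "y \<in> sor_span B"
  shows "sor_bracket x y \<in> sor_span C"
  unfolding sor_bracket_def
  by (intro sor_span_sum sor_span_smult assms(1)) (use assms(2,3) in \<open>auto simp: sor_span_def\<close>)

lemma sor_bracket_gen: "sor_bracket (gen a) (gen b) = basis_bracket a b"
proof -
  have "pm_scale 1 x = x" for x :: sor
    by (rule poly_mapping_eqI) simp
  then show ?thesis
    by (simp add: sor_bracket_def gen_def sor_smult_eq)
qed

lemma gen_hpart: "gen a \<in> hpart SOR (index_parity a)"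
  by (simp add: sor_span_gen)

fun T_index :: "nat \<Rightarrow> sor_index \<Rightarrow> bool" where
  "T_index d (iL i) \<longleftrightarrow> 0 \<le> i"
| "T_index d (iW i) \<longleftrightarrow> - int d \<le> i"
| "T_index d (iG i) \<longleftrightarrow> 0 \<le> i"
| "T_index d _ \<longleftrightarrow> True"

text \<open>Because \<open>iG i\<close> stands for the index \<open>i + 1/2\<close>, the condition
  \<open>int t \<le> i\<close> describes the elements from \<open>t + 1/2\<close> upwards, in line
  with the strict bounds for the two even families.\<close>

fun S_index :: "nat \<Rightarrow> nat \<Rightarrow> sor_index \<Rightarrow> bool" where
  "S_index d t (iL i) \<longleftrightarrow> int (t + d) < i"
| "S_index d t (iW i) \<longleftrightarrow> int t < i"
| "S_index d t (iG i) \<longleftrightarrow> int t \<le> i"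
| "S_index d t _ \<longleftrightarrow> False"

abbreviation "TS d \<equiv> Collect (T_index d)"
abbreviation "SS d t \<equiv> Collect (S_index d t)"

lemma Td_span: "Td d = sor_span (TS d)"
proof -
  have "{iL i | i. 0 \<le> i} \<union> {iW (i - int d) | i. 0 \<le> i} \<union> {iG (i - 1) | i. 1 \<le> i} \<union> {iC1, iC2} = TS d"
    (is "?A = _")
  proof (intro equalityI subsetI)
    fix a assume "a \<in> TS d"
    then show "a \<in> ?A"
    proof (cases a)
      case (iW i)
      then have "a = iW ((i + int d) - int d) \<and> 0 \<le> i + int d" using \<open>a \<in> TS d\<close> by simp
      then show ?thesis by blast
    next
      case (iG i)
      then have "a = iG ((i + 1) - 1) \<and> 1 \<le> i + 1" using \<open>a \<in> TS d\<close> by simp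
      then show ?thesis by blast
    qed auto
  qed auto
  then show ?thesis by (simp add: Td_def)
qed

lemma Sr_span: "Sr (t + d + 1) (t + 1) (t + 1) = sor_span (SS d t)"
proof -
  have "{iL i | i. int (t + d + 1) \<le> i} \<union> {iW i | i. int (t + 1) \<le> i} \<union>
      {iG (i - 1) | i. int (t + 1) \<le> i \<and> i \<noteq> 0} = SS d t" (is "?A = _")
  proof (intro equalityI subsetI)
    fix a assume "a \<in> SS d t"
    then show "a \<in> ?A"
    proof (cases a)
      case (iG i)
      then have "a = iG ((i + 1) - 1) \<and> int (t + 1) \<le> i + 1 \<and> i + 1 \<noteq> 0" using \<open>a \<in> SS d t\<close> by simp
      then show ?thesis by blast
    qed auto
  qed auto
  then show ?thesis by (simp add: Sr_def)
qed

lemma S_subset_T: "SS d t \<subseteq> TS d"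
proof
  fix a assume "a \<in> SS d t"
  then show "a \<in> TS d" by (cases a) auto
qed

lemmas br_defs = br_LL_def br_LW_def br_LG_def br_GG_def

lemma basis_bracket_T:
  assumes "a \<in> TS d" "b \<in> TS d"
  shows "basis_bracket a b \<in> sor_span (TS d)"
  using assms
  by (cases a; cases b) (auto simp: br_defs intro!: sor_span_add sor_span_diff sor_span_smult sor_span_uminus sor_span_gen sor_span_0)

lemma basis_bracket_S:
  assumes "a \<in> SS d t" "b \<in> TS d"
  shows "basis_bracket a b \<in> sor_span (SS d t)" "basis_bracket b a \<in> sor_span (SS d t)"
  using assms
  by (cases a; cases b; auto simp: br_defs intro!: sor_span_add sor_span_diff sor_span_smult sor_span_uminus sor_span_gen sor_span_0)+

lemma sor_span_graded: "sor_span B \<subseteq> (sor_span B \<inter> hpart SOR 0) <+>\<^bsub>SOR\<^esub> (sor_span B \<inter> hpart SOR 1)"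
proof
  fix x assume "x \<in> sor_span B"
  then have "\<exists>a\<in>sor_span B \<inter> hpart SOR 0. \<exists>b\<in>sor_span B \<inter> hpart SOR 1. x = a + b"
  proof (induction x rule: sor_span_induct)
    case zero
    show ?case
      by (rule bexI[of _ 0], rule bexI[of _ 0]) (simp_all add: sor_span_0)
  next
    case (add a c y)
    then obtain u v where uv: "u \<in> sor_span B" "u \<in> hpart SOR 0" "v \<in> sor_span B" "v \<in> hpart SOR 1" "y = u + v"
      by blast
    have g: "sor_smult c (gen a) \<in> sor_span B" "sor_smult c (gen a) \<in> hpart SOR (index_parity a)"
      using add.hyps(1) by (simp_all add: sor_span_smult sor_span_gen)
    show ?case
    proof (cases "index_parity a = 0")
      case True
      then have "sor_smult c (gen a) + u \<in> sor_span B \<inter> hpart SOR 0"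
        using uv(1,2) g by (simp add: sor_span_add)
      moreover have "sor_smult c (gen a) + y = (sor_smult c (gen a) + u) + v"
        using uv(5) by (simp add: add.assoc)
      ultimately show ?thesis using uv(3,4) by blast
    next
      case False
      then have p: "index_parity a = 1" by (cases a) auto
      then have "sor_smult c (gen a) + v \<in> sor_span B \<inter> hpart SOR 1"
        using uv(3,4) g by (simp add: sor_span_add)
      moreover have "sor_smult c (gen a) + y = u + (sor_smult c (gen a) + v)"
        using uv(5) by (simp add: add.left_commute)
      ultimately show ?thesis using uv(1,2) by blast
    qed
  qed
  then show "x \<in> (sor_span B \<inter> hpart SOR 0) <+>\<^bsub>SOR\<^esub> (sor_span B \<inter> hpart SOR 1)"
    by (simp add: set_add_iff)
qed

text \<open>The Lie superalgebra axioms for \<open>SOR\<close> are part of what it means to have a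
  module over it, so they enter as an assumption here and are supplied by the module
  \<open>P\<close> through \<open>lie_SOR\<close>.\<close>

context
  assumes SOR: "lie_superalgebra SOR"
begin

lemma submodule_sor_span: "submodule (sor_span B) CC SOR"
proof -
  interpret lie_superalgebra SOR by (rule SOR)
  show ?thesis
    by (rule CC_submoduleI[OF module_axioms]) (simp_all add: sor_span_0 sor_span_add sor_span_smult)
qed

lemma lie_superalgebra_Td: "lie_superalgebra (sub_lsa SOR (Td d))"
  unfolding Td_span
  by (rule lie_superalgebra_sub[OF SOR submodule_sor_span sor_span_graded])
    (unfold SOR_simps, rule sor_bracket_span[OF basis_bracket_T])

lemma Td_quot:
  fixes d t :: nat
  defines "\<gg> \<equiv> sub_lsa SOR (Td d)" and "J \<equiv> Sr (t + d + 1) (t + 1) (t + 1)"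
  shows submodule_Sr: "submodule J CC \<gg>"
    and Sr_graded: "J \<subseteq> (J \<inter> hpart \<gg> 0) <+>\<^bsub>\<gg>\<^esub> (J \<inter> hpart \<gg> 1)"
    and Sr_left: "\<And>x y. x \<in> J \<Longrightarrow> y \<in> carrier \<gg> \<Longrightarrow> bracket \<gg> x y \<in> J"
    and Sr_right: "\<And>x y. x \<in> carrier \<gg> \<Longrightarrow> y \<in> J \<Longrightarrow> bracket \<gg> x y \<in> J"
proof -
  interpret lie_superalgebra \<gg> unfolding \<gg>_def by (rule lie_superalgebra_Td)
  have simps: "carrier \<gg> = sor_span (TS d)" "add \<gg> = (+)" "\<zero>\<^bsub>\<gg>\<^esub> = 0" "module.smult \<gg> = sor_smult"
    "\<And>i. hpart \<gg> i = hpart SOR i \<inter> sor_span (TS d)" "bracket \<gg> = sor_bracket" "J = sor_span (SS d t)"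
    by (simp_all only: \<gg>_def J_def Sr_span Td_span) (simp_all add: sub_lsa_def)
  have ST: "x \<in> sor_span (TS d)" if "x \<in> sor_span (SS d t)" for x
    using that sor_span_mono[OF S_subset_T] by blast
  show "submodule J CC \<gg>"
    by (rule CC_submoduleI[OF module_axioms])
      (simp_all add: simps ST subsetI sor_span_0 sor_span_add sor_span_smult)
  show "bracket \<gg> x y \<in> J" if "x \<in> J" "y \<in> carrier \<gg>" for x y
    using that sor_bracket_span[where A = "SS d t" and B = "TS d", OF basis_bracket_S(1)[of _ d t]]
    by (simp add: simps)
  show "bracket \<gg> x y \<in> J" if "x \<in> carrier \<gg>" "y \<in> J" for x y
    using that sor_bracket_span[where A = "TS d" and B = "SS d t", OF basis_bracket_S(2)[of _ d t]]
    by (simp add: simps)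
  have "J \<inter> hpart \<gg> i = sor_span (SS d t) \<inter> hpart SOR i" for i
    unfolding simps using ST by blast
  then show "J \<subseteq> (J \<inter> hpart \<gg> 0) <+>\<^bsub>\<gg>\<^esub> (J \<inter> hpart \<gg> 1)"
    using sor_span_graded[of "SS d t"] by (simp only: simps(2,7) set_add_def set_mult_def SOR_simps monoid.simps)
qed

lemma lie_superalgebra_qdt: "lie_superalgebra (qdt d t)"
  unfolding qdt_def
  by (rule lie_superalgebra.lie_superalgebra_quot[OF lie_superalgebra_Td submodule_Sr Sr_graded Sr_left Sr_right])

lemma quot_map_props:
  shows carrier_qdt: "carrier (qdt d t) = quot_map d t ` Td d"
    and quot_map_add: "x \<in> Td d \<Longrightarrow> y \<in> Td d \<Longrightarrow> quot_map d t x \<oplus>\<^bsub>qdt d t\<^esub> quot_map d t y = quot_map d t (x + y)"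
    and quot_map_smult: "x \<in> Td d \<Longrightarrow> c \<odot>\<^bsub>qdt d t\<^esub> quot_map d t x = quot_map d t (sor_smult c x)"
    and quot_map_bracket: "x \<in> Td d \<Longrightarrow> y \<in> Td d \<Longrightarrow>
      bracket (qdt d t) (quot_map d t x) (quot_map d t y) = quot_map d t (sor_bracket x y)"
    and quot_map_hpart: "hpart (qdt d t) i = quot_map d t ` (hpart SOR i \<inter> Td d)"
  using lie_superalgebra.quot_lsa_ops[OF lie_superalgebra_Td submodule_Sr Sr_left Sr_right, of t d]
  unfolding qdt_def[symmetric] quot_map_def[symmetric] by (simp_all add: sub_lsa_def)

lemma quot_map_mem: "y \<in> quot_map d t x \<longleftrightarrow> y - x \<in> Sr (t + d + 1) (t + 1) (t + 1)"
proof -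
  have "y \<in> quot_map d t x \<longleftrightarrow> (\<exists>s\<in>Sr (t + d + 1) (t + 1) (t + 1). y = s + x)"
    by (simp add: quot_map_def a_r_coset_def' sub_lsa_def)
  also have "\<dots> \<longleftrightarrow> y - x \<in> Sr (t + d + 1) (t + 1) (t + 1)"
    by (metis add_diff_cancel diff_add_cancel)
  finally show ?thesis .
qed

end

text \<open>\<open>V\<close> may be any \<open>Td d\<close>-submodule of vectors killed by the
  ideal, not just the space of all of them: simplicity of that space is obtained by taking a nonzero
  submodule of it for \<open>V\<close>.\<close>

locale sor_induced = induced_module SOR "Td d" P V
  for d :: nat and P :: "(sor, 'v, 'c) lie_supermodule_scheme" and V :: "(sor, 'v, 'd) lie_supermodule_scheme" +
  fixes t :: nat and c1 c2 :: complex
  assumes C1: "acts_as_scalar P (gen iC1) c1" and C2: "acts_as_scalar P (gen iC2) c2"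
    and sing: "v \<in> carrier V \<Longrightarrow> a \<in> SS d t \<Longrightarrow> act P (gen a) v = \<zero>\<^bsub>P\<^esub>"
    and W_inj: "t > 0 \<Longrightarrow> v \<in> carrier P \<Longrightarrow> act P (gen (iW (int t))) v = \<zero>\<^bsub>P\<^esub> \<Longrightarrow> v = \<zero>\<^bsub>P\<^esub>"
    and c2: "t = 0 \<Longrightarrow> c2 \<noteq> 0"
begin

abbreviation l where "l a \<equiv> lm (letter (gen a))"

definition eqz (infix \<open>\<sim>\<close> 50) where "x \<sim> y \<longleftrightarrow> x - y \<in> Z"

lemma eqz_refl: "x \<sim> x"
  by (simp add: eqz_def Z_0)

lemma eqz_sym: "x \<sim> y \<Longrightarrow> y \<sim> x"
  unfolding eqz_def using Z_uminus[of "x - y"] by simp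

lemma eqz_trans [trans]: "x \<sim> y \<Longrightarrow> y \<sim> z \<Longrightarrow> x \<sim> z"
  unfolding eqz_def using Z_add[of "x - y" "y - z"] by simp

lemma eqz_add: "x \<sim> y \<Longrightarrow> x' \<sim> y' \<Longrightarrow> x + x' \<sim> y + y'"
  unfolding eqz_def using Z_add[of "x - y" "x' - y'"] by (simp add: algebra_simps)

lemma lm_diff: "lm p (x - y) = lm p x - lm p y"
  by (rule poly_mapping_eqI) (simp add: lookup_minus algebra_simps)

lemma eqz_lm: "x \<sim> y \<Longrightarrow> lm p x \<sim> lm p y"
  unfolding eqz_def using Z_lm[of "x - y" p] by (simp add: lm_diff)

lemma eqz_Z: "x \<sim> y \<Longrightarrow> y \<in> Z \<Longrightarrow> x \<in> Z"
  unfolding eqz_def using Z_add[of "x - y" y] by simp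

lemma f_eqz: "x \<sim> y \<Longrightarrow> f x = f y"
proof -
  assume "x \<sim> y"
  then have "f (x - y) = \<zero>\<^bsub>P\<^esub>" by (simp add: eqz_def f_Z)
  then show ?thesis using f_add[of "x - y" y] f_closed[of y] by simp
qed

lemma letter_add: "lm (letter (x + y)) u \<sim> lm (letter x) u + lm (letter y) u"
proof -
  have "letter (x + y) - letter x - letter y \<in> env_rel SOR"
    unfolding env_rel_def by (intro UnI1 CollectI exI[of _ x] exI[of _ y]) simp
  then have "lm (letter (x + y) - letter x - letter y) u \<in> Z"
    by (intro Z_ideal subsetD[OF P.env_rel_ideal])
  then show ?thesis by (simp add: eqz_def lm_diff_left lm_add_left diff_diff_eq)
qed

lemma letter_smult: "lm (letter (sor_smult c x)) u \<sim> lm (const c) (lm (letter x) u)"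
proof -
  have "letter (sor_smult c x) - const c * letter x \<in> env_rel SOR"
    unfolding env_rel_def by (intro UnI1[OF UnI2] CollectI exI[of _ c] exI[of _ x]) simp
  then have "lm (letter (sor_smult c x) - const c * letter x) u \<in> Z"
    by (intro Z_ideal subsetD[OF P.env_rel_ideal])
  then show ?thesis by (simp add: eqz_def lm_diff_left lm_mult)
qed

lemma letter_zero: "lm (letter 0) u \<in> Z"
proof -
  have "lm (const 0) (lm (letter 0) u) = 0"
    by (rule poly_mapping_eqI) (simp add: const_def)
  moreover have "sor_smult 0 0 = 0" by (simp add: sor_smult_eq)
  ultimately show ?thesis
    using letter_smult[of 0 0 u] by (simp add: eqz_def)
qed

lemma letter_bracket:
  "l a (l b u) \<sim> lm (const (koszul (index_parity a) (index_parity b))) (l b (l a u)) + lm (letter (basis_bracket a b)) u"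
proof -
  let ?k = "const (koszul (index_parity a) (index_parity b))"
  have "letter (gen a) * letter (gen b) - ?k * letter (gen b) * letter (gen a) -
      letter (bracket SOR (gen a) (gen b)) \<in> env_rel SOR"
    unfolding env_rel_def
    by (intro UnI2 CollectI exI[of _ "gen a"] exI[of _ "gen b"] exI[of _ "index_parity a"]
        exI[of _ "index_parity b"] conjI refl gen_hpart)
  then have "lm (letter (gen a) * letter (gen b) - ?k * letter (gen b) * letter (gen a) -
      letter (basis_bracket a b)) u \<in> Z"
    unfolding SOR_simps(6) sor_bracket_gen by (intro Z_ideal subsetD[OF P.env_rel_ideal])
  then show ?thesis by (simp add: eqz_def lm_diff_left lm_add_left lm_mult diff_diff_eq mult.assoc)
qed

lemma letter_bracket_even:
  assumes "koszul (index_parity a) (index_parity b) = 1"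
  shows "l a (l b u) \<sim> l b (l a u) + lm (letter (basis_bracket a b)) u"
  using letter_bracket[of a b u] by (simp only: assms const_1 lm_1)

text \<open>Modulo \<open>Z\<close> the letter of a linear combination is the combination of
  letters, so stability under the basis letters is enough.\<close>

lemma sor_generation:
  assumes N: "Z \<subseteq> N" "\<And>x y. x \<in> N \<Longrightarrow> y \<in> N \<Longrightarrow> x + y \<in> N" "\<And>v. v \<in> carrier V \<Longrightarrow> emb v \<in> N"
    "\<And>c x. x \<in> N \<Longrightarrow> lm (const c) x \<in> N" and gen: "\<And>a x. x \<in> N \<Longrightarrow> l a x \<in> N"
  shows "x \<in> N"
proof (rule generation[OF N])
  have eq: "x \<in> N" if "x \<sim> y" "y \<in> N" for x y
    using N(2)[of "x - y" y] that N(1) by (auto simp: eqz_def)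
  fix s :: sor and x assume x: "x \<in> N"
  have "s \<in> sor_span UNIV" by (simp add: sor_span_UNIV)
  then show "lm (letter s) x \<in> N"
  proof (induction s rule: sor_span_induct)
    case zero
    then show ?case using letter_zero N(1) by blast
  next
    case (add a c s)
    have "lm (letter (sor_smult c (gen a))) x \<in> N"
      by (rule eq[OF letter_smult]) (intro N(4) gen x)
    then show ?case
      using eq[OF letter_add] N(2) add.IH by blast
  qed
qed

lemma gen_h: "a \<in> TS d \<Longrightarrow> gen a \<in> carrier h"
  proof -
  assume "a \<in> TS d"
  then have "gen a \<in> Td d" unfolding Td_span by (rule sor_span_gen)
  then show ?thesis by (simp only: carrier_sub)
qed

lemma letter_gen_mem: "a \<in> TS d \<Longrightarrow> letter (gen a) \<in> carrier (free_alg h)"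
  by (intro free_alg_letter gen_h)

lemma gen_emb:
  assumes "a \<in> TS d" "v \<in> carrier V"
  shows "l a (emb v) \<sim> emb (act P (gen a) v)" "act P (gen a) v \<in> carrier V"
proof -
  have g: "gen a \<in> carrier h" by (rule gen_h[OF assms(1)])
  then have e: "act V (gen a) v = act P (gen a) v" using V_act assms(2) unfolding carrier_sub by blast
  show "l a (emb v) \<sim> emb (act P (gen a) v)"
    using lm_emb[OF letter_gen_mem[OF assms(1)] assms(2)] V.free_act_letter[OF assms(2) g] e
    by (simp add: eqz_def)
  show "act P (gen a) v \<in> carrier V"
    using V.act_closed[OF g assms(2)] e by simp
qed

lemma const_emb: "v \<in> carrier V \<Longrightarrow> lm (const c) (emb v) \<sim> emb (c \<odot>\<^bsub>P\<^esub> v)"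
  using lm_emb[OF free_alg_const, of v c] V.free_act_const[of v c] V_sub(4) by (simp add: eqz_def)

lemma lm_com: "lm (const c) (lm p x) = lm p (lm (const c) x)"
  by (simp only: lm_mult[symmetric] const_commute[of c p])

text \<open>The scalar action is inherited from \<open>P\<close> on the vectors of \<open>V\<close>
  and then spreads along words, because all brackets with a central element vanish.\<close>

lemma central:
  assumes C: "C \<in> {iC1, iC2}" "acts_as_scalar P (gen C) c"
  shows "l C u \<sim> lm (const c) u"
proof -
  have "u \<in> {u. l C u \<sim> lm (const c) u}"
  proof (rule sor_generation; (unfold mem_Collect_eq)?)
    show "Z \<subseteq> {u. l C u \<sim> lm (const c) u}"
      by (auto simp: eqz_def intro!: Z_diff Z_lm)
    show "l C (x + y) \<sim> lm (const c) (x + y)" if "l C x \<sim> lm (const c) x" "l C y \<sim> lm (const c) y" for x y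
      using eqz_add[OF that] by (simp add: lm_add)
    show "l C (emb v) \<sim> lm (const c) (emb v)" if v: "v \<in> carrier V" for v
    proof -
      have "act P (gen C) v = c \<odot>\<^bsub>P\<^esub> v"
        using C(2) V_P[OF v] by (simp add: acts_as_scalar_def)
      moreover have "C \<in> TS d" using C(1) by auto
      ultimately have "l C (emb v) \<sim> emb (c \<odot>\<^bsub>P\<^esub> v)"
        using gen_emb(1)[OF _ v, of C] by simp
      then show ?thesis
        by (rule eqz_trans[OF _ eqz_sym[OF const_emb[OF v]]])
    qed
    show "l C (lm (const a) x) \<sim> lm (const c) (lm (const a) x)" if "l C x \<sim> lm (const c) x" for a x
      using eqz_lm[OF that, of "const a"] by (simp only: lm_com[of a])
    show "l C (l a x) \<sim> lm (const c) (l a x)" if x: "l C x \<sim> lm (const c) x" for a x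
    proof -
      have "l C (l a x) \<sim> l a (l C x) + lm (letter (basis_bracket C a)) x"
        using C(1) by (intro letter_bracket_even) (auto simp: koszul_def)
      also have "basis_bracket C a = 0" using C(1) by (cases a) auto
      also have "l a (l C x) + lm (letter 0) x \<sim> l a (lm (const c) x) + 0"
        using letter_zero by (intro eqz_add eqz_lm x) (simp add: eqz_def)
      also have "l a (lm (const c) x) + 0 = lm (const c) (l a x)"
        by (simp only: lm_com add_0_right)
      finally show ?thesis .
    qed
  qed
  then show ?thesis by simp
qed

lemma letter_lin: "lm (letter (sor_smult c (gen a) + y)) u \<sim> lm (const c) (l a u) + lm (letter y) u"
  by (rule eqz_trans[OF letter_add eqz_add[OF letter_smult eqz_refl]])

lemma lm_const_0: "lm (const 0) u = 0"
  by (rule poly_mapping_eqI) (simp add: const_def)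

lemma letter_if:
  assumes "\<And>u. lm (letter y) u \<sim> lm (const c) u"
  shows "lm (letter (if b then y else 0)) u \<sim> lm (const (if b then c else 0)) u"
  using assms letter_zero[of u] by (simp add: eqz_def lm_const_0)

lemma bracket_if:
  assumes "koszul (index_parity a) (index_parity b) = 1"
    and "basis_bracket a b = sor_smult e (gen g) + (if p then y else 0)" "\<And>u. lm (letter y) u \<sim> lm (const c) u"
  shows "l a (l b u) \<sim> l b (l a u) + lm (const e) (l g u) + lm (const (if p then c else 0)) u"
  unfolding add.assoc
  by (rule eqz_trans[OF letter_bracket_even[OF assms(1)] eqz_add[OF eqz_refl]], unfold assms(2))
    (rule eqz_trans[OF letter_lin eqz_add[OF eqz_refl letter_if[OF assms(3)]]])

text \<open>The relations hold modulo \<open>Z\<close>, hence modulo every larger stable space. The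
  two uses are \<open>Y = Z\<close> and \<open>Y = K\<close>.\<close>

lemma lowering_on:
  assumes Y: "Z \<subseteq> Y" "\<And>x y. x \<in> Y \<Longrightarrow> y \<in> Y \<Longrightarrow> x + y \<in> Y" "\<And>p x. x \<in> Y \<Longrightarrow> lm p x \<in> Y"
  shows "lowering (\<lambda>c. lm (const c)) (\<lambda>m. l (iL m)) (\<lambda>m. l (iW m)) (\<lambda>i. l (iG i)) c2 Y"
proof -
  interpret vs: vector_space "\<lambda>c. lm (const c) :: ('v \<Rightarrow>\<^sub>0 (sor gword \<Rightarrow>\<^sub>0 complex)) \<Rightarrow> _"
    by (rule vector_space_lm)
  have eqY: "x - y \<in> Y" if "x \<sim> y" for x y
    using that Y(1) by (auto simp: eqz_def)
  have com: "lm p (lm (const c) x) = lm (const c) (lm p x)" for p c and x :: "'v \<Rightarrow>\<^sub>0 (sor gword \<Rightarrow>\<^sub>0 complex)"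
    by (rule lm_com[symmetric])
  have C1': "lm (letter (gen iC1)) u \<sim> lm (const c1) u" and C2': "lm (letter (gen iC2)) u \<sim> lm (const c2) u" for u
    using central[OF _ C1] central[OF _ C2] by blast+
  have even: "koszul 0 i = 1" for i by (simp add: koszul_def)
  show ?thesis
  proof (intro lowering.intro vector_space_lm lowering_axioms.intro)
    show "vs.subspace Y"
      unfolding vs.subspace_def using Y Z_0 by blast
    show "\<exists>c. l (iL m) (l (iL n) x) - (l (iL n) (l (iL m) x) + lm (const (of_int (n - m))) (l (iL (m + n)) x) + lm (const c) x) \<in> Y" for m n x
    proof -
      have y: "lm (letter (sor_smult (of_int (m ^ 3 - m) / 12) (gen iC1))) u \<sim>
          lm (const (of_int (m ^ 3 - m) / 12 * c1)) u" for u
      proof -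
        have "lm (letter (sor_smult (of_int (m ^ 3 - m) / 12) (gen iC1))) u \<sim>
            lm (const (of_int (m ^ 3 - m) / 12)) (lm (const c1) u)"
          by (rule eqz_trans[OF letter_smult eqz_lm[OF C1']])
        then show ?thesis by (simp only: lm_mult[symmetric] const_mult)
      qed
      have "l (iL m) (l (iL n) x) \<sim> l (iL n) (l (iL m) x) + lm (const (of_int (n - m))) (l (iL (m + n)) x) +
          lm (const (if m + n = 0 then of_int (m ^ 3 - m) / 12 * c1 else 0)) x"
        by (rule bracket_if[OF _ _ y]) (simp_all only: index_parity.simps even basis_bracket.simps br_LL_def)
      then show ?thesis using eqY by blast
    qed
    show "l (iL m) (l (iW n) x) - (l (iW n) (l (iL m) x) + lm (const (of_int (m + n))) (l (iW (m + n)) x) +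
        lm (const (if m + n = 0 then c2 else 0)) x) \<in> Y" for m n x
      by (rule eqY, rule bracket_if[OF _ _ C2']) (simp_all only: index_parity.simps even basis_bracket.simps br_LW_def)
    show "l (iL m) (l (iG i) x) - (l (iG i) (l (iL m) x) + lm (const (of_int i + 1 / 2)) (l (iG (m + i)) x)) \<in> Y" for m i x
    proof (rule eqY)
      have "l (iL m) (l (iG i) x) \<sim> l (iG i) (l (iL m) x) + lm (letter (br_LG m i)) x"
        using letter_bracket_even[of "iL m" "iG i" x] by (simp add: even)
      also have "\<dots> \<sim> l (iG i) (l (iL m) x) + lm (const (of_int i + 1 / 2)) (l (iG (m + i)) x)"
        unfolding br_LG_def by (rule eqz_add[OF eqz_refl letter_smult])
      finally show "l (iL m) (l (iG i) x) \<sim> l (iG i) (l (iL m) x) + lm (const (of_int i + 1 / 2)) (l (iG (m + i)) x)" .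
    qed
    show "l (iG i) (l (iG j) x) - (- l (iG j) (l (iG i) x) + lm (const (of_int (i + j + 1))) (l (iW (i + j + 1)) x) +
        lm (const (if i + j + 1 = 0 then c2 else 0)) x) \<in> Y" for i j x
    proof (rule eqY)
      have k: "koszul 1 1 = - 1" by (simp add: koszul_def)
      have "l (iG i) (l (iG j) x) \<sim> - l (iG j) (l (iG i) x) + lm (letter (br_GG i j)) x"
        using letter_bracket[of "iG i" "iG j" x] by (simp only: index_parity.simps k lm_uminus_1 basis_bracket.simps)
      also have "\<dots> \<sim> - l (iG j) (l (iG i) x) + (lm (const (of_int (i + j + 1))) (l (iW (i + j + 1)) x) +
          lm (const (if i + j + 1 = 0 then c2 else 0)) x)"
        unfolding br_GG_def
        by (rule eqz_add[OF eqz_refl eqz_trans[OF letter_lin eqz_add[OF eqz_refl letter_if[OF C2']]]])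
      finally show "l (iG i) (l (iG j) x) \<sim> - l (iG j) (l (iG i) x) +
          lm (const (of_int (i + j + 1))) (l (iW (i + j + 1)) x) + lm (const (if i + j + 1 = 0 then c2 else 0)) x"
        by (simp only: add.assoc)
    qed
    have zero: "l a (l b x) - l b (l a x) \<in> Y" if "index_parity a = 0" "basis_bracket a b = 0" for a b x
    proof (rule eqY)
      have "l a (l b x) \<sim> l b (l a x) + lm (letter 0) x"
        using letter_bracket_even[of a b x] that by (simp add: even)
      also have "\<dots> \<sim> l b (l a x) + 0"
        using letter_zero by (intro eqz_add eqz_refl) (simp add: eqz_def)
      finally show "l a (l b x) \<sim> l b (l a x)" by simp
    qed
    show "l (iW m) (l (iW n) x) - l (iW n) (l (iW m) x) \<in> Y" for m n x
      by (rule zero) simp_all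
    show "l (iW m) (l (iG i) x) - l (iG i) (l (iW m) x) \<in> Y" for m i x
      by (rule zero) simp_all
  qed (simp_all only: lm_add com Y(3))
qed

definition K where "K = {x. f x = \<zero>\<^bsub>P\<^esub>}"

lemma f_gen: "f (l a x) = act P (gen a) (f x)"
  by (simp add: f_lm P.free_act_letter f_closed univ)

lemma free_act_zero: "free_act P p \<zero>\<^bsub>P\<^esub> = \<zero>\<^bsub>P\<^esub>"
  using P.free_act_smult_right[of p "\<zero>\<^bsub>P\<^esub>" 0] P.free_act_closed[of "\<zero>\<^bsub>P\<^esub>" p] by (simp add: P.M.CC_null)

lemma K_props:
  shows Z_K: "Z \<subseteq> K" and K_add: "x \<in> K \<Longrightarrow> y \<in> K \<Longrightarrow> x + y \<in> K" and K_lm: "x \<in> K \<Longrightarrow> lm p x \<in> K"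
  by (auto simp: K_def f_Z f_add f_lm free_act_zero)

lemma K_W: "t > 0 \<Longrightarrow> l (iW (int t)) x \<in> K \<Longrightarrow> x \<in> K"
  using W_inj[OF _ f_closed[of x]] by (simp add: K_def f_gen)

lemma generated:
  assumes "Z \<subseteq> N" "\<And>x y. x \<in> N \<Longrightarrow> y \<in> N \<Longrightarrow> x + y \<in> N" "\<And>c x. x \<in> N \<Longrightarrow> lm (const c) x \<in> N"
    and "\<And>v. v \<in> carrier V \<Longrightarrow> emb v \<in> N" and "\<And>m x. x \<in> N \<Longrightarrow> l (iL m) x \<in> N"
    and "\<And>m x. x \<in> N \<Longrightarrow> l (iW m) x \<in> N" and "\<And>m x. x \<in> N \<Longrightarrow> l (iG m) x \<in> N"
  shows "N = UNIV"
proof -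
  have eq: "x \<in> N" if "x \<sim> y" "y \<in> N" for x y
    using assms(2)[of "x - y" y] that assms(1) by (auto simp: eqz_def)
  have "l a x \<in> N" if x: "x \<in> N" for a x
  proof (cases a)
    case iC1
    then show ?thesis using eq[OF central[OF _ C1] assms(3)[OF x]] by simp
  next
    case iC2
    then show ?thesis using eq[OF central[OF _ C2] assms(3)[OF x]] by simp
  qed (use assms(5-7) x in auto)
  then have "x \<in> N" for x
    using sor_generation[of N x] assms(1-4) by blast
  then show ?thesis by blast
qed

text \<open>Working modulo \<open>K\<close> amounts to working in \<open>P\<close> itself: the
  locale parameter \<open>Z\<close> is instantiated by \<open>K\<close>, its \<open>V\<close> by the
  preimage of \<open>carrier V\<close>, and the condition \<open>V \<inter> K \<subseteq> Z\<close>
  becomes trivial.\<close>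

lemma singular_mem:
  assumes "\<And>a. a \<in> SS d t \<Longrightarrow> act P (gen a) (f x) = \<zero>\<^bsub>P\<^esub>"
  shows "f x \<in> carrier V"
proof -
  interpret low: lowering "\<lambda>c. lm (const c)" "\<lambda>m. l (iL m)" "\<lambda>m. l (iW m)" "\<lambda>i. l (iG i)" c2 K
    by (rule lowering_on[OF Z_K K_add K_lm])
  let ?V = "{x. f x \<in> carrier V}"
  have zero: "\<zero>\<^bsub>P\<^esub> \<in> carrier V" using V.M.zero_closed V_sub(3) by simp
  have f0: "f 0 = \<zero>\<^bsub>P\<^esub>" using f_Z[OF Z_0] .
  have sK: "low.zspace K" by (rule low.zspace_Z_self)
  have Vadd: "x + y \<in> ?V" if "x \<in> ?V" "y \<in> ?V" for x y
    using V.M.a_closed[of "f x" "f y"] that V_sub(2) by (simp add: f_add)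
  have Vscale: "lm (const c) x \<in> ?V" if "x \<in> ?V" for c x
    using V.M.CC_smult_closed[of "f x" c] that V_sub(4) by (simp add: f_lm P.free_act_const f_closed)
  have KV: "K \<subseteq> ?V"
    using zero by (auto simp: K_def)
  have V0: "0 \<in> ?V"
    using f0 zero by simp
  have sV: "low.zspace ?V"
    unfolding low.zspace_def low.subspace_def by (intro conjI ballI allI V0 Vadd Vscale KV)
  have st: "f (l a x) \<in> carrier V" if "f x \<in> carrier V" "a \<in> TS d" for a x
    using gen_emb(2)[OF that(2,1)] by (simp add: f_gen)
  have nu: "l a x \<in> K" if "f x \<in> carrier V" "a \<in> SS d t" for a x
    using sing[OF that] by (simp add: K_def f_gen)
  interpret li: lowering_induced "\<lambda>c. lm (const c)" "\<lambda>m. l (iL m)" "\<lambda>m. l (iW m)" "\<lambda>i. l (iG i)" c2 K d t K ?V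
  proof (intro lowering_induced.intro low.lowering_axioms lowering_induced_axioms.intro sK sV Int_lower2)
    fix x m
    show "l (iL m) x \<in> K" "l (iW m) x \<in> K" "l (iG m) x \<in> K" if "x \<in> K"
      by (rule K_lm[OF that])+
    show "0 \<le> m \<Longrightarrow> l (iL m) x \<in> ?V" "- int d \<le> m \<Longrightarrow> l (iW m) x \<in> ?V" "0 \<le> m \<Longrightarrow> l (iG m) x \<in> ?V"
      if "x \<in> ?V"
      using that by (simp_all add: st)
    show "int (t + d) < m \<Longrightarrow> l (iL m) x \<in> K" "int t < m \<Longrightarrow> l (iW m) x \<in> K" "int t \<le> m \<Longrightarrow> l (iG m) x \<in> K"
      if "x \<in> ?V"
      using that by (simp_all add: nu)
  next
    show "t = 0 \<Longrightarrow> c2 \<noteq> 0" by (rule c2)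
    show "t > 0 \<Longrightarrow> l (iW (int t)) x \<in> K \<Longrightarrow> x \<in> K" for x by (rule K_W)
    show "N = UNIV" if N: "low.zspace N" "?V \<subseteq> N" "\<And>m x. x \<in> N \<Longrightarrow> l (iL m) x \<in> N"
      "\<And>m x. x \<in> N \<Longrightarrow> l (iW m) x \<in> N" "\<And>m x. x \<in> N \<Longrightarrow> l (iG m) x \<in> N" for N
    proof (rule generated)
      show "Z \<subseteq> N" using N(1) Z_K by (auto simp: low.zspace_def)
      show "x + y \<in> N" if "x \<in> N" "y \<in> N" for x y using low.zspace_add[OF N(1) that] .
      show "lm (const c) x \<in> N" if "x \<in> N" for c x using low.zspace_scale[OF N(1) that] .
      show "emb v \<in> N" if v: "v \<in> carrier V" for v
      proof -
        have "f (emb v) = v" using f_single[OF v, of 1] P.free_act_const[of v 1] V_P[OF v]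
          by (simp add: const_1 P.M.CC_one)
        then show ?thesis using N(2) v by auto
      qed
    qed (fact N(3-5))+
  qed
  have "x \<in> ?V"
    by (rule li.singular_in_V) (simp_all add: K_def f_gen assms)
  then show ?thesis by simp
qed

text \<open>This time the relations are those of the induced module and the generating space is the
  copy of \<open>V\<close> inside it. A vector of the kernel is sent into \<open>K\<close> by all
  operators, so it lies in that copy; and there \<open>f\<close> is injective, since
  \<open>f (emb v) = v\<close>.\<close>

lemma f_inj:
  assumes "f x = \<zero>\<^bsub>P\<^esub>"
  shows "x \<in> Z"
proof -
  interpret low: lowering "\<lambda>c. lm (const c)" "\<lambda>m. l (iL m)" "\<lambda>m. l (iW m)" "\<lambda>i. l (iG i)" c2 Z
    by (rule lowering_on[OF subset_refl Z_add Z_lm])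
  let ?V = "{x. \<exists>v\<in>carrier V. x \<sim> emb v}"
  have ev: "f x = v" if "x \<sim> emb v" "v \<in> carrier V" for x v
    using f_eqz[OF that(1)] f_single[OF that(2), of 1] P.free_act_const[of v 1] V_P[OF that(2)]
    by (simp add: const_1 P.M.CC_one)
  have zero: "\<zero>\<^bsub>V\<^esub> \<in> carrier V" by simp
  have VK: "?V \<inter> K \<subseteq> Z"
  proof
    fix x assume "x \<in> ?V \<inter> K"
    then obtain v where v: "v \<in> carrier V" "x \<sim> emb v" and "x \<in> K" by (elim IntE CollectE bexE)
    then have fx: "f x = \<zero>\<^bsub>P\<^esub>" by (simp add: K_def)
    have "v = \<zero>\<^bsub>V\<^esub>" using ev[OF v(2,1)] fx V_sub(3) by simp
    then show "x \<in> Z" using eqz_Z[OF v(2)] emb_zero by simp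
  qed
  have ZV: "x \<in> ?V" if "x \<in> Z" for x
  proof -
    have "x \<sim> emb \<zero>\<^bsub>V\<^esub>" unfolding eqz_def by (rule Z_diff[OF that emb_zero])
    then show ?thesis by (intro CollectI bexI[OF _ zero])
  qed
  have Vadd: "x + y \<in> ?V" if xy: "x \<in> ?V" "y \<in> ?V" for x y
  proof -
    obtain v w where vw: "v \<in> carrier V" "x \<sim> emb v" "w \<in> carrier V" "y \<sim> emb w" using xy by (elim CollectE bexE)
    have "x + y \<sim> emb v + emb w" by (rule eqz_add[OF vw(2,4)])
    also have "\<dots> \<sim> emb (v \<oplus>\<^bsub>V\<^esub> w)"
      by (rule eqz_sym) (simp add: eqz_def emb_add[OF vw(1,3)])
    finally show ?thesis by (intro CollectI bexI[OF _ V.M.a_closed[OF vw(1,3)]])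
  qed
  have Vscale: "lm (const c) x \<in> ?V" if x: "x \<in> ?V" for c x
  proof -
    obtain v where v: "v \<in> carrier V" "x \<sim> emb v" using x by (elim CollectE bexE)
    have "lm (const c) x \<sim> emb (c \<odot>\<^bsub>P\<^esub> v)" by (rule eqz_trans[OF eqz_lm[OF v(2)] const_emb[OF v(1)]])
    moreover have "c \<odot>\<^bsub>P\<^esub> v \<in> carrier V"
      using V.M.CC_smult_closed[OF v(1), of c] V_sub(4) by simp
    ultimately show ?thesis by (intro CollectI bexI)
  qed
  have sV: "low.zspace ?V"
    unfolding low.zspace_def low.subspace_def
  proof (intro conjI ballI allI subsetI)
    show "0 \<in> ?V" by (rule ZV[OF Z_0])
  qed (rule Vadd Vscale ZV; assumption)+
  have sK: "low.zspace K"
    unfolding low.zspace_def low.subspace_def by (intro conjI ballI allI Z_K subsetD[OF Z_K Z_0] K_add K_lm)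
  have gen: "l a x \<sim> emb (act P (gen a) v)" if "x \<sim> emb v" "v \<in> carrier V" "a \<in> TS d" for a x v
    by (rule eqz_trans[OF eqz_lm[OF that(1)] gen_emb(1)[OF that(3,2)]])
  have st: "l a x \<in> ?V" if xa: "x \<in> ?V" "a \<in> TS d" for a x
  proof -
    obtain v where v: "v \<in> carrier V" "x \<sim> emb v" using xa(1) by (elim CollectE bexE)
    show ?thesis
      by (rule CollectI, rule bexI[where x = "act P (gen a) v"])
        (rule gen[OF v(2,1) xa(2)], rule gen_emb(2)[OF xa(2) v(1)])
  qed
  have nu: "l a x \<in> Z" if x: "x \<in> ?V" and a: "a \<in> SS d t" for a x
  proof -
    obtain v where v: "v \<in> carrier V" "x \<sim> emb v" using x by (elim CollectE bexE)
    have "l a x \<sim> emb \<zero>\<^bsub>V\<^esub>"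
      using gen[OF v(2,1) subsetD[OF S_subset_T a]] sing[OF v(1) a] V_sub(3) by simp
    then show ?thesis by (rule eqz_Z[OF _ emb_zero])
  qed
  interpret li: lowering_induced "\<lambda>c. lm (const c)" "\<lambda>m. l (iL m)" "\<lambda>m. l (iW m)" "\<lambda>i. l (iG i)" c2 Z d t K ?V
  proof (intro lowering_induced.intro low.lowering_axioms lowering_induced_axioms.intro sK sV VK)
    fix x m
    show "l (iL m) x \<in> K" "l (iW m) x \<in> K" "l (iG m) x \<in> K" if "x \<in> K"
      by (rule K_lm[OF that])+
    show "0 \<le> m \<Longrightarrow> l (iL m) x \<in> ?V" "- int d \<le> m \<Longrightarrow> l (iW m) x \<in> ?V" "0 \<le> m \<Longrightarrow> l (iG m) x \<in> ?V"
      if "x \<in> ?V"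
      using st[OF that, of "iL m"] st[OF that, of "iW m"] st[OF that, of "iG m"] by simp_all
    show "int (t + d) < m \<Longrightarrow> l (iL m) x \<in> Z" "int t < m \<Longrightarrow> l (iW m) x \<in> Z" "int t \<le> m \<Longrightarrow> l (iG m) x \<in> Z"
      if "x \<in> ?V"
      using nu[OF that, of "iL m"] nu[OF that, of "iW m"] nu[OF that, of "iG m"] by simp_all
  next
    show "t = 0 \<Longrightarrow> c2 \<noteq> 0" by (rule c2)
    show "t > 0 \<Longrightarrow> l (iW (int t)) x \<in> K \<Longrightarrow> x \<in> K" for x by (rule K_W)
    show "N = UNIV" if N: "low.zspace N" "?V \<subseteq> N" "\<And>m x. x \<in> N \<Longrightarrow> l (iL m) x \<in> N"
      "\<And>m x. x \<in> N \<Longrightarrow> l (iW m) x \<in> N" "\<And>m x. x \<in> N \<Longrightarrow> l (iG m) x \<in> N" for N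
    proof (rule generated)
      show "Z \<subseteq> N" using N(1) by (auto simp: low.zspace_def)
      show "x + y \<in> N" if "x \<in> N" "y \<in> N" for x y using low.zspace_add[OF N(1) that] .
      show "lm (const c) x \<in> N" if "x \<in> N" for c x using low.zspace_scale[OF N(1) that] .
      show "emb v \<in> N" if v: "v \<in> carrier V" for v
        by (intro subsetD[OF N(2)] CollectI bexI[OF eqz_refl v])
    qed (fact N(3-5))+
  qed
  have "x \<in> K" using assms by (simp add: K_def)
  then have "x \<in> ?V"
    by (intro li.singular_in_V K_lm)
  then show ?thesis by (intro subsetD[OF VK] IntI \<open>x \<in> K\<close>)
qed

end

context lie_supermodule
begin

lemma zero_unless_homogeneous:
  assumes "a \<in> hpart M 0" "b \<in> hpart M 1" "a \<oplus>\<^bsub>M\<^esub> b = \<zero>\<^bsub>M\<^esub>"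
  shows "a = \<zero>\<^bsub>M\<^esub>" "b = \<zero>\<^bsub>M\<^esub>"
proof -
  have c: "a \<in> carrier M" "b \<in> carrier M"
    by (rule M.hpart_carrier[OF assms(1)], rule M.hpart_carrier[OF assms(2)])
  have "a = \<ominus>\<^bsub>M\<^esub> b"
    using M.minus_equality[OF assms(3) c(2,1)] by simp
  then have "a \<in> hpart M 1"
    using M.hpart_smult[OF assms(2), of "-1"] by (simp add: M.CC_minus[OF c(2)])
  then show a: "a = \<zero>\<^bsub>M\<^esub>" using assms(1) M.hpart_disjoint by blast
  then show "b = \<zero>\<^bsub>M\<^esub>" using assms(3) c by simp
qed

text \<open>A homogeneous element sends the two parts of a vector to different parities, so their
  images cannot cancel. This is why spaces of annihilated vectors are graded.\<close>

lemma act_homogeneous_null: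
  assumes x: "x \<in> hpart \<gg> i" and ab: "a \<in> hpart M 0" "b \<in> hpart M 1" and z: "act M x (a \<oplus>\<^bsub>M\<^esub> b) = \<zero>\<^bsub>M\<^esub>"
  shows "act M x a = \<zero>\<^bsub>M\<^esub>" "act M x b = \<zero>\<^bsub>M\<^esub>"
proof -
  have c: "a \<in> carrier M" "b \<in> carrier M" "x \<in> carrier \<gg>"
    by (rule M.hpart_carrier[OF ab(1)], rule M.hpart_carrier[OF ab(2)], rule hpart_carrier[OF x])
  have s: "act M x a \<oplus>\<^bsub>M\<^esub> act M x b = \<zero>\<^bsub>M\<^esub>" "act M x b \<oplus>\<^bsub>M\<^esub> act M x a = \<zero>\<^bsub>M\<^esub>"
    using z act_add_right[OF c(3,1,2)] M.a_comm act_closed c by simp_all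
  have h: "act M x a \<in> hpart M (i + 0)" "act M x b \<in> hpart M (i + 1)"
    using act_hpart[OF x ab(1)] act_hpart[OF x ab(2)] by simp_all
  have "act M x a = \<zero>\<^bsub>M\<^esub> \<and> act M x b = \<zero>\<^bsub>M\<^esub>"
  proof (cases "i = 0")
    case True
    then show ?thesis using zero_unless_homogeneous[OF _ _ s(1)] h by simp
  next
    case False
    then have "i = 1" by (cases i) auto
    then show ?thesis using zero_unless_homogeneous[OF _ _ s(2)] h by simp
  qed
  then show "act M x a = \<zero>\<^bsub>M\<^esub>" "act M x b = \<zero>\<^bsub>M\<^esub>" by blast+
qed

end

section \<open>Vectors killed by the ideal, and injectivity of \<open>W t\<close>\<close>

locale sor_module = P: lie_supermodule SOR P for P :: "(sor, 'v, 'c) lie_supermodule_scheme"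
begin

abbreviation A :: "sor_index \<Rightarrow> 'v \<Rightarrow> 'v" where "A a \<equiv> act P (gen a)"

lemma A_closed: "v \<in> carrier P \<Longrightarrow> A a v \<in> carrier P"
  by (rule P.act_closed) simp_all

lemma A_zero: "A a \<zero>\<^bsub>P\<^esub> = \<zero>\<^bsub>P\<^esub>"
  by (rule P.act_zero) simp

lemma act_zero_left: "v \<in> carrier P \<Longrightarrow> act P 0 v = \<zero>\<^bsub>P\<^esub>"
  using P.act_smult_left[of "0 :: sor" v 0] P.act_closed[of "0 :: sor" v] by (simp add: sor_smult_eq P.M.CC_null)

lemma act_span:
  assumes N: "submodule N CC P" and x: "x \<in> sor_span B" and v: "v \<in> carrier P" "\<And>a. a \<in> B \<Longrightarrow> A a v \<in> N"
  shows "act P x v \<in> N"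
  using x
proof (induction x rule: sor_span_induct)
  case zero
  then show ?case using act_zero_left[OF v(1)] CC_submoduleD(2)[OF N] by simp
next
  case (add a c y)
  have "act P (sor_smult c (gen a) + y) v = c \<odot>\<^bsub>P\<^esub> A a v \<oplus>\<^bsub>P\<^esub> act P y v"
    using P.act_add_left[of "sor_smult c (gen a)" y v] P.act_smult_left[of "gen a" v c] v(1) by simp
  then show ?case
    using CC_submoduleD(3)[OF N CC_submoduleD(4)[OF N v(2)[OF add.hyps(1)]] add.IH] by simp
qed

lemma submodule_zero: "submodule {\<zero>\<^bsub>P\<^esub>} CC P"
  by (rule CC_submoduleI[OF P.M.module_axioms]) (simp_all add: P.M.CC_r_null)

lemma A_commutator:
  assumes "v \<in> carrier P"
  shows "A a (A b v) = act P (basis_bracket a b) v \<oplus>\<^bsub>P\<^esub>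
    koszul (index_parity a) (index_parity b) \<odot>\<^bsub>P\<^esub> A b (A a v)"
proof -
  let ?k = "koszul (index_parity a) (index_parity b) \<odot>\<^bsub>P\<^esub> A b (A a v)"
  have "act P (basis_bracket a b) v = A a (A b v) \<ominus>\<^bsub>P\<^esub> ?k"
    using P.act_bracket[OF gen_hpart gen_hpart assms, of a b] by (simp add: sor_bracket_gen)
  moreover have "?k \<in> carrier P" "A a (A b v) \<in> carrier P"
    using assms by (auto intro!: P.M.CC_smult_closed A_closed)
  ultimately show ?thesis
    by (simp add: a_minus_def P.M.a_assoc P.M.l_neg)
qed

definition Sing :: "nat \<Rightarrow> nat \<Rightarrow> 'v set" where
  "Sing d t = {v \<in> carrier P. \<forall>a\<in>SS d t. A a v = \<zero>\<^bsub>P\<^esub>}"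

lemma Sing_carrier: "v \<in> Sing d t \<Longrightarrow> v \<in> carrier P"
  by (simp add: Sing_def)

lemma submodule_Sing: "submodule (Sing d t) CC P"
  by (rule CC_submoduleI[OF P.M.module_axioms])
    (auto simp: Sing_def A_zero P.act_add_right P.act_smult_right P.M.CC_smult_closed P.M.CC_r_null)

text \<open>When an element of the ideal is moved past one of \<open>Td d\<close>, the bracket stays
  in the ideal and kills \<open>v\<close> as well.\<close>

lemma Sing_A: "a \<in> TS d \<Longrightarrow> v \<in> Sing d t \<Longrightarrow> A a v \<in> Sing d t"
proof -
  assume a: "a \<in> TS d" and v: "v \<in> Sing d t"
  have "A b (A a v) = \<zero>\<^bsub>P\<^esub>" if b: "b \<in> SS d t" for b
  proof -
    have "act P (basis_bracket b a) v \<in> {\<zero>\<^bsub>P\<^esub>}"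
      using v by (intro act_span[OF submodule_zero basis_bracket_S(1)[OF b a]]) (auto simp: Sing_def)
    moreover have "A b v = \<zero>\<^bsub>P\<^esub>" using v b by (simp add: Sing_def)
    ultimately show ?thesis
      using A_commutator[OF Sing_carrier[OF v], of b a] by (simp add: A_zero P.M.CC_r_null)
  qed
  then show ?thesis using A_closed[OF Sing_carrier[OF v]] by (simp add: Sing_def)
qed

lemma Sing_act: "x \<in> Td d \<Longrightarrow> v \<in> Sing d t \<Longrightarrow> act P x v \<in> Sing d t"
  unfolding Td_span by (rule act_span[OF submodule_Sing _ Sing_carrier Sing_A])

lemma Sing_null: "x \<in> Sr (t + d + 1) (t + 1) (t + 1) \<Longrightarrow> v \<in> Sing d t \<Longrightarrow> act P x v = \<zero>\<^bsub>P\<^esub>"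
  using act_span[OF submodule_zero, of x "SS d t" v] unfolding Sr_span by (simp add: Sing_def)

lemma Sing_graded: "Sing d t \<subseteq> (Sing d t \<inter> hpart P 0) <+>\<^bsub>P\<^esub> (Sing d t \<inter> hpart P 1)"
proof
  fix v assume v: "v \<in> Sing d t"
  obtain a b where ab: "a \<in> hpart P 0" "b \<in> hpart P 1" "v = a \<oplus>\<^bsub>P\<^esub> b"
    using Sing_carrier[OF v] by (rule P.M.hpart_decomp)
  have "A i a = \<zero>\<^bsub>P\<^esub> \<and> A i b = \<zero>\<^bsub>P\<^esub>" if "i \<in> SS d t" for i
    using P.act_homogeneous_null[OF gen_hpart[of i] ab(1,2)] v that unfolding ab(3) by (simp add: Sing_def)
  then have "a \<in> Sing d t" "b \<in> Sing d t"
    using P.M.hpart_carrier[OF ab(1)] P.M.hpart_carrier[OF ab(2)] by (simp_all add: Sing_def)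
  then show "v \<in> (Sing d t \<inter> hpart P 0) <+>\<^bsub>P\<^esub> (Sing d t \<inter> hpart P 1)"
    unfolding set_add_iff using ab by blast
qed

lemma lie_SOR: "lie_superalgebra SOR"
  by (rule P.lie_superalgebra_axioms)

lemma induced_module_sub:
  assumes N: "submodule N CC P" "N \<subseteq> (N \<inter> hpart P 0) <+>\<^bsub>P\<^esub> (N \<inter> hpart P 1)"
    and closed: "\<And>x v. x \<in> Td d \<Longrightarrow> v \<in> N \<Longrightarrow> act P x v \<in> N"
    and V: "carrier V = N" "\<zero>\<^bsub>V\<^esub> = \<zero>\<^bsub>P\<^esub>" "add V = add P" "module.smult V = module.smult P"
      "hpart V = (\<lambda>i. hpart P i \<inter> N)" "\<And>x v. x \<in> Td d \<Longrightarrow> v \<in> N \<Longrightarrow> act V x v = act P x v"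
  shows "induced_module SOR (Td d) P V"
proof -
  let ?M = "P\<lparr>carrier := N, hpart := \<lambda>i. hpart P i \<inter> N\<rparr>" and ?h = "sub_lsa SOR (Td d)"
  have M: "lie_supermodule ?h ?M"
    by (rule lie_supermodule_sub[OF P.lie_supermodule_axioms lie_superalgebra_Td[OF lie_SOR] _ N closed]) simp
  have "lie_supermodule ?h V"
    by (rule lie_supermodule_descend[OF M lie_superalgebra_Td[OF lie_SOR], where \<pi> = "\<lambda>x. x"])
      (simp_all only: image_ident V partial_object.simps module.simps ring.simps superspace.simps lie_supermodule.simps,
       simp_all add: V sub_lsa_def)
  then show ?thesis
    by (intro induced_module.intro P.lie_supermodule_axioms induced_module_axioms.intro)
      (use CC_submoduleD(1)[OF N(1)] V in \<open>auto simp: subset_iff\<close>)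
qed

lemma A_double_zero:
  assumes "x \<in> carrier P" "x = (-1) \<odot>\<^bsub>P\<^esub> x"
  shows "x = \<zero>\<^bsub>P\<^esub>"
proof -
  have "(2 :: complex) \<odot>\<^bsub>P\<^esub> x = x \<oplus>\<^bsub>P\<^esub> x"
    using P.M.CC_l_distr[OF assms(1), of 1 1] P.M.CC_one[OF assms(1)] by simp
  also have "\<dots> = x \<oplus>\<^bsub>P\<^esub> (-1) \<odot>\<^bsub>P\<^esub> x" using assms(2) by simp
  also have "\<dots> = \<zero>\<^bsub>P\<^esub>"
    using assms(1) by (simp add: P.M.CC_minus[symmetric] P.M.r_neg)
  finally have "(1/2) \<odot>\<^bsub>P\<^esub> ((2 :: complex) \<odot>\<^bsub>P\<^esub> x) = \<zero>\<^bsub>P\<^esub>"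
    by (simp add: P.M.CC_r_null)
  then show ?thesis
    using P.M.CC_assoc[OF assms(1), of "1/2" 2] P.M.CC_one[OF assms(1)] by simp
qed

text \<open>If \<open>W\<^sub>t\<close> kills \<open>v\<close>, then \<open>v\<close> or \<open>G\<^bsub>t-1/2\<^esub> v\<close> is killed by everything that a smaller
  value of \<open>t\<close> requires.\<close>

lemma W_inj_Sing:
  assumes t: "t > 0" and min: "Sing (Suc d) (t - 1) \<subseteq> {\<zero>\<^bsub>P\<^esub>}"
    and v: "v \<in> Sing d t" and W0: "A (iW (int t)) v = \<zero>\<^bsub>P\<^esub>"
  shows "v = \<zero>\<^bsub>P\<^esub>"
proof -
  let ?g = "iG (int t - 1)" and ?B = "insert (iW (int t)) (SS d t)" and ?S = "SS (Suc d) (t - 1)"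
  have vc: "v \<in> carrier P" by (rule Sing_carrier[OF v])
  have B0: "A a v = \<zero>\<^bsub>P\<^esub>" if "a \<in> ?B" for a
    using that v W0 by (auto simp: Sing_def)
  \<comment> \<open>Raising \<open>d\<close> by one while lowering \<open>t\<close> by one leaves
    the bound \<open>t + d\<close> for the \<open>L\<close> unchanged, so the only new conditions
    concern \<open>W t\<close> and \<open>?g\<close>.\<close>
  have S: "a \<in> insert ?g ?B" if "a \<in> ?S" for a
    using that t by (cases a) (auto simp: of_nat_diff)
  \<comment> \<open>The bracket of \<open>?g\<close> with some \<open>iG i\<close>, where
    \<open>i \<ge> t - 1\<close>, is a multiple of \<open>W (i + t)\<close>. Its index is at least
    \<open>2t - 1\<close>, and this is at least \<open>t\<close> because \<open>t > 0\<close>; so it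
    kills \<open>v\<close> by \<open>W0\<close> or by the ideal.\<close>
  have bb: "basis_bracket a ?g \<in> sor_span ?B" if "a \<in> ?S" for a
    using that t
    by (cases a) (auto simp: br_defs of_nat_diff intro!: sor_span_add sor_span_smult sor_span_gen sor_span_0)
  have w: "A ?g v \<in> Sing (Suc d) (t - 1)"
    unfolding Sing_def
  proof (intro CollectI conjI ballI A_closed vc)
    fix a assume a: "a \<in> ?S"
    have "act P (basis_bracket a ?g) v \<in> {\<zero>\<^bsub>P\<^esub>}"
      by (rule act_span[OF submodule_zero bb[OF a] vc]) (simp only: B0 singleton_iff)
    then have c: "A a (A ?g v) = koszul (index_parity a) 1 \<odot>\<^bsub>P\<^esub> A ?g (A a v)"
      using A_commutator[OF vc, of a ?g] P.M.CC_smult_closed[OF A_closed[OF A_closed[OF vc]]] by simp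
    show "A a (A ?g v) = \<zero>\<^bsub>P\<^esub>"
    \<comment> \<open>It is not known yet that \<open>?g\<close> kills \<open>v\<close>. But an odd
      operator whose bracket with itself kills \<open>v\<close> satisfies
      \<open>A ?g (A ?g v) = - A ?g (A ?g v)\<close>, so its square does kill
      \<open>v\<close>.\<close>
    proof (cases "a = ?g")
      case True
      then show ?thesis
        using c by (intro A_double_zero A_closed vc) (simp add: koszul_def)
    next
      case False
      then have "A a v = \<zero>\<^bsub>P\<^esub>" using S[OF a] B0 by blast
      then show ?thesis using c by (simp add: A_zero P.M.CC_r_null)
    qed
  qed
  then have g0: "A ?g v = \<zero>\<^bsub>P\<^esub>" using min by blast
  have "A a v = \<zero>\<^bsub>P\<^esub>" if "a \<in> ?S" for a
    using S[OF that] B0 g0 by blast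
  then have "v \<in> Sing (Suc d) (t - 1)" using vc by (simp add: Sing_def)
  then show ?thesis using min by blast
qed

text \<open>Bracketing with \<open>W t\<close> maps the algebra into the span of the
  \<open>W\<close> and \<open>C2\<close>, all of which commute with \<open>W t\<close>; hence the
  locally nilpotent vectors \<open>N\<close> of \<open>W t\<close> form a submodule. If it were all
  of \<open>P\<close>, some power of \<open>W t\<close> would kill \<open>u\<close>; but
  \<open>W t\<close> preserves \<open>Sing d t\<close> and is injective there by
  \<open>W_inj_Sing\<close>.\<close>

lemma W_inj:
  assumes simple: "\<And>N. graded_submodule SOR P N \<Longrightarrow> N = {\<zero>\<^bsub>P\<^esub>} \<or> N = carrier P"
    and t: "t > 0" and min: "Sing (Suc d) (t - 1) \<subseteq> {\<zero>\<^bsub>P\<^esub>}" and u: "u \<in> Sing d t" "u \<noteq> \<zero>\<^bsub>P\<^esub>"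
    and v: "v \<in> carrier P" "A (iW (int t)) v = \<zero>\<^bsub>P\<^esub>"
  shows "v = \<zero>\<^bsub>P\<^esub>"
proof -
  let ?w = "iW (int t)"
  define T where "T = A ?w"
  have T_closed: "(T ^^ n) x \<in> carrier P" if "x \<in> carrier P" for n x
    by (induction n) (simp_all add: that T_def A_closed)
  have T_add: "(T ^^ n) (x \<oplus>\<^bsub>P\<^esub> y) = (T ^^ n) x \<oplus>\<^bsub>P\<^esub> (T ^^ n) y"
    if "x \<in> carrier P" "y \<in> carrier P" for n x y
  proof (induction n)
    case (Suc n)
    then show ?case using T_closed that by (simp add: T_def P.act_add_right)
  qed simp
  have T_smult: "(T ^^ n) (c \<odot>\<^bsub>P\<^esub> x) = c \<odot>\<^bsub>P\<^esub> (T ^^ n) x" if "x \<in> carrier P" for n c x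
  proof (induction n)
    case (Suc n)
    then show ?case using T_closed that by (simp add: T_def P.act_smult_right)
  qed simp
  have T_zero: "(T ^^ n) \<zero>\<^bsub>P\<^esub> = \<zero>\<^bsub>P\<^esub>" for n
    by (induction n) (simp_all add: T_def A_zero)
  have T_more: "(T ^^ (m + n)) x = \<zero>\<^bsub>P\<^esub>" if "(T ^^ n) x = \<zero>\<^bsub>P\<^esub>" for m n x
    using that T_zero by (simp add: funpow_add)
  define N where "N = {x \<in> carrier P. \<exists>n. (T ^^ n) x = \<zero>\<^bsub>P\<^esub>}"
  have NI: "x \<in> N" if "x \<in> carrier P" "(T ^^ n) x = \<zero>\<^bsub>P\<^esub>" for x n
    using that by (auto simp: N_def)
  have sub: "submodule N CC P"
  proof (rule CC_submoduleI[OF P.M.module_axioms])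
    show "N \<subseteq> carrier P" by (auto simp: N_def)
    show "\<zero>\<^bsub>P\<^esub> \<in> N" by (rule NI[of _ 0]) simp_all
    show "x \<oplus>\<^bsub>P\<^esub> y \<in> N" if xy: "x \<in> N" "y \<in> N" for x y
    proof -
      obtain m n where *: "x \<in> carrier P" "(T ^^ m) x = \<zero>\<^bsub>P\<^esub>" "y \<in> carrier P" "(T ^^ n) y = \<zero>\<^bsub>P\<^esub>"
        using xy by (auto simp: N_def)
      have "(T ^^ (m + n)) (x \<oplus>\<^bsub>P\<^esub> y) = \<zero>\<^bsub>P\<^esub>"
        using T_more[OF *(4), of m] T_more[OF *(2), of n] T_add[OF *(1,3), of "m + n"] by (simp add: add.commute)
      then show ?thesis using *(1,3) by (intro NI) auto
    qed
    show "c \<odot>\<^bsub>P\<^esub> x \<in> N" if x: "x \<in> N" for c x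
    proof -
      obtain n where *: "x \<in> carrier P" "(T ^^ n) x = \<zero>\<^bsub>P\<^esub>" using x by (auto simp: N_def)
      then have "(T ^^ n) (c \<odot>\<^bsub>P\<^esub> x) = \<zero>\<^bsub>P\<^esub>" using T_smult by (simp add: P.M.CC_r_null)
      then show ?thesis using P.M.CC_smult_closed[OF *(1)] by (intro NI)
    qed
  qed
  let ?B = "range iW \<union> {iC2}"
  have comm: "T (A b x) = A b (T x)" if b: "b \<in> ?B" and x: "x \<in> carrier P" for b x
  proof -
    have "basis_bracket ?w b = 0" "koszul (index_parity ?w) (index_parity b) = 1"
      using b by (auto simp: koszul_def)
    then show ?thesis
      using A_commutator[OF x, of ?w b] act_zero_left[OF x] A_closed[OF A_closed[OF x]]
      by (simp add: T_def P.M.CC_one)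
  qed
  have B_N: "A b x \<in> N" if b: "b \<in> ?B" and x: "x \<in> N" for b x
  proof -
    obtain n where *: "x \<in> carrier P" "(T ^^ n) x = \<zero>\<^bsub>P\<^esub>" using x by (auto simp: N_def)
    have "(T ^^ k) (A b x) = A b ((T ^^ k) x)" for k
      by (induction k) (simp_all add: comm[OF b] T_closed *(1))
    then have "(T ^^ n) (A b x) = \<zero>\<^bsub>P\<^esub>" using *(2) by (simp add: A_zero)
    then show ?thesis by (intro NI A_closed *(1))
  qed
  \<comment> \<open>Induction on the order of nilpotency through
    \<open>T (A a x) = [W t, a] x + A a (T x)\<close>: the first term is in \<open>N\<close> by
    \<open>B_N\<close>, the second by the induction hypothesis.\<close>
  have A_N: "A a x \<in> N" if "x \<in> carrier P" "(T ^^ n) x = \<zero>\<^bsub>P\<^esub>" for a x n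
    using that
  proof (induction n arbitrary: x)
    case 0
    then show ?case using A_zero CC_submoduleD(2)[OF sub] by simp
  next
    case (Suc n)
    have "(T ^^ n) (T x) = \<zero>\<^bsub>P\<^esub>" using Suc.prems(2) by (simp add: funpow_swap1)
    then have 1: "A a (T x) \<in> N"
      using Suc.IH[of "T x"] A_closed[OF Suc.prems(1)] by (simp add: T_def)
    have xN: "x \<in> N" by (rule NI[OF Suc.prems])
    have bb: "basis_bracket ?w a \<in> sor_span ?B"
      by (cases a) (auto simp: br_defs
          intro!: sor_span_uminus sor_span_diff sor_span_add sor_span_smult sor_span_gen sor_span_0)
    have 2: "act P (basis_bracket ?w a) x \<in> N"
      by (rule act_span[OF sub bb Suc.prems(1) B_N[OF _ xN]])
    have "koszul (index_parity ?w) (index_parity a) = 1" by (simp add: koszul_def)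
    then have "T (A a x) = act P (basis_bracket ?w a) x \<oplus>\<^bsub>P\<^esub> A a (T x)"
      using A_commutator[OF Suc.prems(1), of ?w a] A_closed[OF A_closed[OF Suc.prems(1)]]
      by (simp add: T_def P.M.CC_one)
    then have "T (A a x) \<in> N" using CC_submoduleD(3)[OF sub 2 1] by simp
    then obtain m where "(T ^^ m) (T (A a x)) = \<zero>\<^bsub>P\<^esub>" by (auto simp: N_def)
    then have "(T ^^ Suc m) (A a x) = \<zero>\<^bsub>P\<^esub>" by (simp add: funpow_swap1)
    then show ?case by (intro NI A_closed Suc.prems(1))
  qed
  have "graded_submodule SOR P N"
    unfolding graded_submodule_def
  proof (intro conjI ballI sub)
    show "act P s x \<in> N" if "x \<in> N" for s x
    proof (rule act_span[OF sub])
      show "s \<in> sor_span UNIV" by (simp add: sor_span_UNIV)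
      show "x \<in> carrier P" using that by (simp add: N_def)
      show "A a x \<in> N" for a using A_N that by (auto simp: N_def)
    qed
    show "N = (N \<inter> hpart P 0) <+>\<^bsub>P\<^esub> (N \<inter> hpart P 1)"
    proof (intro equalityI subsetI)
      fix x assume "x \<in> N"
      then obtain n where x: "x \<in> carrier P" "(T ^^ n) x = \<zero>\<^bsub>P\<^esub>" by (auto simp: N_def)
      obtain a b where ab: "a \<in> hpart P 0" "b \<in> hpart P 1" "x = a \<oplus>\<^bsub>P\<^esub> b"
        using x(1) by (rule P.M.hpart_decomp)
      have c: "a \<in> carrier P" "b \<in> carrier P"
        by (rule P.M.hpart_carrier[OF ab(1)], rule P.M.hpart_carrier[OF ab(2)])
      have Th: "(T ^^ k) y \<in> hpart P i" if "y \<in> hpart P i" for k y i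
      proof (induction k)
        case (Suc k)
        then show ?case using P.act_hpart[OF gen_hpart[of ?w] Suc] by (simp only: T_def funpow.simps comp_apply index_parity.simps add_0_left)
      qed (use that in simp)
      have "(T ^^ n) a = \<zero>\<^bsub>P\<^esub>" "(T ^^ n) b = \<zero>\<^bsub>P\<^esub>"
        using P.zero_unless_homogeneous[OF Th[OF ab(1)] Th[OF ab(2)], of n n] T_add[OF c, of n] x(2) ab(3) by simp_all
      then have "a \<in> N" "b \<in> N" by (simp_all add: NI[OF c(1)] NI[OF c(2)])
      then show "x \<in> (N \<inter> hpart P 0) <+>\<^bsub>P\<^esub> (N \<inter> hpart P 1)"
        unfolding set_add_iff using ab by blast
    next
      fix x assume "x \<in> (N \<inter> hpart P 0) <+>\<^bsub>P\<^esub> (N \<inter> hpart P 1)"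
      then show "x \<in> N" unfolding set_add_iff using CC_submoduleD(3)[OF sub] by blast
    qed
  qed
  then consider "N = {\<zero>\<^bsub>P\<^esub>}" | "N = carrier P" using simple by blast
  then show ?thesis
  proof cases
    case 1
    have "v \<in> N" by (rule NI[OF v(1), of 1]) (simp add: T_def v(2))
    then show ?thesis using 1 by simp
  next
    case 2
    then obtain n where "(T ^^ n) u = \<zero>\<^bsub>P\<^esub>"
      using Sing_carrier[OF u(1)] unfolding N_def by blast
    then have "u = \<zero>\<^bsub>P\<^esub>" using u(1)
    proof (induction n arbitrary: u)
      case (Suc n)
      have "?w \<in> TS d" by simp
      then have "T u \<in> Sing d t" unfolding T_def by (rule Sing_A[OF _ Suc.prems(2)])
      then have "T u = \<zero>\<^bsub>P\<^esub>" using Suc.IH[of "T u"] Suc.prems(1) by (simp add: funpow_swap1)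
      then show ?case unfolding T_def by (rule W_inj_Sing[OF t min Suc.prems(2)])
    qed simp
    then show ?thesis using u(2) by blast
  qed
qed

end

theorem theorem5p3:
  fixes P :: "(sor, 'p) lie_supermodule"
  assumes "simple_supermodule SOR P"
    and "restricted P"
    and "\<exists>c1. acts_as_scalar P (gen iC1) c1"
    and "\<exists>c2. acts_as_scalar P (gen iC2) c2"
    and "(\<exists>k::int. k \<ge> 1 \<and> inj_on (act P (gen (iW k))) (carrier P)) \<or>
         (\<exists>c2. c2 \<noteq> 0 \<and> acts_as_scalar P (gen iC2) c2)"
  shows "\<exists>(d::nat) (t::nat) (V :: (sor set, 'p) lie_supermodule).
    simple_supermodule (qdt d t) V \<and>
    (\<exists>c1. acts_as_scalar V (quot_map d t (gen iC1)) c1) \<and>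
    (\<exists>c2. acts_as_scalar V (quot_map d t (gen iC2)) c2) \<and>
    supermodule_iso SOR P (Ind SOR (Td d) (pullback (quot_map d t) V))"
proof -
  interpret sor_module P
    using assms(1) by (intro sor_module.intro) (simp add: simple_supermodule_def)
  have simple: "N = {\<zero>\<^bsub>P\<^esub>} \<or> N = carrier P" if "graded_submodule SOR P N" for N
    using assms(1) that by (simp add: simple_supermodule_def)
  have "\<exists>v\<in>carrier P. v \<noteq> \<zero>\<^bsub>P\<^esub>"
    using assms(1) P.M.zero_closed unfolding simple_supermodule_def by blast
  then obtain v0 where v0: "v0 \<in> carrier P" "v0 \<noteq> \<zero>\<^bsub>P\<^esub>" by blast
  then obtain n where n: "\<forall>i\<ge>n. A (iL i) v0 = \<zero>\<^bsub>P\<^esub> \<and> A (iW i) v0 = \<zero>\<^bsub>P\<^esub> \<and> A (iG i) v0 = \<zero>\<^bsub>P\<^esub>"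
    using assms(2) unfolding restricted_def by blast
  \<comment> \<open>With \<open>d = 0\<close> and the parameter \<open>nat n\<close>, every index
    that the ideal contains is at least \<open>n\<close>, which is the range where restrictedness
    makes \<open>v0\<close> vanish.\<close>
  have "A a v0 = \<zero>\<^bsub>P\<^esub>" if "a \<in> SS 0 (nat n)" for a
    using that n by (cases a) (auto split: if_splits)
  then have "v0 \<in> Sing 0 (nat n)" using v0(1) by (simp add: Sing_def)
  then have ex: "\<exists>t d. \<not> Sing d t \<subseteq> {\<zero>\<^bsub>P\<^esub>}" using v0(2) by blast
  \<comment> \<open>The minimum is taken over all \<open>d\<close> simultaneously, because passing
    from \<open>t\<close> to \<open>t - 1\<close> in \<open>W_inj_Sing\<close> changes
    \<open>d\<close> to \<open>Suc d\<close>.\<close>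
  define t where "t = (LEAST t. \<exists>d. \<not> Sing d t \<subseteq> {\<zero>\<^bsub>P\<^esub>})"
  obtain d where d: "\<not> Sing d t \<subseteq> {\<zero>\<^bsub>P\<^esub>}"
    using LeastI_ex[OF ex] unfolding t_def by blast
  then obtain u where u: "u \<in> Sing d t" "u \<noteq> \<zero>\<^bsub>P\<^esub>" by blast
  have min: "Sing d' s \<subseteq> {\<zero>\<^bsub>P\<^esub>}" if "s < t" for d' s
    using not_less_Least[OF that[unfolded t_def]] by blast
  obtain c1 where c1: "acts_as_scalar P (gen iC1) c1" using assms(3) by blast
  \<comment> \<open>For \<open>t = 0\<close> every \<open>W k\<close> with \<open>k \<ge> 1\<close>
    belongs to the ideal and kills \<open>u\<close>, so the alternative with an injective
    \<open>W k\<close> is excluded and a nonzero \<open>c2\<close> must exist.\<close>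
  have "\<exists>c2. acts_as_scalar P (gen iC2) c2 \<and> (t = 0 \<longrightarrow> c2 \<noteq> 0)"
  proof (cases "\<exists>c2. c2 \<noteq> 0 \<and> acts_as_scalar P (gen iC2) c2")
    case False
    then obtain k :: int where k: "k \<ge> 1" "inj_on (A (iW k)) (carrier P)" using assms(5) by blast
    have "t \<noteq> 0"
    proof
      assume "t = 0"
      then have "iW k \<in> SS d t" using k(1) by simp
      then have "A (iW k) u = A (iW k) \<zero>\<^bsub>P\<^esub>"
        using u(1) by (simp add: Sing_def A_zero)
      then show False
        using inj_onD[OF k(2)] Sing_carrier[OF u(1)] P.M.zero_closed u(2) by blast
    qed
    then show ?thesis using assms(4) by blast
  qed blast
  then obtain c2 where c2: "acts_as_scalar P (gen iC2) c2" "t = 0 \<Longrightarrow> c2 \<noteq> 0" by blast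
  have inj: "v = \<zero>\<^bsub>P\<^esub>" if "t > 0" "v \<in> carrier P" "A (iW (int t)) v = \<zero>\<^bsub>P\<^esub>" for v
  proof (rule W_inj[OF _ that(1) _ u that(2,3)])
    show "Sing (Suc d) (t - 1) \<subseteq> {\<zero>\<^bsub>P\<^esub>}" by (rule min) (use that(1) in simp)
  qed (rule simple)
  \<comment> \<open>Stated for arbitrary \<open>W\<close>, since it is needed both for a submodule
    of \<open>Sing d t\<close> and for \<open>Sing d t\<close> itself.\<close>
  have sor: "sor_induced d P W t c1 c2" if "induced_module SOR (Td d) P W" "carrier W \<subseteq> Sing d t"
    for W :: "(sor, 'p) lie_supermodule"
    using that c1 c2 inj unfolding sor_induced_def sor_induced_axioms_def by (auto simp: Sing_def)
  let ?S = "Sing d t" and ?q = "quot_map d t"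
  \<comment> \<open>A coset acts through an arbitrarily chosen representative; the ideal kills
    \<open>Sing d t\<close>, so the choice is immaterial, as \<open>V_act\<close> records.\<close>
  define V :: "(sor set, 'p) lie_supermodule" where
    "V = pullback (\<lambda>B. SOME x. x \<in> B) (P\<lparr>carrier := ?S, hpart := \<lambda>i. hpart P i \<inter> ?S\<rparr>)"
  have V: "carrier V = ?S" "\<zero>\<^bsub>V\<^esub> = \<zero>\<^bsub>P\<^esub>" "add V = add P" "module.smult V = module.smult P"
    "hpart V = (\<lambda>i. hpart P i \<inter> ?S)"
    by (simp_all add: V_def pullback_def)
  have V_act: "act V (?q x) v = act P x v" if "x \<in> Td d" "v \<in> ?S" for x v
  proof -
    define y where "y = (SOME y. y \<in> ?q x)"
    have "x \<in> ?q x"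
      using sor_span_0[of "SS d t"] by (simp add: quot_map_mem[OF lie_SOR] flip: Sr_span)
    then have "y \<in> ?q x" unfolding y_def by (rule someI)
    then have "y - x \<in> Sr (t + d + 1) (t + 1) (t + 1)" by (simp add: quot_map_mem[OF lie_SOR])
    then have "act P (y - x) v = \<zero>\<^bsub>P\<^esub>" by (rule Sing_null[OF _ that(2)])
    then have "act P y v = act P x v"
      using P.act_add_left[of "y - x" x v] Sing_carrier[OF that(2)] P.act_closed[of x v] by simp
    then show ?thesis by (simp add: V_def pullback_def y_def)
  qed
  have M: "lie_supermodule (sub_lsa SOR (Td d)) (P\<lparr>carrier := ?S, hpart := \<lambda>i. hpart P i \<inter> ?S\<rparr>)"
    by (rule lie_supermodule_sub[OF P.lie_supermodule_axioms lie_superalgebra_Td[OF lie_SOR] _ submodule_Sing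
          Sing_graded Sing_act]) simp
  have V_module: "lie_supermodule (qdt d t) V"
    by (rule lie_supermodule_descend[OF M lie_superalgebra_qdt[OF lie_SOR], where \<pi> = ?q])
      (simp_all add: V V_act sub_lsa_def quot_map_props[OF lie_SOR])
  have "simple_supermodule (qdt d t) V"
    unfolding simple_supermodule_def
  proof (intro conjI allI impI V_module)
    show "carrier V \<noteq> {\<zero>\<^bsub>V\<^esub>}" using u unfolding V by blast
    show "N = {\<zero>\<^bsub>V\<^esub>} \<or> N = carrier V" if N: "graded_submodule (qdt d t) V N" for N
    proof (unfold disj_imp, rule impI)
      assume nz: "N \<noteq> {\<zero>\<^bsub>V\<^esub>}"
      have NV: "submodule N CC V" "N = (N \<inter> hpart V 0) <+>\<^bsub>V\<^esub> (N \<inter> hpart V 1)"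
        and NA: "\<And>B v. B \<in> carrier (qdt d t) \<Longrightarrow> v \<in> N \<Longrightarrow> act V B v \<in> N"
        using N unfolding graded_submodule_def by blast+
      have NS: "N \<subseteq> ?S" using CC_submoduleD(1)[OF NV(1)] V(1) by blast
      have NP: "submodule N CC P"
        using CC_submoduleD[OF NV(1)] subset_trans[OF NS subsetI[OF Sing_carrier]]
        by (intro CC_submoduleI[OF P.M.module_axioms]) (auto simp: V)
      have eq: "(N \<inter> hpart V 0) <+>\<^bsub>V\<^esub> (N \<inter> hpart V 1) \<subseteq> (N \<inter> hpart P 0) <+>\<^bsub>P\<^esub> (N \<inter> hpart P 1)"
        unfolding subset_iff set_add_iff V(3,5) by blast
      have NT: "act P x v \<in> N" if "x \<in> Td d" "v \<in> N" for x v
        using NA[of "?q x" v] that NS V_act[of x v] by (auto simp: carrier_qdt[OF lie_SOR])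
      define W where "W = P\<lparr>carrier := N, hpart := \<lambda>i. hpart P i \<inter> N\<rparr>"
      have "induced_module SOR (Td d) P W"
        by (rule induced_module_sub[OF NP _ NT]) (use NV(2) eq in \<open>simp_all add: W_def\<close>)
      then interpret W: sor_induced d P W t c1 c2
        by (rule sor) (simp add: W_def NS)
      have "carrier W \<noteq> {\<zero>\<^bsub>P\<^esub>}" using nz by (simp add: W_def V)
      \<comment> \<open>Since \<open>P\<close> is simple, it is the image of the module induced from
        \<open>N\<close>. So \<open>v\<close> has the form \<open>W.f x\<close>, and as it is killed
        by the ideal, \<open>singular_mem\<close> places it in \<open>N\<close>.\<close>
      have "v \<in> N" if v: "v \<in> ?S" for v
      proof -
        obtain x where x: "v = W.f x"
          using W.f_surj[OF simple \<open>carrier W \<noteq> {\<zero>\<^bsub>P\<^esub>}\<close> Sing_carrier[OF v]] by blast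
        have "W.f x \<in> carrier W"
          by (rule W.singular_mem) (use v in \<open>simp add: x Sing_def\<close>)
        then show ?thesis by (simp add: x W_def)
      qed
      then show "N = carrier V" using NS V(1) by blast
    qed
    show "\<exists>B\<in>carrier (qdt d t). \<exists>v\<in>carrier V. act V B v \<noteq> \<zero>\<^bsub>V\<^esub>"
    proof -
      \<comment> \<open>An element of \<open>Td d\<close> that acts injectively witnesses the
        nontrivial action: the nonzero scalar \<open>C2\<close> for \<open>t = 0\<close>, and
        \<open>W t\<close> otherwise.\<close>
      define a where "a = (if t = 0 then iC2 else iW (int t))"
      have "A a u \<noteq> \<zero>\<^bsub>P\<^esub>"
      proof (cases "t = 0")
        case True
        have "A iC2 u = c2 \<odot>\<^bsub>P\<^esub> u" using c2(1) Sing_carrier[OF u(1)] by (simp add: acts_as_scalar_def)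
        moreover have "c2 \<odot>\<^bsub>P\<^esub> u \<noteq> \<zero>\<^bsub>P\<^esub>"
        proof
          assume "c2 \<odot>\<^bsub>P\<^esub> u = \<zero>\<^bsub>P\<^esub>"
          then have "(1 / c2 * c2) \<odot>\<^bsub>P\<^esub> u = \<zero>\<^bsub>P\<^esub>"
            using P.M.CC_assoc[OF Sing_carrier[OF u(1)], of "1 / c2" c2] by (simp add: P.M.CC_r_null)
          then show False using c2(2)[OF True] u P.M.CC_one[OF Sing_carrier[OF u(1)]] by simp
        qed
        ultimately show ?thesis using True by (simp add: a_def)
      next
        case False
        then show ?thesis using inj[OF _ Sing_carrier[OF u(1)]] u(2) by (auto simp: a_def)
      qed
      moreover have "gen a \<in> Td d" unfolding Td_span by (rule sor_span_gen) (simp add: a_def)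
      ultimately show ?thesis
        using V_act[of "gen a" u] u(1) unfolding carrier_qdt[OF lie_SOR] V by (metis imageI)
    qed
  qed
  moreover have "acts_as_scalar V (?q (gen C)) c"
    if "C \<in> {iC1, iC2}" "acts_as_scalar P (gen C) c" for C c
  proof -
    have "gen C \<in> Td d" unfolding Td_span by (rule sor_span_gen) (use that(1) in auto)
    then show ?thesis using that(2) V_act Sing_carrier by (simp add: acts_as_scalar_def V)
  qed
  then have "acts_as_scalar V (?q (gen iC1)) c1" "acts_as_scalar V (?q (gen iC2)) c2"
    using c1 c2(1) by blast+
  moreover have "supermodule_iso SOR P (Ind SOR (Td d) (pullback ?q V))"
  proof -
    have pb: "carrier (pullback ?q V) = ?S"
      by (simp add: pullback_def V)
    have "induced_module SOR (Td d) P (pullback ?q V)"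
    proof (rule induced_module_sub[OF submodule_Sing Sing_graded Sing_act])
      show "act (pullback ?q V) x v = act P x v" if "x \<in> Td d" "v \<in> ?S" for x v
        using V_act[OF that] by (simp add: pullback_def)
    qed (simp_all add: pullback_def V)
    then interpret I: sor_induced d P "pullback ?q V" t c1 c2
      by (rule sor) (simp add: pb)
    show ?thesis
    proof (rule I.supermodule_iso_Ind[OF simple _ I.f_inj])
      show "carrier (pullback ?q V) \<noteq> {\<zero>\<^bsub>P\<^esub>}" using u unfolding pb by blast
    qed
  qed
  ultimately show ?thesis by blast
qed

end
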